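(* Let $Y_f^\eta(t)=\sum_{i=1}^{N_f(t)}X_i$, $t\ge0$, where the iid jumps $X_i$ are exponentially distributed with parameter $\eta>0$. Then the probability density function $P^\eta_f(x,t)$, $x>0$, of $Y_f^\eta(t)$ satisfies the fractional differential equation $$\eta\,\mathcal{D}^f_t P^\eta_f(x,t)=-\left[\lambda+\mathcal{D}^f_t\right]\frac{\partial}{\partial x}P^\eta_f(x,t),$$ with the conditions $$P^\eta_f(x,0)=0,\qquad \mathbb{P}(Y_f^\eta(t)>0)=1-\mathbb{E}[e^{-\lambda E_f(t)}].$$
   Context: Let $f(s)=bs+\int_0^\infty(1-e^{-sx})\,\nu(dx)$, $s>0$, with $b\ge 0$ and $\nu$ a non-negative L\'evy measure on $(0,\infty)$ with $\int_0^\infty (x\wedge 1)\,\nu(dx)<\infty$ and $\nu((0,\infty))=\infty$. Let $\{D_f(t)\}_{t\ge0}$ be the L\'evy subordinator with $\mathbb{E}[e^{-sD_f(t)}]=e^{-tf(s)}$ and $E_f(t)=\inf\{r\ge0: D_f(r)>t\}$ its inverse. Let $\{N(t)\}_{t\ge0}$ be a Poisson process with rate $\lambda>0$ independent of $\{E_f(t)\}$, and $N_f(t)=N(E_f(t))$. The iid jumps $X_i$ are independent of $N$ and $E_f$, and an empty sum is $0$. Thus $Y_f^\eta(t)$ has an atom at $0$, and $P_f^\eta(x,t)$ denotes the density of its law on $(0,\infty)$. The generalized Caputo–Djrbashian derivative with respect to $f$ is, for absolutely continuous $u$, $$\mathcal{D}^f_t u(t)=b\frac{d}{dt}u(t)+\int_0^t\frac{\partial}{\partial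 t}u(t-s)\,\bar\nu(s)\,ds,\qquad \bar\nu(s)=\nu((s,\infty)).$$
   Formalization: The equation is shown for each x>0 and almost every t>0, assuming P(x,·) and its x-derivative are locally absolutely continuous in t; without this it can fail, e.g. b=0 and ν the sum of unit masses at (k!)^{-3}, where P(x,·) is singular. *)

theory Defs
  imports "HOL-Probability.Probability"
begin

definition levy_measure_pos :: "real measure \<Rightarrow> bool" where
  "levy_measure_pos \<nu> \<longleftrightarrow>
     sets \<nu> = sets borel \<and> emeasure \<nu> {..0} = 0 \<and>
     (\<integral>\<^sup>+x\<in>{0<..}. ennreal (min x 1) \<partial>\<nu>) < \<infinity> \<and>
     emeasure \<nu> {0<..} = \<infinity>"

definition bernstein_fun :: "real \<Rightarrow> real measure \<Rightarrow> real \<Rightarrow> real" where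
  "bernstein_fun b \<nu> s = b * s + (LINT x:{0<..}|\<nu>. 1 - exp (- s * x))"

definition levy_tail :: "real measure \<Rightarrow> real \<Rightarrow> real" where
  "levy_tail \<nu> s = measure \<nu> {s<..}"

definition independent_increments :: "'a measure \<Rightarrow> (real \<Rightarrow> 'a \<Rightarrow> real) \<Rightarrow> bool" where
  "independent_increments M Z \<longleftrightarrow>
     (\<forall>(n::nat) ts. 0 \<le> ts 0 \<and> (\<forall>i<n. ts i < ts (Suc i)) \<longrightarrow>
        prob_space.indep_vars M (\<lambda>_. borel) (\<lambda>i \<omega>. Z (ts (Suc i)) \<omega> - Z (ts i) \<omega>) {..<n})"

text \<open>Paths are nondecreasing and right-continuous for every outcome (left limits then exist).\<close>

definition increasing_rcont_paths :: "'a measure \<Rightarrow> (real \<Rightarrow> 'a \<Rightarrow> real) \<Rightarrow> bool" where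
  "increasing_rcont_paths M Z \<longleftrightarrow>
     (\<forall>\<omega>\<in>space M. mono_on {0..} (\<lambda>t. Z t \<omega>) \<and>
        (\<forall>t\<ge>0. continuous (at_right t) (\<lambda>t. Z t \<omega>)))"

definition levy_subordinator :: "'a measure \<Rightarrow> (real \<Rightarrow> 'a \<Rightarrow> real) \<Rightarrow> bool" where
  "levy_subordinator M D \<longleftrightarrow>
     (\<forall>t\<ge>0. D t \<in> borel_measurable M) \<and>
     (AE \<omega> in M. D 0 \<omega> = 0) \<and>
     independent_increments M D \<and>
     (\<forall>s\<ge>0. \<forall>h\<ge>0. distr M borel (\<lambda>\<omega>. D (s + h) \<omega> - D s \<omega>) = distr M borel (D h)) \<and>
     increasing_rcont_paths M D"

definition poisson_process :: "'a measure \<Rightarrow> real \<Rightarrow> (real \<Rightarrow> 'a \<Rightarrow> nat) \<Rightarrow> bool" where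
  "poisson_process M rate N \<longleftrightarrow>
     (\<forall>t\<ge>0. N t \<in> measurable M (count_space UNIV)) \<and>
     (AE \<omega> in M. N 0 \<omega> = 0) \<and>
     independent_increments M (\<lambda>t \<omega>. real (N t \<omega>)) \<and>
     (\<forall>s\<ge>0. \<forall>h>0. distr M (count_space UNIV) (\<lambda>\<omega>. N (s + h) \<omega> - N s \<omega>)
                      = measure_pmf (poisson_pmf (rate * h))) \<and>
     increasing_rcont_paths M (\<lambda>t \<omega>. real (N t \<omega>))"

text \<open>The set below is almost surely nonempty for an unbounded subordinator.  Its infimum over the
  reals is an unspecified number when it is empty, so the value 0 is used on that null event.\<close>

definition inverse_subordinator :: "(real \<Rightarrow> 'a \<Rightarrow> real) \<Rightarrow> real \<Rightarrow> 'a \<Rightarrow> real" where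
  "inverse_subordinator D t \<omega> =
     (if \<exists>r\<ge>0. D r \<omega> > t then Inf {r. r \<ge> 0 \<and> D r \<omega> > t} else 0)"

definition process_sigma ::
    "'a measure \<Rightarrow> 'b measure \<Rightarrow> 'i set \<Rightarrow> ('i \<Rightarrow> 'a \<Rightarrow> 'b) \<Rightarrow> 'a set set" where
  "process_sigma M S I Z =
     sigma_sets (space M) (\<Union>i\<in>I. {Z i -` A \<inter> space M | A. A \<in> sets S})"

definition compound_process ::
    "(real \<Rightarrow> 'a \<Rightarrow> nat) \<Rightarrow> (real \<Rightarrow> 'a \<Rightarrow> real) \<Rightarrow> (nat \<Rightarrow> 'a \<Rightarrow> real) \<Rightarrow> real \<Rightarrow> 'a \<Rightarrow> real" where
  "compound_process N E X t \<omega> = (\<Sum>i=1..N (E t \<omega>) \<omega>. X i \<omega>)"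

text \<open>The law of \<open>Y\<close> may have an atom at 0, so \<open>p\<close> describes it on the positive half-line only.
  Continuity singles out one version of the density: \<open>p\<close> is then unique on the positive half-line.\<close>

definition has_continuous_pdf_pos :: "'a measure \<Rightarrow> ('a \<Rightarrow> real) \<Rightarrow> (real \<Rightarrow> real) \<Rightarrow> bool" where
  "has_continuous_pdf_pos M Y p \<longleftrightarrow>
     Y \<in> borel_measurable M \<and> continuous_on {0<..} p \<and> (\<forall>x>0. p x \<ge> 0) \<and>
     (\<forall>A\<in>sets borel. A \<subseteq> {0<..} \<longrightarrow>
        emeasure M (Y -` A \<inter> space M) = (\<integral>\<^sup>+x\<in>A. ennreal (p x) \<partial>lborel))"

definition abs_continuous_on_interval :: "real \<Rightarrow> real \<Rightarrow> (real \<Rightarrow> real) \<Rightarrow> bool" where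
  "abs_continuous_on_interval l r u \<longleftrightarrow>
     (\<forall>\<epsilon>>0. \<exists>\<delta>>0. \<forall>(n::nat) a c.
        (\<forall>i<n. l \<le> a i \<and> a i \<le> c i \<and> c i \<le> r) \<and>
        disjoint_family_on (\<lambda>i. {a i<..<c i}) {..<n} \<and>
        (\<Sum>i<n. c i - a i) < \<delta>
        \<longrightarrow> (\<Sum>i<n. \<bar>u (c i) - u (a i)\<bar>) < \<epsilon>)"

definition loc_abs_continuous :: "(real \<Rightarrow> real) \<Rightarrow> bool" where
  "loc_abs_continuous u \<longleftrightarrow> (\<forall>T>0. abs_continuous_on_interval 0 T u)"

text \<open>Generalized Caputo--Djrbashian derivative.  For an absolutely continuous \<open>u\<close> the derivative of
  \<open>u\<close> exists almost everywhere only, hence the operator is defined for almost every \<open>t\<close>.  The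
  integral is taken with respect to the completed measure because \<open>deriv u\<close> is arbitrary on the
  exceptional null set.\<close>

definition CD_deriv :: "real \<Rightarrow> real measure \<Rightarrow> (real \<Rightarrow> real) \<Rightarrow> real \<Rightarrow> real" where
  "CD_deriv b \<nu> u t =
     b * deriv u t + (LINT s:{0<..<t}|lebesgue. deriv (\<lambda>\<tau>. u (\<tau> - s)) t * levy_tail \<nu> s)"

definition CD_defined :: "real measure \<Rightarrow> (real \<Rightarrow> real) \<Rightarrow> real \<Rightarrow> bool" where
  "CD_defined \<nu> u t \<longleftrightarrow>
     u differentiable (at t) \<and>
     set_integrable lebesgue {0<..<t} (\<lambda>s. deriv (\<lambda>\<tau>. u (\<tau> - s)) t * levy_tail \<nu> s)"

end

(* For a Poisson process independent of the inverse E of the subordinator D, the event N(E(t)) > n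
   means that D, evaluated at the (n+1)-st Poisson jump time, is at most t.  So if rho_n is the law
   of D at an independent Erlang(n+1, lam) time, then q_n(t) = P(N(E(t)) = n) equals
   rho_{n-1}[0,t] - rho_n[0,t] (with rho_{-1} the unit mass at 0), and the density is the power series
   P(x,t) = sum_n q_{n+1}(t) erlang_n(x).  The Laplace transform of rho_n is theta^(n+1) with
   theta = lam / (lam + f).  As f(s)/s is the Laplace transform of b delta_0 + nu((s,oo)) ds,
   uniqueness of Laplace transforms gives the identity of measures
     b rho_n + nu((.,oo)) * rho_n = lam q_n(t) dt.
   Both P(x,.) and its x-derivative are differences of distribution functions of mixtures of the
   rho_n.  When such a difference is locally absolutely continuous, the singular parts of the two
   mixtures cancel, and Lebesgue's differentiation theorem (obtained from the Vitali covering
   theorem) turns the identity of measures into the value of the Caputo-Djrbashian derivative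
   at almost every t.  The equation then follows by comparing coefficients of the series. *)

theory Submission
  imports Defs
begin

text \<open>No density is available for the single laws \<rho>_n, so the functions q_n need not be
  absolutely continuous and the series cannot be differentiated in t term by term; regularity is
  assumed only for P(x,.) and its x-derivative as whole sums. The analysis in t is therefore carried
  out on finite positive measures: each sum is split by the sign of its coefficients into two
  mixtures of the \<rho>_n. Identities are tested against functions with values in
  \<open>ennreal\<close> and kept as sums on both sides, until finiteness almost everywhere permits
  subtraction. Formally the fractional operator sends the distribution function of \<rho>_n to lam
  q_n, that is, it lowers an index by one, while the x-derivative of the Erlang series raises it by
  one. This interplay of shifts is the equation. The infinite mass of \<nu> makes f unbounded, hence
  D(r) > 0 almost surely for r > 0. This keeps all \<rho>_n away from 0 and gives E(0) = 0, which is
  the initial condition.\<close>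

section \<open>Lebesgue differentiation on the line\<close>

text \<open>Where g stays below \<alpha>, a ball whose integral of g exceeds \<beta> times its
  length must collect more than \<beta> - \<alpha> times its length from points outside that set.
  This excess is controlled by a finite measure not charging the set, hence small on some open
  superset, and disjoint Vitali balls inside the superset bound the size of the exceptional set. The
  balls need only contain t, not be centred there; this later covers one-sided difference
  quotients.\<close>

lemma negligible_upper_density_points:
  fixes g :: "real \<Rightarrow> real"
  assumes g: "integrable lborel g" and ab: "\<alpha> < \<beta>"
  shows "negligible {t. g t < \<alpha> \<and>
    (\<forall>d>0. \<exists>m r. 0 < r \<and> r < d \<and> t \<in> cball m r \<and> \<beta> * (2 * r) < (LINT y:cball m r|lborel. g y))}"
    (is "negligible ?S")
proof -
  have [measurable]: "g \<in> borel_measurable borel"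
    using borel_measurable_integrable[OF g] by simp
  define H where "H = {y. g y < \<alpha>}"
  have [measurable]: "H \<in> sets borel" unfolding H_def by measurable
  have "negligible (?S \<inter> {- real n<..<real n})" for n :: nat
    unfolding negligible_outer_le
  proof (intro allI impI)
    fix e :: real assume e: "e > 0"
    define J where "J = {- real n<..<real n}"
    have [measurable]: "J \<in> sets borel" by (simp add: J_def)
    \<comment> \<open>Off \<open>H\<close> the weight dominates g - \<alpha>. The bounded window
      \<open>J\<close> makes the measure finite, as outer regularity requires.\<close>
    define m where "m = density lborel (\<lambda>y. ennreal (indicator (J - H) y * (\<bar>g y\<bar> + \<bar>\<alpha>\<bar>)))"
    have sm: "sets m = sets borel" by (simp add: m_def)
    have intJ: "integrable lborel (\<lambda>y. indicator (J - H) y * (\<bar>g y\<bar> + \<bar>\<alpha>\<bar>))"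
    proof -
      have "integrable lborel (\<lambda>y. \<bar>g y\<bar> + indicator {- real n..real n} y * \<bar>\<alpha>\<bar>)"
        using g by (intro Bochner_Integration.integrable_add integrable_abs integrable_mult_left integrable_real_indicator) auto
      then show ?thesis
        by (rule Bochner_Integration.integrable_bound) (auto simp: J_def indicator_def)
    qed
    have fin: "emeasure m (space m) \<noteq> \<infinity>"
      using intJ by (simp add: m_def emeasure_density nn_integral_eq_integral)
    have "emeasure m (H \<inter> J) = 0"
      by (auto simp: m_def emeasure_density nn_integral_0_iff_AE indicator_def)
    then have "(INF U \<in> {U. H \<inter> J \<subseteq> U \<and> open U}. emeasure m U) < ennreal (e * (\<beta> - \<alpha>))"
      using outer_regular[OF sm fin, of "H \<inter> J"] e ab by simp
    then obtain U where U: "H \<inter> J \<subseteq> U" "open U" "emeasure m U < ennreal (e * (\<beta> - \<alpha>))"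
      unfolding INF_less_iff by auto
    define K where "K = {(c, r). 0 < r \<and> cball c r \<subseteq> U \<inter> J \<and> \<beta> * (2 * r) < (LINT y:cball c r|lborel. g y)}"
    have vit: "\<exists>i. i \<in> K \<and> x \<in> cball (fst i) (snd i) \<and> snd i < d" if x: "x \<in> ?S \<inter> J" and d: "d > 0" for x d
    proof -
      have "open (U \<inter> J)" "x \<in> U \<inter> J" using U x by (auto simp: J_def H_def)
      then obtain \<rho> where \<rho>: "\<rho> > 0" "ball x \<rho> \<subseteq> U \<inter> J" by (meson openE)
      obtain c r where cr: "0 < r" "r < min d (\<rho>/2)" "x \<in> cball c r" "\<beta> * (2 * r) < (LINT y:cball c r|lborel. g y)"
        using x d \<rho>(1) by (auto dest!: spec[of _ "min d (\<rho>/2)"])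
      have "cball c r \<subseteq> ball x \<rho>" using cr by (auto simp: dist_real_def)
      then show ?thesis using cr \<rho> by (intro exI[of _ "(c,r)"]) (auto simp: K_def)
    qed
    obtain C where C: "countable C" "C \<subseteq> K"
      "pairwise (\<lambda>i j. disjnt (cball (fst i) (snd i)) (cball (fst j) (snd j))) C"
      "negligible (?S \<inter> J - (\<Union>i \<in> C. cball (fst i) (snd i)))"
    proof (rule Vitali_covering_theorem_cballs[of K snd "?S \<inter> J" fst])
      show "0 < snd i" if "i \<in> K" for i using that by (auto simp: K_def)
    qed (use vit in blast)+
    define W where "W = (\<Union>i \<in> C. cball (fst i) (snd i))"
    have each: "ennreal (\<beta> - \<alpha>) * emeasure lborel (cball c r) \<le> emeasure m (cball c r)" if "(c, r) \<in> K" for c r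
    proof -
      have r: "0 < r" "cball c r \<subseteq> J" "\<beta> * (2 * r) < (LINT y:cball c r|lborel. g y)" using that by (auto simp: K_def)
      have 1: "set_integrable lborel (cball c r) g" using g unfolding set_integrable_def
        by (intro integrable_mult_indicator) auto
      have i1: "set_integrable lborel (cball c r) (\<lambda>_. \<alpha>)"
        unfolding set_integrable_def real_scaleR_def
        by (intro integrable_mult_left integrable_real_indicator) (use emeasure_bounded_finite[OF bounded_cball] in \<open>auto simp: less_top\<close>)
      have i2: "set_integrable lborel (cball c r) (\<lambda>y. indicator (J - H) y * (\<bar>g y\<bar> + \<bar>\<alpha>\<bar>))"
        unfolding set_integrable_def by (intro integrable_mult_indicator intJ) auto
      note 2 = set_integral_add(1)[OF i1 i2]
      have c: "(LINT y:cball c r|lborel. \<alpha>) = \<alpha> * (2 * r)"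
        using r(1) by (simp add: set_lebesgue_integral_def cball_eq_atLeastAtMost)
      have "(LINT y:cball c r|lborel. g y) \<le> (LINT y:cball c r|lborel. \<alpha> + indicator (J - H) y * (\<bar>g y\<bar> + \<bar>\<alpha>\<bar>))"
        using r(2) by (intro set_integral_mono[OF 1 2]) (auto simp: H_def indicator_def)
      also have "\<dots> = \<alpha> * (2 * r) + (LINT y:cball c r|lborel. indicator (J - H) y * (\<bar>g y\<bar> + \<bar>\<alpha>\<bar>))"
        by (simp add: set_integral_add(2)[OF i1 i2] c)
      finally have *: "(\<beta> - \<alpha>) * (2 * r) \<le> (LINT y:cball c r|lborel. indicator (J - H) y * (\<bar>g y\<bar> + \<bar>\<alpha>\<bar>))"
        using r by (simp add: algebra_simps)
      have "emeasure m (cball c r) = (\<integral>\<^sup>+y. ennreal (indicator (cball c r) y * (indicator (J - H) y * (\<bar>g y\<bar> + \<bar>\<alpha>\<bar>))) \<partial>lborel)"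
        unfolding m_def by (subst emeasure_density) (auto intro!: nn_integral_cong simp: indicator_def)
      also have "\<dots> = ennreal (LINT y:cball c r|lborel. indicator (J - H) y * (\<bar>g y\<bar> + \<bar>\<alpha>\<bar>))"
        unfolding set_lebesgue_integral_def
        by (subst nn_integral_eq_integral) (auto intro!: integrable_mult_indicator[where 'b=real, simplified] intJ)
      finally show ?thesis using * r ab
        by (simp add: cball_eq_atLeastAtMost ennreal_mult'[symmetric] ennreal_leI)
    qed
    have disj: "disjoint_family_on (\<lambda>i. cball (fst i) (snd i)) C"
      using C(3) by (auto simp: disjoint_family_on_def pairwise_def disjnt_def)
    have "ennreal (\<beta> - \<alpha>) * emeasure lborel W = (\<integral>\<^sup>+i. ennreal (\<beta> - \<alpha>) * emeasure lborel (cball (fst i) (snd i)) \<partial>count_space C)"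
      unfolding W_def using C(1) disj by (subst emeasure_UN_countable) (auto simp: nn_integral_cmult)
    also have "\<dots> \<le> (\<integral>\<^sup>+i. emeasure m (cball (fst i) (snd i)) \<partial>count_space C)"
      using C(2) each by (intro nn_integral_mono) auto
    also have "\<dots> = emeasure m W"
      unfolding W_def using C(1) disj by (subst emeasure_UN_countable) (auto simp: sm)
    also have "\<dots> \<le> emeasure m U"
    proof (rule emeasure_mono)
      show "W \<subseteq> U"
      proof
        fix x assume "x \<in> W"
        then obtain c r where "(c, r) \<in> C" and x: "x \<in> cball c r" by (auto simp: W_def)
        then have "cball c r \<subseteq> U" using C(2) unfolding K_def by blast
        with x show "x \<in> U" by blast
      qed
    qed (use U in \<open>auto simp: sm\<close>)
    also have "\<dots> \<le> ennreal (e * (\<beta> - \<alpha>))" using U by simp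
    finally have le: "ennreal (\<beta> - \<alpha>) * emeasure lborel W \<le> ennreal (\<beta> - \<alpha>) * ennreal e"
      using ab e by (simp add: ennreal_mult'[symmetric] mult.commute)
    then have We: "emeasure lborel W \<le> ennreal e"
      using ab by (subst (asm) ennreal_mult_le_mult_iff) auto
    have Wm: "W \<in> sets borel" unfolding W_def using C(1) by auto
    have WL: "W \<in> lmeasurable"
      using We Wm by (auto simp: fmeasurable_def le_less_trans)
    have Wle: "measure lebesgue W \<le> e"
      using We Wm e unfolding measure_def by (auto simp: enn2real_leI)
    let ?T = "W \<union> (?S \<inter> J - W)"
    show "\<exists>T. ?S \<inter> {- real n<..<real n} \<subseteq> T \<and> T \<in> lmeasurable \<and> measure lebesgue T \<le> e"
    proof (intro exI conjI)
      show "?S \<inter> {- real n<..<real n} \<subseteq> ?T" by (auto simp: J_def)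
      have neg: "negligible (?S \<inter> J - W)" using C(4) by (simp add: W_def)
      show "?T \<in> lmeasurable" using WL negligible_imp_measurable[OF neg] by (intro fmeasurable.Un)
      show "measure lebesgue ?T \<le> e"
        using measure_Un_le[of W lebesgue "?S \<inter> J - W"] WL negligible_imp_measurable[OF neg] negligible_imp_measure0[OF neg] Wle
        by (auto simp: fmeasurable_def)
    qed
  qed
  then have "negligible (\<Union>n. ?S \<inter> {- real n<..<real n})" by (intro negligible_countable_Union) auto
  moreover have "?S \<subseteq> (\<Union>n. ?S \<inter> {- real n<..<real n})"
  proof
    fix x assume x: "x \<in> ?S"
    obtain n :: nat where "\<bar>x\<bar> < real n" using reals_Archimedean2 by blast
    then have "x \<in> {- real n<..<real n}" by auto
    with x show "x \<in> (\<Union>n. ?S \<inter> {- real n<..<real n})" by blast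
  qed
  ultimately show ?thesis by (rule negligible_subset)
qed

text \<open>Two rationals strictly between g t and \<beta> reduce the uncountable family of
  thresholds to countably many negligible sets.\<close>

lemma AE_lborel_upper_density:
  fixes g :: "real \<Rightarrow> real"
  assumes g: "integrable lborel g"
  shows "AE t in lborel. \<forall>\<beta>>g t. \<exists>d>0. \<forall>m r. 0 < r \<longrightarrow> r < d \<longrightarrow> t \<in> cball m r \<longrightarrow>
           (LINT y:cball m r|lborel. g y) \<le> \<beta> * (2 * r)"
proof -
  let ?S = "\<lambda>\<alpha> \<beta>. {t. g t < \<alpha> \<and>
    (\<forall>d>0. \<exists>m r. 0 < r \<and> r < d \<and> t \<in> cball m r \<and> \<beta> * (2 * r) < (LINT y:cball m r|lborel. g y))}"
  have "negligible (\<Union>(\<alpha>, \<beta>) \<in> {p. fst p \<in> \<rat> \<and> snd p \<in> \<rat> \<and> fst p < snd p}. ?S \<alpha> \<beta>)"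
  proof (intro negligible_countable_Union)
    have "{p. fst p \<in> \<rat> \<and> snd p \<in> \<rat> \<and> fst p < snd p} \<subseteq> (\<rat> \<times> \<rat> :: (real \<times> real) set)" by auto
    then have "countable {p. fst p \<in> (\<rat>::real set) \<and> snd p \<in> \<rat> \<and> fst p < snd p}"
      by (rule countable_subset) (intro countable_SIGMA countable_rat)
    then show "countable ((\<lambda>(\<alpha>, \<beta>). ?S \<alpha> \<beta>) ` {p. fst p \<in> \<rat> \<and> snd p \<in> \<rat> \<and> fst p < snd p})" by (rule countable_image)
  qed (use negligible_upper_density_points[OF g] in auto)
  then have "AE t in lebesgue. t \<notin> (\<Union>(\<alpha>, \<beta>) \<in> {p. fst p \<in> \<rat> \<and> snd p \<in> \<rat> \<and> fst p < snd p}. ?S \<alpha> \<beta>)"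
    unfolding negligible_iff_null_sets by (rule AE_not_in)
  then have "AE t in lborel. t \<notin> (\<Union>(\<alpha>, \<beta>) \<in> {p. fst p \<in> \<rat> \<and> snd p \<in> \<rat> \<and> fst p < snd p}. ?S \<alpha> \<beta>)"
    by (simp add: AE_completion_iff)
  then show ?thesis
  proof (eventually_elim, intro allI impI)
    fix t \<beta> assume t: "t \<notin> (\<Union>(\<alpha>, \<beta>) \<in> {p. fst p \<in> \<rat> \<and> snd p \<in> \<rat> \<and> fst p < snd p}. ?S \<alpha> \<beta>)" and b: "g t < \<beta>"
    obtain a where a: "a \<in> \<rat>" "g t < a" "a < \<beta>" using Rats_dense_in_real[OF b] by auto
    obtain b' where b': "b' \<in> \<rat>" "a < b'" "b' < \<beta>" using Rats_dense_in_real[OF a(3)] by auto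
    have "t \<notin> ?S a b'" using t a b' by (auto dest!: bspec[of _ _ "(a,b')"])
    then obtain d where d: "d > 0" "\<And>m r. 0 < r \<Longrightarrow> r < d \<Longrightarrow> t \<in> cball m r \<Longrightarrow> (LINT y:cball m r|lborel. g y) \<le> b' * (2 * r)"
      using a(2) unfolding mem_Collect_eq de_Morgan_conj not_all not_ex not_imp not_less
      by (metis not_less)
    show "\<exists>d>0. \<forall>m r. 0 < r \<longrightarrow> r < d \<longrightarrow> t \<in> cball m r \<longrightarrow> (LINT y:cball m r|lborel. g y) \<le> \<beta> * (2 * r)"
    proof (intro exI[of _ d] conjI allI impI d(1))
      fix m r assume "0 < r" "r < d" "t \<in> cball m r"
      then have "(LINT y:cball m r|lborel. g y) \<le> b' * (2 * r)" by (rule d(2))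
      also have "\<dots> \<le> \<beta> * (2 * r)" using b' \<open>0 < r\<close> by (intro mult_right_mono) auto
      finally show "(LINT y:cball m r|lborel. g y) \<le> \<beta> * (2 * r)" .
    qed
  qed
qed

text \<open>The upper density bound is applied to g and to -g. An interval with end point t is an
  uncentred ball containing t, so increments on either side of t are treated alike.\<close>

theorem AE_lborel_indefinite_integral_has_derivative:
  fixes g :: "real \<Rightarrow> real"
  assumes g: "integrable lborel g"
  shows "AE t in lborel. ((\<lambda>\<tau>. LINT y:{..\<tau>}|lborel. g y) has_real_derivative g t) (at t)"
proof -
  have mg: "integrable lborel (\<lambda>y. - g y)" using g by simp
  let ?F = "\<lambda>\<tau>. LINT y:{..\<tau>}|lborel. g y"
  have si: "set_integrable lborel A g" if "A \<in> sets borel" for A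
    using that g unfolding set_integrable_def by (intro integrable_mult_indicator) auto
  have incr: "?F c - ?F a = (LINT y:cball ((a+c)/2) ((c-a)/2)|lborel. g y)" if "a \<le> c" for a c
  proof -
    have "{..c} = {..a} \<union> {a<..c}" using that by auto
    then have "?F c = ?F a + (LINT y:{a<..c}|lborel. g y)"
      using set_integral_Un[of "{..a}" "{a<..c}" lborel g] si by (simp add: ivl_disj_int)
    moreover have "(LINT y:{a<..c}|lborel. g y) = (LINT y:{a..c}|lborel. g y)"
      unfolding set_lebesgue_integral_def using AE_lborel_singleton[of a]
      by (intro integral_cong_AE) (use borel_measurable_integrable[OF g] in \<open>auto simp: indicator_def\<close>)
    moreover have "cball ((a+c)/2) ((c-a)/2) = {a..c}" by (auto simp: cball_eq_atLeastAtMost field_simps)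
    ultimately show ?thesis by simp
  qed
  from AE_lborel_upper_density[OF g] AE_lborel_upper_density[OF mg]
  show ?thesis
  proof eventually_elim
    fix t
    assume up: "\<forall>\<beta>>g t. \<exists>d>0. \<forall>m r. 0 < r \<longrightarrow> r < d \<longrightarrow> t \<in> cball m r \<longrightarrow> (LINT y:cball m r|lborel. g y) \<le> \<beta> * (2 * r)"
    assume lo: "\<forall>\<beta>>- g t. \<exists>d>0. \<forall>m r. 0 < r \<longrightarrow> r < d \<longrightarrow> t \<in> cball m r \<longrightarrow> (LINT y:cball m r|lborel. - g y) \<le> \<beta> * (2 * r)"
    show "(?F has_real_derivative g t) (at t)"
      unfolding has_field_derivative_iff
    proof (rule LIM_I)
      fix e :: real assume e: "0 < e"
      obtain d1 where d1: "d1 > 0" "\<And>m r. 0 < r \<Longrightarrow> r < d1 \<Longrightarrow> t \<in> cball m r \<Longrightarrow> (LINT y:cball m r|lborel. g y) \<le> (g t + e/2) * (2 * r)"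
        using up[rule_format, of "g t + e/2"] e by auto
      obtain d2 where d2: "d2 > 0" "\<And>m r. 0 < r \<Longrightarrow> r < d2 \<Longrightarrow> t \<in> cball m r \<Longrightarrow> (LINT y:cball m r|lborel. - g y) \<le> (- g t + e/2) * (2 * r)"
        using lo[rule_format, of "- g t + e/2"] e by auto
      have main: "\<bar>?F c - ?F a - g t * (c - a)\<bar> \<le> e/2 * (c - a)" if "a < c" "c - a < min d1 d2" "a \<le> t" "t \<le> c" for a c
      proof -
        let ?m = "(a+c)/2" and ?r = "(c-a)/2"
        have r: "0 < ?r" "?r < d1" "?r < d2" "t \<in> cball ?m ?r" using that d1 d2 by (auto simp: dist_real_def abs_le_iff field_simps)
        have two: "(2::real) \<noteq> 0" by simp
        have neg: "(LINT y:cball ?m ?r|lborel. - g y) = - (LINT y:cball ?m ?r|lborel. g y)"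
          by (simp add: set_lebesgue_integral_def)
        have "?F c - ?F a \<le> (g t + e/2) * (c - a)" "- (?F c - ?F a) \<le> (- g t + e/2) * (c - a)"
          using d1(2)[OF r(1,2,4)] d2(2)[OF r(1,3,4)] incr[of a c] that
          unfolding nonzero_mult_div_cancel_left[OF two] times_divide_eq_right neg by simp_all
        then show ?thesis unfolding abs_le_iff by (auto simp: field_simps)
      qed
      show "\<exists>s>0. \<forall>x. x \<noteq> t \<and> norm (x - t) < s \<longrightarrow> norm ((?F x - ?F t) / (x - t) - g t) < e"
      proof (intro exI[of _ "min d1 d2"] conjI allI impI)
        show "0 < min d1 d2" using d1 d2 by auto
        fix x assume x: "x \<noteq> t \<and> norm (x - t) < min d1 d2"
        have "\<bar>?F x - ?F t - g t * (x - t)\<bar> \<le> e/2 * \<bar>x - t\<bar>"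
          using main[of t x] main[of x t] x by (cases "x < t") (auto simp: abs_minus_commute abs_le_iff algebra_simps)
        then have "\<bar>(?F x - ?F t) / (x - t) - g t\<bar> \<le> e/2"
          using x by (simp add: field_simps abs_if split: if_splits)
        then show "norm ((?F x - ?F t) / (x - t) - g t) < e" using e by simp
      qed
    qed
  qed
qed

section \<open>Absolutely continuous differences of distribution functions\<close>

lemma (in finite_measure) measure_tendsto_indicator:
  assumes [measurable]: "\<And>k. U k \<in> sets M" "K \<in> sets M"
    and "\<And>x. (\<lambda>k. indicat_real (U k) x) \<longlonglongrightarrow> indicat_real K x"
  shows "(\<lambda>k. measure M (U k)) \<longlonglongrightarrow> measure M K"
proof -
  have "(\<lambda>k. LINT x|M. indicat_real (U k) x) \<longlonglongrightarrow> (LINT x|M. indicat_real K x)"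
    by (rule integral_dominated_convergence[where w="\<lambda>_. 1"]) (use assms(3) in auto)
  moreover have "(LINT x|M. indicat_real A x) = measure M A" if "A \<in> sets M" for A
    using sets.sets_into_space[OF that] by (simp add: Int_absorb2)
  ultimately show ?thesis using assms(1,2) by simp
qed

lemma measure_Ioc_eq_diff:
  fixes M :: "real measure"
  assumes "finite_measure M" "sets M = sets borel" "a \<le> b"
  shows "measure M {a<..b} = measure M {..b} - measure M {..a}"
proof -
  have "{a<..b} = {..b} - {..a}" by auto
  then show ?thesis using assms finite_measure.finite_measure_Diff[OF assms(1), of "{..b}" "{..a}"] by simp
qed

text \<open>The grid cells that meet K form sets \<open>U k\<close> converging pointwise to K
  because K is closed, so their Lebesgue measure tends to 0. Absolute continuity then makes the
  total increment of V over these cells small, and that increment is the difference of the two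
  masses of \<open>U k\<close>.\<close>

lemma abs_continuous_compact_null_set:
  fixes \<mu>1 \<mu>2 :: "real measure" and V :: "real \<Rightarrow> real"
  assumes "finite_measure \<mu>1" "finite_measure \<mu>2"
    and sets: "sets \<mu>1 = sets borel" "sets \<mu>2 = sets borel"
    and V: "\<And>t. t \<ge> 0 \<Longrightarrow> V t = measure \<mu>1 {..t} - measure \<mu>2 {..t}"
    and ac: "abs_continuous_on_interval 0 T V" and T: "T > 0"
    and K: "compact K" "K \<subseteq> {0<..T}" "K \<in> null_sets lborel"
  shows "measure \<mu>1 K = measure \<mu>2 K"
proof -
  define h where "h k = T / real (Suc k)" for k
  have h0: "h k > 0" for k using T by (simp add: h_def)
  \<comment> \<open>Half-open cells are disjoint and have increments of distribution functions as
    masses; \<open>Suc k\<close> of them, each of length \<open>h k\<close>, tile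
    \<open>{0<..T}\<close>.\<close>
  define I where "I k j = {real j * h k<..real (Suc j) * h k}" for k j
  define J where "J k = {j. j < Suc k \<and> I k j \<inter> K \<noteq> {}}" for k
  define U where "U k = (\<Union>j\<in>J k. I k j)" for k
  have finJ: "finite (J k)" for k by (simp add: J_def)
  have disjI: "disjoint_family (I k)" for k
    unfolding disjoint_family_on_def
  proof (intro ballI impI)
    fix i j :: nat assume "i \<noteq> j"
    then consider "Suc i \<le> j" | "Suc j \<le> i" by linarith
    then show "I k i \<inter> I k j = {}"
    proof cases
      case 1 then have "real (Suc i) * h k \<le> real j * h k" using h0[of k] by (intro mult_right_mono) auto
      then show ?thesis by (auto simp: I_def)
    next
      case 2 then have "real (Suc j) * h k \<le> real i * h k" using h0[of k] by (intro mult_right_mono) auto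
      then show ?thesis by (auto simp: I_def)
    qed
  qed
  have I_T: "I k j \<subseteq> {0<..T}" if "j < Suc k" for k j
  proof -
    have "real (Suc j) * h k \<le> real (Suc k) * h k" using that h0[of k] by (intro mult_right_mono) auto
    also have "\<dots> = T" by (simp add: h_def)
    finally have le: "real (Suc j) * h k \<le> T" .
    have "0 \<le> real j * h k" using h0[of k] by simp
    with le show ?thesis unfolding I_def by (auto simp del: of_nat_Suc)
  qed
  have KU: "K \<subseteq> U k" for k
  proof
    fix x assume x: "x \<in> K"
    define z where "z = x / h k"
    have z: "0 < z" using x K h0[of k] by (auto simp: z_def)
    define j where "j = nat (\<lceil>z\<rceil> - 1)"
    have jr: "real j = of_int \<lceil>z\<rceil> - 1" using z by (simp add: j_def)
    have xj: "x \<in> I k j"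
    proof -
      have "real j < z" "z \<le> real (Suc j)" unfolding of_nat_Suc jr by linarith+
      then show ?thesis using h0[of k] by (auto simp: I_def z_def field_simps)
    qed
    have "real j * h k < T" using xj x K(2) unfolding I_def by force
    then have "real j * h k < real (Suc k) * h k" by (simp add: h_def)
    then have "j < Suc k" using h0[of k] by (simp only: mult_less_cancel_right_pos of_nat_less_iff)
    then show "x \<in> U k" using xj x by (auto simp: U_def J_def)
  qed
  have Um [measurable]: "U k \<in> sets borel" for k using finJ by (auto simp: U_def I_def)
  have Km [measurable]: "K \<in> sets borel" using K(1) by (simp add: compact_imp_closed)
  have notU: "eventually (\<lambda>k. x \<notin> U k) sequentially" if "x \<notin> K" for x
  proof -
    have "open (- K)" "x \<in> - K" using that compact_imp_closed[OF K(1)] by auto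
    then obtain d where "d > 0" "ball x d \<subseteq> - K" by (rule openE)
    then have d: "d > 0" "ball x d \<inter> K = {}" by auto
    have "(\<lambda>k. h k) \<longlonglongrightarrow> 0" unfolding h_def by (rule LIMSEQ_Suc[OF lim_const_over_n])
    then have "eventually (\<lambda>k. h k < d) sequentially" using d(1) by (auto dest: order_tendstoD)
    then show ?thesis
    proof eventually_elim
      fix k assume hk: "h k < d"
      show "x \<notin> U k"
      proof
        assume "x \<in> U k"
        then obtain j y where y: "x \<in> I k j" "y \<in> I k j" "y \<in> K" by (auto simp: U_def J_def)
        have "real (Suc j) * h k = real j * h k + h k" by (simp add: distrib_right)
        then have "\<bar>x - y\<bar> \<le> h k" using y(1,2) unfolding I_def greaterThanAtMost_iff by linarith
        then have "dist x y \<le> h k" by (simp add: dist_real_def)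
        with hk have "y \<in> ball x d" by simp
        with d(2) y(3) show False by blast
      qed
    qed
  qed
  have ind: "(\<lambda>k. indicat_real (U k) x) \<longlonglongrightarrow> indicat_real K x" for x
  proof (cases "x \<in> K")
    case True
    then have "indicat_real (U k) x = indicat_real K x" for k using KU[of k] by (auto simp: indicator_def)
    then show ?thesis by simp
  next
    case False
    have "eventually (\<lambda>k. indicat_real (U k) x = indicat_real K x) sequentially"
      by (rule eventually_mono[OF notU[OF False]]) (simp add: False)
    then show ?thesis by (rule tendsto_eventually)
  qed
  have lim: "(\<lambda>k. measure m (U k)) \<longlonglongrightarrow> measure m K" if "finite_measure m" "sets m = sets borel" for m :: "real measure"
    by (rule finite_measure.measure_tendsto_indicator[OF that(1) _ _ ind]) (simp_all only: that(2) Um Km)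
  have Ile: "real i * h k \<le> real (Suc i) * h k" for i k using h0[of k] by (intro mult_right_mono) auto
  have UL: "measure lborel (U k) = (\<Sum>i<Suc k. if i \<in> J k then h k else 0)" for k
  proof -
    have "measure lborel (U k) = (\<Sum>i\<in>J k. measure lborel (I k i))"
      unfolding U_def
      by (rule measure_finite_Union[OF finJ _ disjoint_family_on_mono[OF subset_UNIV disjI]])
        (auto simp: I_def Ile simp del: of_nat_Suc)
    also have "\<dots> = (\<Sum>i\<in>J k. h k)"
    proof (rule sum.cong[OF refl])
      fix i
      have "real i * h k \<le> real (Suc i) * h k" "real (Suc i) * h k = real i * h k + h k"
        using h0[of k] by (auto simp: distrib_right)
      then show "measure lborel (I k i) = h k" unfolding I_def by (simp del: of_nat_Suc)
    qed
    also have "J k = {i\<in>{..<Suc k}. i \<in> J k}" by (auto simp: J_def)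
    also have "(\<Sum>i\<in>\<dots>. h k) = (\<Sum>i<Suc k. if i \<in> J k then h k else 0)"
      by (rule sum.inter_filter) simp
    finally show ?thesis .
  qed
  have Um': "measure m (U k) = (\<Sum>i<Suc k. if i \<in> J k then measure m {..real (Suc i) * h k} - measure m {..real i * h k} else 0)"
    if "finite_measure m" "sets m = sets borel" for m :: "real measure" and k
  proof -
    have "measure m (U k) = (\<Sum>i\<in>J k. measure m (I k i))"
      unfolding U_def
      by (rule finite_measure.finite_measure_finite_Union[OF that(1) finJ _ disjoint_family_on_mono[OF subset_UNIV disjI]])
        (auto simp: I_def that(2))
    also have "\<dots> = (\<Sum>i\<in>J k. measure m {..real (Suc i) * h k} - measure m {..real i * h k})"
      unfolding I_def by (intro sum.cong[OF refl] measure_Ioc_eq_diff that mult_right_mono less_imp_le[OF h0]) simp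
    also have "J k = {i\<in>{..<Suc k}. i \<in> J k}" by (auto simp: J_def)
    also have "(\<Sum>i\<in>\<dots>. measure m {..real (Suc i) * h k} - measure m {..real i * h k}) = (\<Sum>i<Suc k. if i \<in> J k then measure m {..real (Suc i) * h k} - measure m {..real i * h k} else 0)"
      by (rule sum.inter_filter) simp
    finally show ?thesis .
  qed
  have limL: "(\<lambda>k. measure lborel (U k)) \<longlonglongrightarrow> 0"
  proof -
    \<comment> \<open>Lebesgue measure cut down to \<open>{0<..T}\<close> is finite, so the same
      limit argument applies to it.\<close>
    let ?m = "density lborel (indicator {0<..T})"
    have "finite_measure ?m"
      by (rule finite_measureI) (use T in \<open>simp add: emeasure_density\<close>)
    then have "(\<lambda>k. measure ?m (U k)) \<longlonglongrightarrow> measure ?m K" by (rule lim) simp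
    moreover have "measure ?m A = measure lborel A" if "A \<subseteq> {0<..T}" "A \<in> sets borel" for A
    proof -
      have "emeasure ?m A = emeasure lborel A"
        using that by (simp add: emeasure_density indicator_inter_arith[symmetric] Int_absorb1)
      then show ?thesis by (simp add: measure_def)
    qed
    moreover have "U k \<subseteq> {0<..T}" for k
    proof -
      have "I k j \<subseteq> {0<..T}" if "j \<in> J k" for j using that by (intro I_T) (simp add: J_def)
      then show ?thesis unfolding U_def by blast
    qed
    ultimately show ?thesis using K(2,3) by (simp add: measure_eq_0_null_sets)
  qed
  have "(\<lambda>k. measure \<mu>1 (U k) - measure \<mu>2 (U k)) \<longlonglongrightarrow> 0"
  proof (rule LIMSEQ_I)
    fix e :: real assume "e > 0"
    then obtain \<delta> where \<delta>: "\<delta> > 0" "\<And>(n::nat) a c. (\<forall>i<n. 0 \<le> a i \<and> a i \<le> c i \<and> c i \<le> T) \<Longrightarrow>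
        disjoint_family_on (\<lambda>i. {a i<..<c i}) {..<n} \<Longrightarrow>
        (\<Sum>i<n. c i - a i) < \<delta> \<Longrightarrow> (\<Sum>i<n. \<bar>V (c i) - V (a i)\<bar>) < e"
      using ac[unfolded abs_continuous_on_interval_def, rule_format, of e] by blast
    have "eventually (\<lambda>k. measure lborel (U k) < \<delta>) sequentially" using order_tendstoD(2)[OF limL \<delta>(1)] .
    then obtain k0 where k0: "\<And>k. k \<ge> k0 \<Longrightarrow> measure lborel (U k) < \<delta>" unfolding eventually_sequentially by blast
    show "\<exists>no. \<forall>k\<ge>no. norm (measure \<mu>1 (U k) - measure \<mu>2 (U k) - 0) < e"
    proof (intro exI[of _ k0] allI impI)
      fix k assume k: "k \<ge> k0"
      define a where "a i = real i * h k" for i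
      \<comment> \<open>Cells that miss K are kept as degenerate intervals, because absolute
        continuity is formulated for intervals indexed by an initial segment of the
        naturals.\<close>
      define c where "c i = (if i \<in> J k then real (Suc i) * h k else real i * h k)" for i
      have leT: "real (Suc i) * h k \<le> T" if "i < Suc k" for i
      proof -
        have "real (Suc i) * h k \<le> real (Suc k) * h k" using that h0[of k] by (intro mult_right_mono) auto
        then show ?thesis by (simp add: h_def)
      qed
      have 1: "\<forall>i<Suc k. 0 \<le> a i \<and> a i \<le> c i \<and> c i \<le> T"
        using leT order_trans[OF Ile leT] Ile h0[of k] unfolding a_def c_def by (auto simp del: of_nat_Suc)
      have sub: "{a i<..<c i} \<subseteq> I k i" for i by (auto simp: a_def c_def I_def)
      have 2: "disjoint_family_on (\<lambda>i. {a i<..<c i}) {..<Suc k}"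
        using disjI[of k] sub unfolding disjoint_family_on_def by blast
      have "(\<Sum>i<Suc k. c i - a i) = measure lborel (U k)"
        unfolding UL by (intro sum.cong) (auto simp: c_def a_def algebra_simps)
      then have 3: "(\<Sum>i<Suc k. c i - a i) < \<delta>" using k0[OF k] by simp
      have "measure \<mu>1 (U k) - measure \<mu>2 (U k) = (\<Sum>i<Suc k. V (c i) - V (a i))"
        unfolding Um'[OF assms(1) sets(1)] Um'[OF assms(2) sets(2)] sum_subtractf[symmetric]
      proof (rule sum.cong[OF refl])
        fix i
        have "0 \<le> real i * h k" "0 \<le> real (Suc i) * h k" using h0[of k] by (auto intro!: mult_nonneg_nonneg)
        then show "(if i \<in> J k then measure \<mu>1 {..real (Suc i) * h k} - measure \<mu>1 {..real i * h k} else 0) -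
           (if i \<in> J k then measure \<mu>2 {..real (Suc i) * h k} - measure \<mu>2 {..real i * h k} else 0) = V (c i) - V (a i)"
          by (auto simp: c_def a_def V simp del: of_nat_Suc)
      qed
      then have "\<bar>measure \<mu>1 (U k) - measure \<mu>2 (U k)\<bar> \<le> (\<Sum>i<Suc k. \<bar>V (c i) - V (a i)\<bar>)"
        by (simp only: sum_abs)
      also have "\<dots> < e" by (rule \<delta>(2)[OF 1 2 3])
      finally show "norm (measure \<mu>1 (U k) - measure \<mu>2 (U k) - 0) < e" by simp
    qed
  qed
  moreover have "(\<lambda>k. measure \<mu>1 (U k) - measure \<mu>2 (U k)) \<longlonglongrightarrow> measure \<mu>1 K - measure \<mu>2 K"
    by (intro tendsto_diff lim assms(1,2) sets)
  ultimately show ?thesis using LIMSEQ_unique by force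
qed

text \<open>Inner regularity reduces a Borel null set to the compact null sets inside the open
  half-line. The part in \<open>{..0}\<close> is handled by the assumption on that set, since V is
  tied to the measures only at nonnegative arguments.\<close>

lemma loc_abs_continuous_null_set:
  fixes \<mu>1 \<mu>2 :: "real measure" and V :: "real \<Rightarrow> real"
  assumes fin: "finite_measure \<mu>1" "finite_measure \<mu>2"
    and sets: "sets \<mu>1 = sets borel" "sets \<mu>2 = sets borel"
    and pos: "emeasure \<mu>1 {..0} = 0" "emeasure \<mu>2 {..0} = 0"
    and V: "\<And>t. t \<ge> 0 \<Longrightarrow> V t = measure \<mu>1 {..t} - measure \<mu>2 {..t}"
    and ac: "loc_abs_continuous V"
    and N: "N \<in> null_sets lborel"
  shows "emeasure \<mu>1 N = emeasure \<mu>2 N"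
proof -
  interpret m1: finite_measure \<mu>1 by (rule fin(1))
  interpret m2: finite_measure \<mu>2 by (rule fin(2))
  have cpt: "emeasure \<mu>1 C = emeasure \<mu>2 C" if C: "C \<subseteq> N \<inter> {0<..}" "compact C" for C
  proof -
    have "bounded C" using C by (simp add: compact_imp_bounded)
    then obtain B where B: "\<forall>x\<in>C. \<bar>x\<bar> \<le> B" unfolding bounded_real by (rule exE)
    define T where "T = max B 1"
    have "C \<subseteq> {0<..T}"
    proof
      fix x assume "x \<in> C" then show "x \<in> {0<..T}" using bspec[OF B, of x] C(1) by (auto simp: T_def)
    qed
    moreover have "C \<in> null_sets lborel"
      using N C by (intro null_sets_subset[OF N]) (auto simp: compact_imp_closed)
    moreover have "T > 0" by (simp add: T_def)
    ultimately have "measure \<mu>1 C = measure \<mu>2 C"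
      using ac C(2) by (intro abs_continuous_compact_null_set[OF fin sets V, of T]) (auto simp: loc_abs_continuous_def)
    then show ?thesis by (simp add: m1.emeasure_eq_measure m2.emeasure_eq_measure)
  qed
  have [measurable]: "N \<in> sets borel" using null_setsD2[OF N] by simp
  have "emeasure \<mu> N = emeasure \<mu> (N \<inter> {0<..})" if "emeasure \<mu> {..0} = 0" "sets \<mu> = sets borel" for \<mu> :: "real measure"
    using that by (intro emeasure_eq_AE AE_I'[of "{..0}"]) (auto simp: null_sets_def)
  moreover have "emeasure \<mu>1 (N \<inter> {0<..}) = emeasure \<mu>2 (N \<inter> {0<..})"
  proof -
    have "emeasure \<mu>1 (N \<inter> {0<..}) = (SUP C \<in> {C. C \<subseteq> N \<inter> {0<..} \<and> compact C}. emeasure \<mu>1 C)"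
      by (rule inner_regular[OF sets(1)]) auto
    also have "\<dots> = (SUP C \<in> {C. C \<subseteq> N \<inter> {0<..} \<and> compact C}. emeasure \<mu>2 C)"
      using cpt by (intro SUP_cong) auto
    also have "\<dots> = emeasure \<mu>2 (N \<inter> {0<..})"
      by (rule inner_regular[OF sets(2), symmetric]) auto
    finally show ?thesis .
  qed
  ultimately show ?thesis using pos sets by metis
qed

text \<open>The supremum of \<mu> over Lebesgue null sets is attained by a countable union
  \<open>N\<close> of such sets. As \<mu> is finite, a null set with positive mass outside
  \<open>N\<close> would push the value above the supremum.\<close>

lemma Lebesgue_decomposition_null_set:
  fixes \<mu> :: "real measure"
  assumes "finite_measure \<mu>" and sets: "sets \<mu> = sets borel"
  obtains N where "N \<in> null_sets lborel" "\<And>Z. Z \<in> null_sets lborel \<Longrightarrow> emeasure \<mu> (Z - N) = 0"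
proof -
  interpret finite_measure \<mu> by (rule assms(1))
  have "emeasure \<mu> ` null_sets lborel \<noteq> {}" by auto
  from ennreal_Sup_countable_SUP[OF this] obtain f :: "nat \<Rightarrow> ennreal"
    where f: "range f \<subseteq> emeasure \<mu> ` null_sets lborel" "Sup (emeasure \<mu> ` null_sets lborel) = (SUP i. f i)" by auto
  then have "\<forall>i. \<exists>Z \<in> null_sets lborel. f i = emeasure \<mu> Z" by auto
  then obtain Z where Z: "\<And>i. Z i \<in> null_sets lborel" "\<And>i. f i = emeasure \<mu> (Z i)" by metis
  define N where "N = (\<Union>i. Z i)"
  have N: "N \<in> null_sets lborel" unfolding N_def by (intro null_sets_UN Z)
  have Nb: "N \<in> sets \<mu>" using null_setsD2[OF N] sets by simp
  have up: "emeasure \<mu> Z' \<le> emeasure \<mu> N" if "Z' \<in> null_sets lborel" for Z'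
  proof -
    have "emeasure \<mu> Z' \<le> Sup (emeasure \<mu> ` null_sets lborel)" using that by (intro SUP_upper)
    also have "\<dots> \<le> emeasure \<mu> N" unfolding f(2) Z(2)
      using Nb by (intro SUP_least emeasure_mono) (auto simp: N_def)
    finally show ?thesis .
  qed
  show thesis
  proof (rule that[OF N])
    fix Z' :: "real set" assume Z': "Z' \<in> null_sets lborel"
    then have b: "Z' \<in> sets \<mu>" using null_setsD2[of Z' lborel] sets by simp
    have "emeasure \<mu> N + emeasure \<mu> (Z' - N) = emeasure \<mu> (N \<union> Z')"
      using Nb b by (subst plus_emeasure) (auto intro!: arg_cong[where f="emeasure \<mu>"])
    also have "\<dots> \<le> emeasure \<mu> N" by (intro up null_sets.Un N Z')
    finally show "emeasure \<mu> (Z' - N) = 0"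
      using emeasure_finite[of N] ennreal_add_left_cancel_le[of "emeasure \<mu> N" "emeasure \<mu> (Z' - N)" 0] by simp
  qed
qed

text \<open>One null set \<open>N\<close> carries the singular parts of both measures. Off
  \<open>N\<close> the Radon-Nikodym theorem gives densities; inside \<open>N\<close> every Borel
  set is null, so there the measures coincide by hypothesis. Each density is added on the opposite
  side because possibly infinite integrals cannot be subtracted.\<close>

lemma emeasure_eq_null_sets_decomposition:
  fixes \<mu>1 \<mu>2 :: "real measure"
  assumes fin: "finite_measure \<mu>1" "finite_measure \<mu>2"
    and sets: "sets \<mu>1 = sets borel" "sets \<mu>2 = sets borel"
    and null: "\<And>N. N \<in> null_sets lborel \<Longrightarrow> emeasure \<mu>1 N = emeasure \<mu>2 N"
  obtains w1 w2 :: "real \<Rightarrow> ennreal"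
  where "w1 \<in> borel_measurable borel" "w2 \<in> borel_measurable borel"
    "(\<integral>\<^sup>+x. w1 x \<partial>lborel) \<le> emeasure \<mu>1 UNIV" "(\<integral>\<^sup>+x. w2 x \<partial>lborel) \<le> emeasure \<mu>2 UNIV"
    "\<And>g. g \<in> borel_measurable borel \<Longrightarrow>
      (\<integral>\<^sup>+x. g x \<partial>\<mu>1) + (\<integral>\<^sup>+x. w2 x * g x \<partial>lborel) = (\<integral>\<^sup>+x. g x \<partial>\<mu>2) + (\<integral>\<^sup>+x. w1 x * g x \<partial>lborel)"
proof -
  obtain N1 where N1: "N1 \<in> null_sets lborel" "\<And>Z. Z \<in> null_sets lborel \<Longrightarrow> emeasure \<mu>1 (Z - N1) = 0"
    by (rule Lebesgue_decomposition_null_set[OF fin(1) sets(1)]) blast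
  obtain N2 where N2: "N2 \<in> null_sets lborel" "\<And>Z. Z \<in> null_sets lborel \<Longrightarrow> emeasure \<mu>2 (Z - N2) = 0"
    by (rule Lebesgue_decomposition_null_set[OF fin(2) sets(2)]) blast
  define N where "N = N1 \<union> N2"
  have N: "N \<in> null_sets lborel" unfolding N_def by (intro null_sets.Un N1(1) N2(1))
  have Nb: "N \<in> sets borel" using null_setsD2[OF N] by simp
  have ex: "\<exists>w \<in> borel_measurable borel. density lborel w = density \<mu> (indicator (- N))"
    if s: "sets \<mu> = sets borel" and Z: "\<And>Z. Z \<in> null_sets lborel \<Longrightarrow> emeasure \<mu> (Z - N') = 0" and N': "N' \<subseteq> N" "N' \<in> null_sets lborel" for \<mu> :: "real measure" and N'
  proof -
    have "absolutely_continuous lborel (density \<mu> (indicator (- N)))"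
      unfolding absolutely_continuous_def
    proof
      fix Z :: "real set" assume Zn: "Z \<in> null_sets lborel"
      then have Zb: "Z \<in> sets borel" using null_setsD2[of Z lborel] by simp
      have "emeasure (density \<mu> (indicator (- N))) Z = emeasure \<mu> (Z - N)"
        using Nb Zb s by (simp add: emeasure_density indicator_inter_arith[symmetric] Diff_eq Int_commute)
      also have "\<dots> \<le> emeasure \<mu> (Z - N')"
        using N'(1) Zb null_setsD2[OF N'(2)] s by (intro emeasure_mono) auto
      also have "\<dots> = 0" by (rule Z[OF Zn])
      finally show "Z \<in> null_sets (density \<mu> (indicator (- N)))"
        using Zb s by (simp add: null_sets_def)
    qed
    from sigma_finite_measure.Radon_Nikodym[OF sigma_finite_lborel this] show ?thesis using s by auto
  qed
  obtain w1 where w1: "w1 \<in> borel_measurable borel" "density lborel w1 = density \<mu>1 (indicator (- N))"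
    using ex[OF sets(1) N1(2) _ N1(1)] unfolding N_def by auto
  obtain w2 where w2: "w2 \<in> borel_measurable borel" "density lborel w2 = density \<mu>2 (indicator (- N))"
    using ex[OF sets(2) N2(2) _ N2(1)] unfolding N_def by auto
  have eqN: "density \<mu>1 (indicator N) = density \<mu>2 (indicator N)"
  proof (rule measure_eqI)
    fix A assume "A \<in> sets (density \<mu>1 (indicator N))"
    then have A: "A \<in> sets borel" using sets by simp
    have "A \<inter> N \<in> null_sets lborel" using N A by (intro null_set_Int1) auto
    then have "emeasure \<mu>1 (A \<inter> N) = emeasure \<mu>2 (A \<inter> N)" by (rule null)
    then show "emeasure (density \<mu>1 (indicator N)) A = emeasure (density \<mu>2 (indicator N)) A"
      using A Nb sets by (simp add: emeasure_density indicator_inter_arith[symmetric] Int_commute)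
  qed (simp add: sets)
  have split: "(\<integral>\<^sup>+x. g x \<partial>\<mu>) = (\<integral>\<^sup>+x. g x \<partial>density \<mu> (indicator N)) + (\<integral>\<^sup>+x. w x * g x \<partial>lborel)"
    if g: "g \<in> borel_measurable borel" and s: "sets \<mu> = sets borel"
      and w: "w \<in> borel_measurable borel" "density lborel w = density \<mu> (indicator (- N))" for \<mu> g w
  proof -
    have gm: "g \<in> borel_measurable \<mu>" using g s by (simp cong: measurable_cong_sets)
    have "(\<integral>\<^sup>+x. w x * g x \<partial>lborel) = (\<integral>\<^sup>+x. g x \<partial>density lborel w)"
      using g w by (subst nn_integral_density) auto
    also have "\<dots> = (\<integral>\<^sup>+x. indicator (- N) x * g x \<partial>\<mu>)"
      unfolding w(2) using gm Nb s by (subst nn_integral_density) auto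
    finally have 1: "(\<integral>\<^sup>+x. w x * g x \<partial>lborel) = (\<integral>\<^sup>+x. indicator (- N) x * g x \<partial>\<mu>)" .
    have 2: "(\<integral>\<^sup>+x. g x \<partial>density \<mu> (indicator N)) = (\<integral>\<^sup>+x. indicator N x * g x \<partial>\<mu>)"
      using gm Nb s by (subst nn_integral_density) auto
    have "(\<integral>\<^sup>+x. g x \<partial>\<mu>) = (\<integral>\<^sup>+x. indicator N x * g x + indicator (- N) x * g x \<partial>\<mu>)"
      by (intro nn_integral_cong) (auto simp: indicator_def)
    also have "\<dots> = (\<integral>\<^sup>+x. indicator N x * g x \<partial>\<mu>) + (\<integral>\<^sup>+x. indicator (- N) x * g x \<partial>\<mu>)"
      using gm Nb s by (intro nn_integral_add) auto
    finally show ?thesis by (simp only: 1 2)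
  qed
  have bound: "(\<integral>\<^sup>+x. w x \<partial>lborel) \<le> emeasure \<mu> UNIV"
    if s: "sets \<mu> = sets borel" and w: "w \<in> borel_measurable borel" "density lborel w = density \<mu> (indicator (- N))" for \<mu> w
  proof -
    have "(\<integral>\<^sup>+x. 1 \<partial>\<mu>) = (\<integral>\<^sup>+x. 1 \<partial>density \<mu> (indicator N)) + (\<integral>\<^sup>+x. w x * 1 \<partial>lborel)"
      by (rule split[OF _ s w]) simp
    then show ?thesis using sets_eq_imp_space_eq[OF s] by simp
  qed
  show thesis
  proof (rule that[OF w1(1) w2(1) bound[OF sets(1) w1] bound[OF sets(2) w2]])
    fix g :: "real \<Rightarrow> ennreal" assume g: "g \<in> borel_measurable borel"
    show "(\<integral>\<^sup>+x. g x \<partial>\<mu>1) + (\<integral>\<^sup>+x. w2 x * g x \<partial>lborel) = (\<integral>\<^sup>+x. g x \<partial>\<mu>2) + (\<integral>\<^sup>+x. w1 x * g x \<partial>lborel)"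
      unfolding split[OF g sets(1) w1] split[OF g sets(2) w2] eqN by (simp only: ac_simps)
  qed
qed

text \<open>The Lebesgue-singular parts of the two measures coincide, hence cancel in the difference.\<close>

lemma loc_abs_continuous_density:
  fixes \<mu>1 \<mu>2 :: "real measure" and V :: "real \<Rightarrow> real"
  assumes fin: "finite_measure \<mu>1" "finite_measure \<mu>2"
    and sets: "sets \<mu>1 = sets borel" "sets \<mu>2 = sets borel"
    and pos: "emeasure \<mu>1 {..0} = 0" "emeasure \<mu>2 {..0} = 0"
    and V: "\<And>t. t \<ge> 0 \<Longrightarrow> V t = measure \<mu>1 {..t} - measure \<mu>2 {..t}"
    and ac: "loc_abs_continuous V"
  obtains w1 w2 :: "real \<Rightarrow> real"
  where "integrable lborel w1" "integrable lborel w2" "\<And>t. 0 \<le> w1 t" "\<And>t. 0 \<le> w2 t"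
    "\<And>t. t \<le> 0 \<Longrightarrow> w1 t = 0" "\<And>t. t \<le> 0 \<Longrightarrow> w2 t = 0"
    "\<And>g. g \<in> borel_measurable borel \<Longrightarrow>
      (\<integral>\<^sup>+x. g x \<partial>\<mu>1) + (\<integral>\<^sup>+x. ennreal (w2 x) * g x \<partial>lborel) = (\<integral>\<^sup>+x. g x \<partial>\<mu>2) + (\<integral>\<^sup>+x. ennreal (w1 x) * g x \<partial>lborel)"
    "AE t in lborel. t > 0 \<longrightarrow> (V has_real_derivative w1 t - w2 t) (at t)"
proof -
  obtain u1 u2 :: "real \<Rightarrow> ennreal" where u:
    "u1 \<in> borel_measurable borel" "u2 \<in> borel_measurable borel"
    "(\<integral>\<^sup>+x. u1 x \<partial>lborel) \<le> emeasure \<mu>1 UNIV" "(\<integral>\<^sup>+x. u2 x \<partial>lborel) \<le> emeasure \<mu>2 UNIV"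
    "\<And>g. g \<in> borel_measurable borel \<Longrightarrow>
      (\<integral>\<^sup>+x. g x \<partial>\<mu>1) + (\<integral>\<^sup>+x. u2 x * g x \<partial>lborel) = (\<integral>\<^sup>+x. g x \<partial>\<mu>2) + (\<integral>\<^sup>+x. u1 x * g x \<partial>lborel)"
    using emeasure_eq_null_sets_decomposition[OF fin sets loc_abs_continuous_null_set[OF fin sets pos V ac]]
    by blast
  note [measurable] = u(1,2)
  \<comment> \<open>Densities of finite mass are infinite only on a null set, so they may be made
    real-valued. Cutting them off at 0 is harmless because neither measure charges
    \<open>{..0}\<close>: the identity for g follows from the one for g times the indicator of the
    positive half-line.\<close>
  define w1 w2 where "w1 t = indicator {0<..} t * enn2real (u1 t)" and "w2 t = indicator {0<..} t * enn2real (u2 t)" for t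
  have [measurable]: "w1 \<in> borel_measurable borel" "w2 \<in> borel_measurable borel" unfolding w1_def w2_def by measurable
  have finu: "(\<integral>\<^sup>+x. u1 x \<partial>lborel) < \<top>" "(\<integral>\<^sup>+x. u2 x \<partial>lborel) < \<top>"
    using finite_measure.emeasure_finite[OF fin(1)] finite_measure.emeasure_finite[OF fin(2)] u(3,4)
    by (auto simp: less_top intro: le_less_trans)
  have ae: "AE x in lborel. u1 x \<noteq> \<infinity>" "AE x in lborel. u2 x \<noteq> \<infinity>"
    using nn_integral_PInf_AE[of u1 lborel] nn_integral_PInf_AE[of u2 lborel] finu by auto
  have int_eq: "(\<integral>\<^sup>+x. ennreal (indicator {0<..} x * enn2real (u x)) * g x \<partial>lborel) = (\<integral>\<^sup>+x. u x * (indicator {0<..} x * g x) \<partial>lborel)"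
    if "AE x in lborel. u x \<noteq> \<infinity>" for g u :: "real \<Rightarrow> ennreal"
    using that by (intro nn_integral_cong_AE, eventually_elim) (auto simp: indicator_def less_top)
  have restrict: "(\<integral>\<^sup>+x. indicator {0<..} x * g x \<partial>\<mu>) = (\<integral>\<^sup>+x. g x \<partial>\<mu>)"
    if "sets \<mu> = sets borel" "emeasure \<mu> {..0} = 0" for g and \<mu> :: "real measure"
    using that by (intro nn_integral_cong_AE AE_I'[of "{..0}"]) (auto simp: null_sets_def indicator_def)
  have eq: "(\<integral>\<^sup>+x. g x \<partial>\<mu>1) + (\<integral>\<^sup>+x. ennreal (w2 x) * g x \<partial>lborel) = (\<integral>\<^sup>+x. g x \<partial>\<mu>2) + (\<integral>\<^sup>+x. ennreal (w1 x) * g x \<partial>lborel)"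
    if g: "g \<in> borel_measurable borel" for g
    using u(5)[of "\<lambda>x. indicator {0<..} x * g x"] g
    unfolding w1_def w2_def int_eq[OF ae(1)] int_eq[OF ae(2)] restrict[OF sets(1) pos(1)] restrict[OF sets(2) pos(2)]
    by simp
  have nn: "0 \<le> w1 t" "0 \<le> w2 t" for t by (auto simp: w1_def w2_def)
  have lefin: "(\<integral>\<^sup>+x. ennreal (w1 x) \<partial>lborel) < \<top>" "(\<integral>\<^sup>+x. ennreal (w2 x) \<partial>lborel) < \<top>"
  proof -
    have le: "ennreal (indicator {0<..} x * enn2real a) \<le> a" for x :: real and a
      by (cases a) (auto simp: indicator_def)
    have "(\<integral>\<^sup>+x. ennreal (w1 x) \<partial>lborel) \<le> (\<integral>\<^sup>+x. u1 x \<partial>lborel)" "(\<integral>\<^sup>+x. ennreal (w2 x) \<partial>lborel) \<le> (\<integral>\<^sup>+x. u2 x \<partial>lborel)"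
      unfolding w1_def w2_def by (intro nn_integral_mono le)+
    then show "(\<integral>\<^sup>+x. ennreal (w1 x) \<partial>lborel) < \<top>" "(\<integral>\<^sup>+x. ennreal (w2 x) \<partial>lborel) < \<top>"
      using finu by (auto intro: le_less_trans)
  qed
  have int: "integrable lborel w1" "integrable lborel w2"
    using lefin nn by (auto intro!: integrableI_nonneg)
  define W where "W \<tau> = (LINT y:{..\<tau>}|lborel. w1 y - w2 y)" for \<tau>
  have VW: "V t = W t" if t: "t \<ge> 0" for t
  proof -
    have si: "set_integrable lborel {..t} w1" "set_integrable lborel {..t} w2"
      unfolding set_integrable_def by (intro integrable_mult_indicator int; simp)+
    have nni: "(\<integral>\<^sup>+x. ennreal (w x) * indicator {..t} x \<partial>lborel) = ennreal (LINT y:{..t}|lborel. w y)"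
      if "set_integrable lborel {..t} w" "\<And>t. 0 \<le> w t" for w
    proof -
      have "(\<integral>\<^sup>+x. ennreal (w x) * indicator {..t} x \<partial>lborel) = (\<integral>\<^sup>+x. ennreal (indicator {..t} x *\<^sub>R w x) \<partial>lborel)"
        by (intro nn_integral_cong) (auto simp: indicator_def)
      also have "\<dots> = ennreal (LINT y:{..t}|lborel. w y)"
        using that unfolding set_lebesgue_integral_def set_integrable_def by (intro nn_integral_eq_integral) auto
      finally show ?thesis .
    qed
    have "emeasure \<mu>1 {..t} + ennreal (LINT y:{..t}|lborel. w2 y) = emeasure \<mu>2 {..t} + ennreal (LINT y:{..t}|lborel. w1 y)"
      using eq[of "indicator {..t}"] sets unfolding nni[OF si(1) nn(1)] nni[OF si(2) nn(2)] by simp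
    then have "measure \<mu>1 {..t} + (LINT y:{..t}|lborel. w2 y) = measure \<mu>2 {..t} + (LINT y:{..t}|lborel. w1 y)"
      using nn by (simp add: finite_measure.emeasure_eq_measure[OF fin(1)] finite_measure.emeasure_eq_measure[OF fin(2)]
          set_lebesgue_integral_def flip: ennreal_plus)
    then show ?thesis unfolding W_def set_integral_diff(2)[OF si] V[OF t] by simp
  qed
  have "AE t in lborel. (W has_real_derivative w1 t - w2 t) (at t)"
    unfolding W_def[abs_def] using int by (intro AE_lborel_indefinite_integral_has_derivative Bochner_Integration.integrable_diff)
  \<comment> \<open>\<open>V\<close> and \<open>W\<close> agree only on the nonnegative half-line,
    which is a neighbourhood of every positive t.\<close>
  then have der: "AE t in lborel. t > 0 \<longrightarrow> (V has_real_derivative w1 t - w2 t) (at t)"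
  proof (eventually_elim, intro impI)
    fix t :: real assume "(W has_real_derivative w1 t - w2 t) (at t)" "t > 0"
    then show "(V has_real_derivative w1 t - w2 t) (at t)"
      using VW by (elim has_field_derivative_transform_within_open[where S="{0<..}"]) auto
  qed
  show thesis
    by (rule that[OF int nn _ _ eq der]) (auto simp: w1_def w2_def)
qed

section \<open>The Caputo-Djrbashian derivative of a difference of distribution functions\<close>

lemma AE_lborel_reflect:
  fixes P :: "real \<Rightarrow> bool"
  assumes "AE x in lborel. P x"
  shows "AE s in lborel. P (t - s)"
proof -
  obtain N where N: "{x. \<not> P x} \<subseteq> N" "N \<in> null_sets lborel"
    using assms unfolding eventually_ae_filter by auto
  have [measurable]: "N \<in> sets borel" using null_setsD2[OF N(2)] by simp
  have "AE x in lborel. x \<notin> N" by (rule AE_not_in[OF N(2)])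
  then have "AE s in lborel. t + (-1) * s \<notin> N"
    by (rule AE_borel_affine[rotated -1]) auto
  then show ?thesis by eventually_elim (use N(1) in auto)
qed

lemma nn_integral_convolution_lborel:
  fixes \<kappa> w :: "real \<Rightarrow> ennreal"
  assumes [measurable]: "\<kappa> \<in> borel_measurable borel" "w \<in> borel_measurable borel" "g \<in> borel_measurable borel"
  shows "(\<integral>\<^sup>+y. w y * (\<integral>\<^sup>+s. \<kappa> s * g (s + y) \<partial>lborel) \<partial>lborel) =
    (\<integral>\<^sup>+t. (\<integral>\<^sup>+s. \<kappa> s * w (t - s) \<partial>lborel) * g t \<partial>lborel)"
proof -
  have "(\<integral>\<^sup>+y. w y * (\<integral>\<^sup>+s. \<kappa> s * g (s + y) \<partial>lborel) \<partial>lborel) = (\<integral>\<^sup>+y. \<integral>\<^sup>+s. w y * (\<kappa> s * g (s + y)) \<partial>lborel \<partial>lborel)"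
    by (intro nn_integral_cong nn_integral_cmult[symmetric]) auto
  also have "\<dots> = (\<integral>\<^sup>+s. \<integral>\<^sup>+y. w y * (\<kappa> s * g (s + y)) \<partial>lborel \<partial>lborel)"
    by (rule lborel_pair.Fubini') simp
  also have "\<dots> = (\<integral>\<^sup>+s. \<integral>\<^sup>+t. w (t - s) * (\<kappa> s * g t) \<partial>lborel \<partial>lborel)"
  proof (rule nn_integral_cong)
    fix s :: real
    show "(\<integral>\<^sup>+y. w y * (\<kappa> s * g (s + y)) \<partial>lborel) = (\<integral>\<^sup>+t. w (t - s) * (\<kappa> s * g t) \<partial>lborel)"
      by (subst nn_integral_real_affine[where c=1 and t="- s"]) auto
  qed
  also have "\<dots> = (\<integral>\<^sup>+t. \<integral>\<^sup>+s. w (t - s) * (\<kappa> s * g t) \<partial>lborel \<partial>lborel)"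
    by (rule lborel_pair.Fubini') simp
  also have "\<dots> = (\<integral>\<^sup>+t. (\<integral>\<^sup>+s. \<kappa> s * w (t - s) \<partial>lborel) * g t \<partial>lborel)"
    by (intro nn_integral_cong) (subst nn_integral_multc[symmetric], auto simp: ac_simps)
  finally show ?thesis .
qed

text \<open>The kernel is only locally integrable, so the convolution is integrated over t \<le> n.
  Since w lives on the positive half-line, s + y \<le> n forces s \<le> n there, and the double
  integral is at most the mass of w times a finite integral of the kernel.\<close>

lemma AE_convolution_finite:
  fixes \<kappa> w :: "real \<Rightarrow> ennreal"
  assumes [measurable]: "\<kappa> \<in> borel_measurable borel" "w \<in> borel_measurable borel"
    and w: "(\<integral>\<^sup>+x. w x \<partial>lborel) < \<top>" "\<And>x. x \<le> 0 \<Longrightarrow> w x = 0"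
    and \<kappa>: "\<And>T. (\<integral>\<^sup>+s. \<kappa> s * indicator {..T} s \<partial>lborel) < \<top>"
  shows "AE t in lborel. (\<integral>\<^sup>+s. \<kappa> s * w (t - s) \<partial>lborel) < \<top>"
proof -
  have "AE t in lborel. t \<le> real n \<longrightarrow> (\<integral>\<^sup>+s. \<kappa> s * w (t - s) \<partial>lborel) < \<top>" for n :: nat
  proof -
    have "(\<integral>\<^sup>+t. (\<integral>\<^sup>+s. \<kappa> s * w (t - s) \<partial>lborel) * indicator {..real n} t \<partial>lborel) =
       (\<integral>\<^sup>+y. w y * (\<integral>\<^sup>+s. \<kappa> s * indicator {..real n} (s + y) \<partial>lborel) \<partial>lborel)"
      by (rule nn_integral_convolution_lborel[symmetric]) auto
    also have "\<dots> \<le> (\<integral>\<^sup>+y. w y * (\<integral>\<^sup>+s. \<kappa> s * indicator {..real n} s \<partial>lborel) \<partial>lborel)"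
    proof (rule nn_integral_mono)
      fix y :: real
      show "w y * (\<integral>\<^sup>+s. \<kappa> s * indicator {..real n} (s + y) \<partial>lborel) \<le> w y * (\<integral>\<^sup>+s. \<kappa> s * indicator {..real n} s \<partial>lborel)"
        using w(2)[of y] by (cases "y \<le> 0") (auto intro!: mult_left_mono nn_integral_mono simp: indicator_def)
    qed
    also have "\<dots> < \<top>"
      using w(1) \<kappa> by (subst nn_integral_multc) (auto simp: ennreal_mult_less_top)
    finally have "AE t in lborel. (\<integral>\<^sup>+s. \<kappa> s * w (t - s) \<partial>lborel) * indicator {..real n} t \<noteq> \<infinity>"
      by (intro nn_integral_PInf_AE) auto
    then show ?thesis by eventually_elim (auto simp: indicator_def less_top)
  qed
  then have "AE t in lborel. \<forall>n. t \<le> real n \<longrightarrow> (\<integral>\<^sup>+s. \<kappa> s * w (t - s) \<partial>lborel) < \<top>"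
    by (subst AE_all_countable) blast
  then show ?thesis by eventually_elim (use real_arch_simple in blast)
qed

text \<open>The measures \<open>\<mu>1\<close>, \<open>\<mu>2\<close> themselves need not have densities; only their convolutions with the
  kernel \<open>b \<delta>\<^sub>0 + \<nu>((s,\<infinity>)) ds\<close> and the difference of the two measures do.\<close>

lemma CD_deriv_of_distribution_functions:
  fixes \<mu>1 \<mu>2 \<nu> :: "real measure" and V h1 h2 :: "real \<Rightarrow> real"
  defines "\<kappa> \<equiv> \<lambda>s. indicator {0<..} s * levy_tail \<nu> s"
  assumes fin: "finite_measure \<mu>1" "finite_measure \<mu>2"
    and sets: "sets \<mu>1 = sets borel" "sets \<mu>2 = sets borel"
    and pos: "emeasure \<mu>1 {..0} = 0" "emeasure \<mu>2 {..0} = 0"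
    and V: "\<And>t. t \<ge> 0 \<Longrightarrow> V t = measure \<mu>1 {..t} - measure \<mu>2 {..t}"
    and ac: "loc_abs_continuous V"
    and b: "b \<ge> 0" and \<kappa>_meas: "\<kappa> \<in> borel_measurable borel"
    and \<kappa>_fin: "\<And>T. (\<integral>\<^sup>+s. ennreal (\<kappa> s) * indicator {..T} s \<partial>lborel) < \<top>"
    and h_meas: "h1 \<in> borel_measurable borel" "h2 \<in> borel_measurable borel"
    and h_nonneg: "\<And>t. 0 \<le> h1 t" "\<And>t. 0 \<le> h2 t"
    and conv1: "\<And>g. g \<in> borel_measurable borel \<Longrightarrow>
      ennreal b * (\<integral>\<^sup>+y. g y \<partial>\<mu>1) + (\<integral>\<^sup>+y. (\<integral>\<^sup>+s. ennreal (\<kappa> s) * g (s + y) \<partial>lborel) \<partial>\<mu>1) = (\<integral>\<^sup>+t. ennreal (h1 t) * g t \<partial>lborel)"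
    and conv2: "\<And>g. g \<in> borel_measurable borel \<Longrightarrow>
      ennreal b * (\<integral>\<^sup>+y. g y \<partial>\<mu>2) + (\<integral>\<^sup>+y. (\<integral>\<^sup>+s. ennreal (\<kappa> s) * g (s + y) \<partial>lborel) \<partial>\<mu>2) = (\<integral>\<^sup>+t. ennreal (h2 t) * g t \<partial>lborel)"
  shows "AE t in lborel. t > 0 \<longrightarrow> CD_defined \<nu> V t \<and> CD_deriv b \<nu> V t = h1 t - h2 t"
proof -
  obtain w1 w2 :: "real \<Rightarrow> real" where int: "integrable lborel w1" "integrable lborel w2"
    and nn: "\<And>t. 0 \<le> w1 t" "\<And>t. 0 \<le> w2 t"
    and zero: "\<And>t. t \<le> 0 \<Longrightarrow> w1 t = 0" "\<And>t. t \<le> 0 \<Longrightarrow> w2 t = 0"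
    and dens: "\<And>g. g \<in> borel_measurable borel \<Longrightarrow>
      (\<integral>\<^sup>+x. g x \<partial>\<mu>1) + (\<integral>\<^sup>+x. ennreal (w2 x) * g x \<partial>lborel) = (\<integral>\<^sup>+x. g x \<partial>\<mu>2) + (\<integral>\<^sup>+x. ennreal (w1 x) * g x \<partial>lborel)"
    and der: "AE t in lborel. t > 0 \<longrightarrow> (V has_real_derivative w1 t - w2 t) (at t)"
    by (rule loc_abs_continuous_density[OF fin sets pos V ac]) blast+
  note [measurable] = \<kappa>_meas h_meas borel_measurable_integrable[OF int(1), simplified] borel_measurable_integrable[OF int(2), simplified]
  have \<kappa>0: "0 \<le> \<kappa> s" for s by (simp add: \<kappa>_def levy_tail_def)
  define cv where "cv w t = (\<integral>\<^sup>+s. ennreal (\<kappa> s) * ennreal (w (t - s)) \<partial>lborel)" for w :: "real \<Rightarrow> real" and t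
  have [measurable]: "cv w1 \<in> borel_measurable borel" "cv w2 \<in> borel_measurable borel"
    unfolding cv_def by measurable
  have dens_w: "(\<integral>\<^sup>+x. ennreal (w x) * (ennreal b * g x + (\<integral>\<^sup>+s. ennreal (\<kappa> s) * g (s + x) \<partial>lborel)) \<partial>lborel) =
      (\<integral>\<^sup>+t. (ennreal b * ennreal (w t) + cv w t) * g t \<partial>lborel)"
    if [measurable]: "w \<in> borel_measurable borel" "g \<in> borel_measurable borel" for w g
  proof -
    have "(\<integral>\<^sup>+x. ennreal (w x) * (ennreal b * g x + (\<integral>\<^sup>+s. ennreal (\<kappa> s) * g (s + x) \<partial>lborel)) \<partial>lborel) =
      (\<integral>\<^sup>+x. ennreal b * ennreal (w x) * g x + ennreal (w x) * (\<integral>\<^sup>+s. ennreal (\<kappa> s) * g (s + x) \<partial>lborel) \<partial>lborel)"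
      by (intro nn_integral_cong) (simp add: distrib_left ac_simps)
    also have "\<dots> = (\<integral>\<^sup>+x. ennreal b * ennreal (w x) * g x \<partial>lborel) + (\<integral>\<^sup>+x. ennreal (w x) * (\<integral>\<^sup>+s. ennreal (\<kappa> s) * g (s + x) \<partial>lborel) \<partial>lborel)"
      by (intro nn_integral_add) auto
    also have "(\<integral>\<^sup>+x. ennreal (w x) * (\<integral>\<^sup>+s. ennreal (\<kappa> s) * g (s + x) \<partial>lborel) \<partial>lborel) = (\<integral>\<^sup>+t. cv w t * g t \<partial>lborel)"
      unfolding cv_def by (rule nn_integral_convolution_lborel) auto
    also have "(\<integral>\<^sup>+x. ennreal b * ennreal (w x) * g x \<partial>lborel) + (\<integral>\<^sup>+t. cv w t * g t \<partial>lborel) =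
       (\<integral>\<^sup>+t. ennreal b * ennreal (w t) * g t + cv w t * g t \<partial>lborel)"
      unfolding cv_def by (intro nn_integral_add[symmetric]) auto
    finally show ?thesis by (simp add: distrib_right)
  qed
  have dens_mu: "(\<integral>\<^sup>+x. ennreal b * g x + (\<integral>\<^sup>+s. ennreal (\<kappa> s) * g (s + x) \<partial>lborel) \<partial>\<mu>) =
      ennreal b * (\<integral>\<^sup>+y. g y \<partial>\<mu>) + (\<integral>\<^sup>+y. (\<integral>\<^sup>+s. ennreal (\<kappa> s) * g (s + y) \<partial>lborel) \<partial>\<mu>)"
    if g[measurable]: "g \<in> borel_measurable borel" and s: "sets \<mu> = sets borel" for g \<mu>
  proof -
    have "(\<lambda>x. \<integral>\<^sup>+s. ennreal (\<kappa> s) * g (s + x) \<partial>lborel) \<in> borel_measurable borel" by measurable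
    then show ?thesis using g s
      by (subst nn_integral_add) (auto simp: nn_integral_cmult cong: measurable_cong_sets)
  qed
  \<comment> \<open>\<open>dens\<close> is applied to the test function b g(x) + \<integral>
    \<kappa>(s) g(s+x) ds, the adjoint of convolution with the kernel. The convolution hypotheses
    then replace both measures by densities, whatever their singular parts are.\<close>
  have key: "(\<integral>\<^sup>+t. (ennreal (h1 t) + (ennreal b * ennreal (w2 t) + cv w2 t)) * g t \<partial>lborel) =
      (\<integral>\<^sup>+t. (ennreal (h2 t) + (ennreal b * ennreal (w1 t) + cv w1 t)) * g t \<partial>lborel)"
    if g[measurable]: "g \<in> borel_measurable borel" for g
  proof -
    have "(\<integral>\<^sup>+t. (ennreal (h t) + (ennreal b * ennreal (w t) + cv w t)) * g t \<partial>lborel) =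
      (\<integral>\<^sup>+t. ennreal (h t) * g t \<partial>lborel) + (\<integral>\<^sup>+t. (ennreal b * ennreal (w t) + cv w t) * g t \<partial>lborel)"
      if [measurable]: "h \<in> borel_measurable borel" "w \<in> borel_measurable borel" for h w :: "real \<Rightarrow> real"
      unfolding distrib_right[of "ennreal (h _)"] cv_def by (intro nn_integral_add) auto
    moreover have "(\<integral>\<^sup>+t. ennreal (h1 t) * g t \<partial>lborel) + (\<integral>\<^sup>+t. (ennreal b * ennreal (w2 t) + cv w2 t) * g t \<partial>lborel) =
        (\<integral>\<^sup>+t. ennreal (h2 t) * g t \<partial>lborel) + (\<integral>\<^sup>+t. (ennreal b * ennreal (w1 t) + cv w1 t) * g t \<partial>lborel)"
      using dens[of "\<lambda>x. ennreal b * g x + (\<integral>\<^sup>+s. ennreal (\<kappa> s) * g (s + x) \<partial>lborel)"]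
      by (simp add: dens_w dens_mu[OF g sets(1)] dens_mu[OF g sets(2)] conv1 conv2)
    ultimately show ?thesis by simp
  qed
  have "density lborel (\<lambda>t. ennreal (h1 t) + (ennreal b * ennreal (w2 t) + cv w2 t)) =
      density lborel (\<lambda>t. ennreal (h2 t) + (ennreal b * ennreal (w1 t) + cv w1 t))"
    by (rule measure_eqI) (auto simp: emeasure_density key)
  then have eqAE: "AE t in lborel. ennreal (h1 t) + (ennreal b * ennreal (w2 t) + cv w2 t) = ennreal (h2 t) + (ennreal b * ennreal (w1 t) + cv w1 t)"
    by (intro sigma_finite_measure.density_unique[OF sigma_finite_lborel]) auto
  have finI: "(\<integral>\<^sup>+x. ennreal (w1 x) \<partial>lborel) < \<top>" "(\<integral>\<^sup>+x. ennreal (w2 x) \<partial>lborel) < \<top>"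
    using nn_integral_eq_integral[OF int(1)] nn_integral_eq_integral[OF int(2)] nn by auto
  \<comment> \<open>The equality just obtained is one of sums in \<open>ennreal\<close>; finiteness
    of the convolutions at almost every t allows it to be read as an equality of real
    differences.\<close>
  have finAE: "AE t in lborel. cv w1 t < \<top>" "AE t in lborel. cv w2 t < \<top>"
    unfolding cv_def by (rule AE_convolution_finite; use finI zero \<kappa>_fin in simp)+
  from eqAE finAE der show ?thesis
  proof (eventually_elim, intro impI)
    fix t :: real
    assume eq: "ennreal (h1 t) + (ennreal b * ennreal (w2 t) + cv w2 t) = ennreal (h2 t) + (ennreal b * ennreal (w1 t) + cv w1 t)"
      and f1: "cv w1 t < \<top>" and f2: "cv w2 t < \<top>"
      and d: "t > 0 \<longrightarrow> (V has_real_derivative w1 t - w2 t) (at t)" and t: "t > 0"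
    have dt: "(V has_real_derivative w1 t - w2 t) (at t)" using d t by simp
    define c where "c w s = \<kappa> s * w (t - s)" for w :: "real \<Rightarrow> real" and s
    have c: "integrable lborel (c w)" "cv w t = ennreal (LINT s|lborel. c w s)" "0 \<le> (LINT s|lborel. c w s)"
      if [measurable]: "w \<in> borel_measurable borel" and "cv w t < \<top>" "\<And>s. 0 \<le> w s" for w
    proof -
      have c0: "0 \<le> c w s" for s using \<kappa>0 that by (simp add: c_def)
      have [measurable]: "c w \<in> borel_measurable borel" unfolding c_def by measurable
      have cvc: "cv w t = (\<integral>\<^sup>+s. ennreal (c w s) \<partial>lborel)"
        unfolding cv_def c_def using \<kappa>0 by (intro nn_integral_cong) (simp add: ennreal_mult')
      show i: "integrable lborel (c w)" using that c0 cvc by (intro integrableI_nonneg) auto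
      show "cv w t = ennreal (LINT s|lborel. c w s)" unfolding cvc using c0 by (intro nn_integral_eq_integral i) auto
      show "0 \<le> (LINT s|lborel. c w s)" using c0 by simp
    qed
    note c1 = c[OF _ f1 nn(1)] and c2 = c[OF _ f2 nn(2)]
    have "h1 t + (b * w2 t + (LINT s|lborel. c w2 s)) = h2 t + (b * w1 t + (LINT s|lborel. c w1 s))"
      using eq b h_nonneg[of t] nn[of t] c1(3) c2(3) unfolding c1(2)[simplified] c2(2)[simplified]
      by (simp flip: ennreal_mult ennreal_plus)
    then have total: "b * (w1 t - w2 t) + ((LINT s|lborel. c w1 s) - (LINT s|lborel. c w2 s)) = h1 t - h2 t"
      by (simp add: algebra_simps)
    define f where "f s = c w1 s - c w2 s" for s
    have fi: "integrable lborel f" unfolding f_def using c1(1) c2(1) by (intro Bochner_Integration.integrable_diff) auto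
    \<comment> \<open>The kernel kills s \<le> 0 and the densities kill s \<ge> t, so the
      convolution over the line is already the integral over \<open>{0<..<t}\<close>.\<close>
    have f0: "f s = 0" if "s \<notin> {0<..<t}" for s using that zero by (auto simp: f_def c_def \<kappa>_def)
    then have ind: "indicator {0<..<t} s *\<^sub>R f s = f s" for s by (auto simp: indicator_def)
    have fL: "set_integrable lebesgue {0<..<t} f" "(LINT s:{0<..<t}|lebesgue. f s) = (LINT s|lborel. f s)"
      using fi borel_measurable_integrable[OF fi] unfolding set_integrable_def set_lebesgue_integral_def ind
      by (auto simp: integrable_completion integral_completion)
    define g where "g s = deriv (\<lambda>\<tau>. V (\<tau> - s)) t * levy_tail \<nu> s" for s
    \<comment> \<open>With t fixed, reflection turns differentiability of V almost everywhere into
      differentiability at t - s for almost every s.\<close>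
    have "AE s in lborel. t - s > 0 \<longrightarrow> (V has_real_derivative w1 (t - s) - w2 (t - s)) (at (t - s))"
      using AE_lborel_reflect[OF der] by simp
    then have "AE s in lborel. s \<in> {0<..<t} \<longrightarrow> g s = f s"
    proof (eventually_elim, intro impI)
      fix s assume "t - s > 0 \<longrightarrow> (V has_real_derivative w1 (t - s) - w2 (t - s)) (at (t - s))" and s: "s \<in> {0<..<t}"
      then have "(V has_real_derivative w1 (t - s) - w2 (t - s)) (at (t + (- s)))" by simp
      then have "((\<lambda>\<tau>. V (\<tau> + (- s))) has_real_derivative w1 (t - s) - w2 (t - s)) (at t)"
        unfolding DERIV_shift .
      then have dv: "deriv (\<lambda>\<tau>. V (\<tau> - s)) t = w1 (t - s) - w2 (t - s)"
        using DERIV_imp_deriv by simp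
      show "g s = f s" using s by (simp add: g_def dv f_def c_def \<kappa>_def right_diff_distrib mult.commute)
    qed
    \<comment> \<open>\<open>g\<close> need not be Borel, since \<open>deriv\<close> is unspecified
      where V is not differentiable. It is compared with the Borel function \<open>f\<close> in the
      completed measure, up to a negligible set.\<close>
    then have neg: "negligible {s. \<not> (s \<in> {0<..<t} \<longrightarrow> g s = f s)}"
      unfolding negligible_iff_null_sets using completion.AE_iff_null_sets[of "\<lambda>s. s \<in> {0<..<t} \<longrightarrow> g s = f s" lborel]
      by (simp add: AE_completion)
    have gabs: "set_integrable lebesgue {0<..<t} g"
      by (rule absolutely_integrable_spike[OF fL(1) neg]) auto
    have "(LINT s:{0<..<t}|lebesgue. g s) = integral {0<..<t} g"
      by (rule set_lebesgue_integral_eq_integral(2)[OF gabs])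
    also have "\<dots> = integral {0<..<t} f" by (rule integral_spike[OF neg]) auto
    also have "\<dots> = (LINT s:{0<..<t}|lebesgue. f s)"
      by (rule set_lebesgue_integral_eq_integral(2)[OF fL(1), symmetric])
    also have "\<dots> = (LINT s|lborel. c w1 s) - (LINT s|lborel. c w2 s)"
      using fL(2) Bochner_Integration.integral_diff[of lborel "c w1" "c w2"] c1(1) c2(1) by (simp add: f_def[abs_def])
    finally have "CD_deriv b \<nu> V t = h1 t - h2 t"
      using total unfolding CD_deriv_def DERIV_imp_deriv[OF dt] g_def by simp
    moreover have "CD_defined \<nu> V t"
      using gabs dt unfolding CD_defined_def g_def by (auto simp: real_differentiable_def)
    ultimately show "CD_defined \<nu> V t \<and> CD_deriv b \<nu> V t = h1 t - h2 t" by simp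
  qed
qed

section \<open>Uniqueness of Laplace transforms\<close>

text \<open>Absolute moments are bounded by 1, so the Taylor polynomials of the characteristic
  function, which depend on the moments alone, converge to it with error at most 2 |t|^n /
  n!.\<close>

lemma real_distribution_unit_interval_moments_unique:
  assumes "real_distribution M1" "real_distribution M2"
    and bd: "AE x in M1. \<bar>x\<bar> \<le> 1" "AE x in M2. \<bar>x\<bar> \<le> 1"
    and mom: "\<And>k::nat. (LINT x|M1. x ^ k) = (LINT x|M2. x ^ k)"
  shows "M1 = M2"
proof (rule Levy_uniqueness[OF assms(1,2)], rule ext)
  fix t
  have est: "cmod (char M t - (\<Sum>k\<le>n. ((\<i> * t) ^ k / fact k) * (LINT x|M. x ^ k))) \<le> 2 * \<bar>t\<bar> ^ n / fact n"
    if "real_distribution M" "AE x in M. \<bar>x\<bar> \<le> 1" for M n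
  proof -
    interpret real_distribution M by fact
    have i: "integrable M (\<lambda>x. x ^ k)" for k
      using that(2) by (intro integrable_const_bound[where B=1]) (auto simp: power_abs power_le_one elim!: eventually_mono)
    have "expectation (\<lambda>x. \<bar>x\<bar> ^ n) \<le> expectation (\<lambda>x. 1)"
    proof (rule integral_mono_AE)
      show "integrable M (\<lambda>x. \<bar>x\<bar> ^ n)" using integrable_abs[OF i[of n]] by (simp add: power_abs)
      show "AE x in M. \<bar>x\<bar> ^ n \<le> 1" using that(2) by eventually_elim (simp add: power_le_one)
    qed simp
    then have "expectation (\<lambda>x. \<bar>x\<bar> ^ n) \<le> 1" using prob_space by simp
    then have "(2 * \<bar>t\<bar> ^ n / fact n) * expectation (\<lambda>x. \<bar>x\<bar> ^ n) \<le> (2 * \<bar>t\<bar> ^ n / fact n) * 1"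
      by (intro mult_left_mono) auto
    then show ?thesis using char_approx1[of n t] i by (auto intro: order_trans)
  qed
  have "cmod (char M1 t - char M2 t) \<le> 4 * (\<bar>t\<bar> ^ n / fact n)" for n
  proof -
    let ?S = "\<Sum>k\<le>n. ((\<i> * t) ^ k / fact k) * (LINT x|M1. x ^ k)"
    have "cmod (char M1 t - ?S) \<le> 2 * \<bar>t\<bar> ^ n / fact n" by (rule est[OF assms(1) bd(1)])
    moreover have "cmod (char M2 t - ?S) \<le> 2 * \<bar>t\<bar> ^ n / fact n" unfolding mom by (rule est[OF assms(2) bd(2)])
    moreover have "char M1 t - char M2 t = (char M1 t - ?S) - (char M2 t - ?S)" by simp
    ultimately show ?thesis
      using norm_triangle_ineq4[of "char M1 t - ?S" "char M2 t - ?S"] by simp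
  qed
  moreover have "(\<lambda>n. 4 * (\<bar>t\<bar> ^ n / fact n)) \<longlonglongrightarrow> 4 * 0"
    using summable_LIMSEQ_zero[OF summable_exp[of "\<bar>t\<bar>"]]
    by (intro tendsto_mult tendsto_const) (simp add: field_simps)
  ultimately have "cmod (char M1 t - char M2 t) \<le> 0"
    by (intro LIMSEQ_le_const[where X="\<lambda>n. 4 * (\<bar>t\<bar> ^ n / fact n)"]) auto
  then show "char M1 t = char M2 t" by simp
qed

text \<open>The weight \<open>exp (- t)\<close> makes the measures finite, and \<open>t \<mapsto> exp (- t)\<close> turns their Laplace
  transforms at the positive integers into the moments of measures on the unit interval.\<close>

lemma Laplace_transform_unique:
  fixes \<alpha> \<beta> :: "real measure"
  assumes sets: "sets \<alpha> = sets borel" "sets \<beta> = sets borel"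
    and pos: "emeasure \<alpha> {..<0} = 0" "emeasure \<beta> {..<0} = 0"
    and eq: "\<And>n::nat. n \<ge> 1 \<Longrightarrow> (\<integral>\<^sup>+t. ennreal (exp (- real n * t)) \<partial>\<alpha>) = (\<integral>\<^sup>+t. ennreal (exp (- real n * t)) \<partial>\<beta>)"
    and fin: "(\<integral>\<^sup>+t. ennreal (exp (- t)) \<partial>\<alpha>) < \<top>"
  shows "\<alpha> = \<beta>"
proof -
  define c where "c = (\<integral>\<^sup>+t. ennreal (exp (- t)) \<partial>\<alpha>)"
  have c\<beta>: "(\<integral>\<^sup>+t. ennreal (exp (- t)) \<partial>\<beta>) = c" using eq[of 1] by (simp add: c_def)
  have cfin: "c < \<top>" using fin by (simp add: c_def)
  show ?thesis
  proof (cases "c = 0")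
    case True
    have "\<mu> = null_measure borel" if s: "sets \<mu> = sets borel" and "(\<integral>\<^sup>+t. ennreal (exp (- t)) \<partial>\<mu>) = 0" for \<mu> :: "real measure"
    proof (rule measure_eqI)
      note [measurable_cong] = s
      have "AE t in \<mu>. ennreal (exp (- t)) = 0" using that(2) by (subst (asm) nn_integral_0_iff_AE) auto
      then have "AE t in \<mu>. \<not> True" by eventually_elim simp
      from emeasure_eq_0_AE[OF this] have "emeasure \<mu> (space \<mu>) = 0" by simp
      then show "emeasure \<mu> A = emeasure (null_measure borel) A" if "A \<in> sets \<mu>" for A
        using emeasure_space[of \<mu> A] by simp
    qed (simp add: s)
    then show ?thesis using sets True c\<beta> c_def by metis
  next
    case False
    define r where "r = enn2real c"
    have cr: "c = ennreal r" "r > 0" using cfin False by (auto simp: r_def enn2real_positive_iff less_top zero_less_iff_neq_zero)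
    define P where "P \<mu> = density \<mu> (\<lambda>t. ennreal (exp (- t) / r))" for \<mu> :: "real measure"
    define Q where "Q \<mu> = distr (P \<mu>) borel (\<lambda>t. exp (- t))" for \<mu>
    \<comment> \<open>The weight contributes one factor exp (- t), so the moment of order k is the
      transform at k + 1; the order 0 gives the normalization.\<close>
    have int: "(\<integral>\<^sup>+y. ennreal (y ^ k) \<partial>Q \<mu>) = (\<integral>\<^sup>+t. ennreal (exp (- real (Suc k) * t)) \<partial>\<mu>) / c"
      if s: "sets \<mu> = sets borel" for \<mu> k
    proof -
      note [measurable_cong] = s
      have "(\<integral>\<^sup>+y. ennreal (y ^ k) \<partial>Q \<mu>) = (\<integral>\<^sup>+t. ennreal (exp (- t) / r) * ennreal (exp (- t) ^ k) \<partial>\<mu>)"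
        unfolding Q_def P_def by (subst nn_integral_distr) (auto simp: nn_integral_density)
      also have "\<dots> = (\<integral>\<^sup>+t. ennreal (1 / r) * ennreal (exp (- real (Suc k) * t)) \<partial>\<mu>)"
        using cr by (intro nn_integral_cong) (simp add: exp_of_nat_mult[symmetric] ennreal_mult'[symmetric] exp_add[symmetric] algebra_simps)
      also have "\<dots> = (\<integral>\<^sup>+t. ennreal (exp (- real (Suc k) * t)) \<partial>\<mu>) / c"
        using cr by (subst nn_integral_cmult) (auto simp: divide_ennreal_def inverse_ennreal field_simps inverse_eq_divide ac_simps)
      finally show ?thesis .
    qed
    have rd: "real_distribution (Q \<mu>)" "AE x in Q \<mu>. 0 \<le> x \<and> x \<le> 1"
      if s: "sets \<mu> = sets borel" and p: "emeasure \<mu> {..<0} = 0" and i: "(\<integral>\<^sup>+t. ennreal (exp (- t)) \<partial>\<mu>) = c" for \<mu>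
    proof -
      note [measurable_cong] = s
      have "emeasure (Q \<mu>) (space (Q \<mu>)) = 1"
        using int[OF s, of 0] i cr by simp
      moreover have "sets (Q \<mu>) = sets borel" by (simp add: Q_def)
      ultimately show "real_distribution (Q \<mu>)"
        by (intro real_distribution.intro real_distribution_axioms.intro prob_spaceI) auto
      have "AE t in \<mu>. 0 \<le> t" using p s by (intro AE_I'[of "{..<0}"]) (auto simp: null_sets_def)
      then show "AE x in Q \<mu>. 0 \<le> x \<and> x \<le> 1"
        unfolding Q_def P_def by (subst AE_distr_iff) (auto simp: AE_density s sets_eq_imp_space_eq[OF s])
    qed
    note rd\<alpha> = rd[OF sets(1) pos(1) c_def[symmetric]] and rd\<beta> = rd[OF sets(2) pos(2) c\<beta>]
    have lint: "(LINT y|Q \<mu>. y ^ k) = enn2real ((\<integral>\<^sup>+t. ennreal (exp (- real (Suc k) * t)) \<partial>\<mu>) / c)"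
      if "sets \<mu> = sets borel" "AE x in Q \<mu>. 0 \<le> x \<and> x \<le> 1" for \<mu> k
      unfolding int[OF that(1), symmetric] using that(2)
      by (intro integral_eq_nn_integral) (auto simp: Q_def elim!: eventually_mono)
    have "Q \<alpha> = Q \<beta>"
    proof (rule real_distribution_unit_interval_moments_unique[OF rd\<alpha>(1) rd\<beta>(1)])
      show "AE x in Q \<alpha>. \<bar>x\<bar> \<le> 1" "AE x in Q \<beta>. \<bar>x\<bar> \<le> 1"
        by (rule eventually_mono[OF rd\<alpha>(2)]; simp) (rule eventually_mono[OF rd\<beta>(2)]; simp)
      show "(LINT x|Q \<alpha>. x ^ k) = (LINT x|Q \<beta>. x ^ k)" for k
        unfolding lint[OF sets(1) rd\<alpha>(2)] lint[OF sets(2) rd\<beta>(2)] using eq[of "Suc k"] by simp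
    qed
    \<comment> \<open>The substitution exp (- t) is undone by - ln, and the factor
      \<open>r * exp t\<close> afterwards undoes the weight, so equality on the unit interval
      returns to the original measures.\<close>
    moreover have "P \<mu> = distr (Q \<mu>) borel (\<lambda>y. - ln y)" if "sets \<mu> = sets borel" for \<mu>
    proof -
      have "P \<mu> = distr (P \<mu>) borel (\<lambda>x. x)" using that by (intro distr_id2[symmetric]) (simp add: P_def)
      also have "\<dots> = distr (Q \<mu>) borel (\<lambda>y. - ln y)"
        unfolding Q_def using that by (subst distr_distr) (auto simp: P_def comp_def cong: measurable_cong_sets)
      finally show ?thesis .
    qed
    ultimately have PP: "P \<alpha> = P \<beta>" using sets by metis
    have "\<mu> = density (P \<mu>) (\<lambda>t. ennreal (r * exp t))" if "sets \<mu> = sets borel" for \<mu>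
    proof -
      note [measurable_cong] = that
      have "density (P \<mu>) (\<lambda>t. ennreal (r * exp t)) = density \<mu> (\<lambda>t. ennreal (exp (- t) / r) * ennreal (r * exp t))"
        unfolding P_def by (intro density_density_eq) auto
      also have "\<dots> = density \<mu> (\<lambda>t. 1)"
        using cr(2) by (intro density_cong) (auto simp: ennreal_mult'[symmetric] exp_minus field_simps)
      finally show ?thesis by (simp add: density_1)
    qed
    then show ?thesis using PP sets by metis
  qed
qed

section \<open>Levy measures and Bernstein functions\<close>

text \<open>Extension of the tail by zero to the whole line, so that convolutions with it are
  integrals over \<open>lborel\<close> without limits depending on t.\<close>

definition levy_kernel :: "real measure \<Rightarrow> real \<Rightarrow> real" where
  "levy_kernel \<nu> s = indicator {0<..} s * levy_tail \<nu> s"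

locale levy_measure =
  fixes \<nu> :: "real measure" and b :: real
  assumes levy: "levy_measure_pos \<nu>" and b_nonneg: "b \<ge> 0"
begin

lemma sets_nu [measurable_cong, simp]: "sets \<nu> = sets borel"
  using levy by (simp add: levy_measure_pos_def)

lemma space_nu [simp]: "space \<nu> = UNIV"
  using sets_eq_imp_space_eq[OF sets_nu] by simp

lemma nn_integral_min_finite: "(\<integral>\<^sup>+x. ennreal (min x 1) * indicator {0<..} x \<partial>\<nu>) < \<top>"
  using levy by (simp add: levy_measure_pos_def)

lemma AE_nu_pos: "AE x in \<nu>. x > 0"
  using levy by (intro AE_I'[of "{..0}"]) (auto simp: levy_measure_pos_def null_sets_def)

lemma emeasure_tail_finite:
  assumes "s > 0"
  shows "emeasure \<nu> {s<..} < \<top>"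
proof -
  have "ennreal (min s 1) * emeasure \<nu> {s<..} = (\<integral>\<^sup>+x. ennreal (min s 1) * indicator {s<..} x \<partial>\<nu>)"
    by (simp add: nn_integral_cmult)
  also have "\<dots> \<le> (\<integral>\<^sup>+x. ennreal (min x 1) * indicator {0<..} x \<partial>\<nu>)"
    using assms by (intro nn_integral_mono) (auto simp: indicator_def intro!: ennreal_leI)
  also have "\<dots> < \<top>" by (rule nn_integral_min_finite)
  finally show ?thesis using assms by (auto simp: ennreal_mult_less_top)
qed

text \<open>Exchanging integrals with the infinite measure \<nu> requires this. The null set
  \<open>{..0}\<close> and the tails beyond 1/(n+1) cover the line.\<close>

lemma sigma_finite_nu: "sigma_finite_measure \<nu>"
proof
  let ?A = "insert {..0} (range (\<lambda>n. {1 / real (Suc n)<..}))"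
  have "x \<in> \<Union> ?A" for x :: real
  proof (cases "x \<le> 0")
    case False
    then obtain n where "inverse (real (Suc n)) < x" using reals_Archimedean[of x] by auto
    then show ?thesis by (auto simp: inverse_eq_divide)
  qed auto
  then show "\<exists>A. countable A \<and> A \<subseteq> sets \<nu> \<and> \<Union> A = space \<nu> \<and> (\<forall>a\<in>A. emeasure \<nu> a \<noteq> \<infinity>)"
    using levy emeasure_tail_finite[of "1 / real (Suc _)"]
    by (intro exI[of _ ?A]) (auto simp: levy_measure_pos_def less_top)
qed

text \<open>The integrand is jointly measurable in s and x; this gives measurability of the tail and
  the exchange of integrals in \<open>nn_integral_levy_kernel\<close>.\<close>

lemma ennreal_levy_kernel: "ennreal (levy_kernel \<nu> s) = (\<integral>\<^sup>+x. (if 0 < s \<and> s < x then 1 else 0) \<partial>\<nu>)"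
proof (cases "s > 0")
  case True
  then have "(\<integral>\<^sup>+x. (if 0 < s \<and> s < x then 1 else 0) \<partial>\<nu>) = (\<integral>\<^sup>+x. indicator {s<..} x \<partial>\<nu>)"
    by (intro nn_integral_cong) (auto simp: indicator_def)
  then have "(\<integral>\<^sup>+x. (if 0 < s \<and> s < x then 1 else 0) \<partial>\<nu>) = emeasure \<nu> {s<..}" by simp
  moreover have "emeasure \<nu> {s<..} = ennreal (measure \<nu> {s<..})"
    using emeasure_tail_finite[OF True] by (intro emeasure_eq_ennreal_measure) auto
  ultimately show ?thesis using True by (simp add: levy_kernel_def levy_tail_def)
qed (simp add: levy_kernel_def)

lemma levy_kernel_nonneg [simp]: "0 \<le> levy_kernel \<nu> s"
  by (simp add: levy_kernel_def levy_tail_def)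

lemma levy_kernel_zero: "s \<le> 0 \<Longrightarrow> levy_kernel \<nu> s = 0"
  by (simp add: levy_kernel_def)

lemma measurable_levy_kernel [measurable]: "levy_kernel \<nu> \<in> borel_measurable borel"
proof -
  interpret sigma_finite_measure \<nu> by (rule sigma_finite_nu)
  have "(\<lambda>s. enn2real (ennreal (levy_kernel \<nu> s))) \<in> borel_measurable borel"
    unfolding ennreal_levy_kernel by (intro measurable_compose[OF _ borel_measurable_enn2real] borel_measurable_nn_integral) measurable
  then show ?thesis by simp
qed

lemma nn_integral_levy_kernel:
  assumes [measurable]: "g \<in> borel_measurable borel"
  shows "(\<integral>\<^sup>+s. ennreal (levy_kernel \<nu> s) * g s \<partial>lborel) = (\<integral>\<^sup>+x. (\<integral>\<^sup>+s. g s * indicator {0<..<x} s \<partial>lborel) \<partial>\<nu>)"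
proof -
  interpret \<nu>: sigma_finite_measure \<nu> by (rule sigma_finite_nu)
  interpret pair_sigma_finite lborel \<nu> ..
  have "(\<integral>\<^sup>+s. ennreal (levy_kernel \<nu> s) * g s \<partial>lborel) = (\<integral>\<^sup>+s. (\<integral>\<^sup>+x. (if 0 < s \<and> s < x then 1 else 0) * g s \<partial>\<nu>) \<partial>lborel)"
    unfolding ennreal_levy_kernel by (intro nn_integral_cong nn_integral_multc[symmetric]) auto
  also have "\<dots> = (\<integral>\<^sup>+x. (\<integral>\<^sup>+s. (if 0 < s \<and> s < x then 1 else 0) * g s \<partial>lborel) \<partial>\<nu>)"
    by (intro Fubini'[symmetric]) measurable
  also have "\<dots> = (\<integral>\<^sup>+x. (\<integral>\<^sup>+s. g s * indicator {0<..<x} s \<partial>lborel) \<partial>\<nu>)"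
    by (intro nn_integral_cong) (auto simp: indicator_def)
  finally show ?thesis .
qed

text \<open>Exchanging integrals bounds the left side by the \<nu>-integral of the positive part of
  min(x,T), which is at most max(T,1) min(x,1) for x > 0.\<close>

lemma nn_integral_levy_kernel_finite: "(\<integral>\<^sup>+s. ennreal (levy_kernel \<nu> s) * indicator {..T} s \<partial>lborel) < \<top>"
proof -
  have "(\<integral>\<^sup>+s. ennreal (levy_kernel \<nu> s) * indicator {..T} s \<partial>lborel) = (\<integral>\<^sup>+x. (\<integral>\<^sup>+s. indicator {..T} s * indicator {0<..<x} s \<partial>lborel) \<partial>\<nu>)"
    by (rule nn_integral_levy_kernel) simp
  also have "\<dots> \<le> (\<integral>\<^sup>+x. ennreal (max T 1) * (ennreal (min x 1) * indicator {0<..} x) \<partial>\<nu>)"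
  proof (rule nn_integral_mono_AE, use AE_nu_pos in eventually_elim)
    fix x :: real assume x: "x > 0"
    have "(\<integral>\<^sup>+s. indicator {..T} s * indicator {0<..<x} s \<partial>lborel) \<le> (\<integral>\<^sup>+s. indicator {0..max 0 (min x T)} s \<partial>lborel)"
      by (intro nn_integral_mono) (auto simp: indicator_def)
    also have "\<dots> = ennreal (max 0 (min x T))" by simp
    also have "\<dots> \<le> ennreal (max T 1 * min x 1)"
    proof (rule ennreal_leI)
      have "min x T \<le> max T 1 * min x 1" using x by (cases "x \<le> 1") (auto simp: mult_le_cancel_right2 min_def max_def)
      then show "max 0 (min x T) \<le> max T 1 * min x 1" using x by (simp add: max_def)
    qed
    also have "\<dots> = ennreal (max T 1) * (ennreal (min x 1) * indicator {0<..} x)"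
      using x by (simp add: ennreal_mult)
    finally show "(\<integral>\<^sup>+s. indicator {..T} s * indicator {0<..<x} s \<partial>lborel) \<le> ennreal (max T 1) * (ennreal (min x 1) * indicator {0<..} x)" .
  qed
  also have "\<dots> = ennreal (max T 1) * (\<integral>\<^sup>+x. ennreal (min x 1) * indicator {0<..} x \<partial>\<nu>)"
    by (rule nn_integral_cmult) measurable
  also have "\<dots> < \<top>" using nn_integral_min_finite by (simp add: ennreal_mult_less_top)
  finally show ?thesis .
qed

abbreviation f :: "real \<Rightarrow> real" where "f \<equiv> bernstein_fun b \<nu>"

lemma set_integrable_bernstein:
  assumes "s > 0"
  shows "set_integrable \<nu> {0<..} (\<lambda>x. 1 - exp (- s * x))"
proof -
  have le: "1 - exp (- s * x) \<le> max s 1 * min x 1" if "x > 0" for x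
  proof -
    have "1 - exp (- s * x) \<le> s * x" using exp_ge_add_one_self[of "- s * x"] by simp
    moreover have "1 - exp (- s * x) \<le> 1" by simp
    moreover have "s * x \<le> max s 1 * x" using that by (intro mult_right_mono) auto
    moreover have "1 \<le> max s 1" by simp
    ultimately show ?thesis
    proof (cases "x \<le> 1")
      case True
      then have m: "min x 1 = x" by simp
      show ?thesis unfolding m using \<open>1 - exp (- s * x) \<le> s * x\<close> \<open>s * x \<le> max s 1 * x\<close> by linarith
    next
      case False
      then have m: "min x 1 = 1" by simp
      show ?thesis unfolding m mult_1_right using \<open>1 - exp (- s * x) \<le> 1\<close> \<open>1 \<le> max s 1\<close> by linarith
    qed
  qed
  have le': "1 - exp (- (s * x)) \<le> max s 1 * min x 1" if "x > 0" for x
    using le[OF that] by (simp only: mult_minus_left)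
  have "(\<integral>\<^sup>+x. ennreal (indicator {0<..} x * (1 - exp (- s * x))) \<partial>\<nu>) \<le> (\<integral>\<^sup>+x. ennreal (max s 1) * (ennreal (min x 1) * indicator {0<..} x) \<partial>\<nu>)"
    by (intro nn_integral_mono) (auto simp: indicator_def ennreal_mult[symmetric] intro!: ennreal_leI le')
  also have "\<dots> = ennreal (max s 1) * (\<integral>\<^sup>+x. ennreal (min x 1) * indicator {0<..} x \<partial>\<nu>)"
    by (rule nn_integral_cmult) measurable
  also have "\<dots> < \<top>" using nn_integral_min_finite by (simp add: ennreal_mult_less_top)
  finally show ?thesis unfolding set_integrable_def using assms
    by (intro integrableI_nonneg) (auto simp: indicator_def)
qed

lemma ennreal_bernstein_fun:
  assumes s: "s > 0"
  shows "ennreal (f s) = ennreal (b * s) + (\<integral>\<^sup>+x. ennreal (1 - exp (- s * x)) * indicator {0<..} x \<partial>\<nu>)"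
proof -
  have "(\<integral>\<^sup>+x. ennreal (1 - exp (- s * x)) * indicator {0<..} x \<partial>\<nu>) = (\<integral>\<^sup>+x. ennreal (indicator {0<..} x *\<^sub>R (1 - exp (- s * x))) \<partial>\<nu>)"
    by (intro nn_integral_cong) (auto simp: indicator_def)
  also have "\<dots> = ennreal (LINT x:{0<..}|\<nu>. 1 - exp (- s * x))"
    using set_integrable_bernstein[OF s] s unfolding set_integrable_def set_lebesgue_integral_def
    by (intro nn_integral_eq_integral) (auto simp: indicator_def)
  finally have eq: "(\<integral>\<^sup>+x. ennreal (1 - exp (- s * x)) * indicator {0<..} x \<partial>\<nu>) = ennreal (LINT x:{0<..}|\<nu>. 1 - exp (- s * x))" .
  have "0 \<le> (LINT x:{0<..}|\<nu>. 1 - exp (- s * x))"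
    using s unfolding set_lebesgue_integral_def by (intro integral_nonneg_AE) (auto simp: indicator_def)
  then show ?thesis using s b_nonneg unfolding eq bernstein_fun_def by (simp add: ennreal_plus)
qed

lemma bernstein_fun_nonneg: "s > 0 \<Longrightarrow> 0 \<le> f s"
  using b_nonneg unfolding bernstein_fun_def set_lebesgue_integral_def
  by (intro add_nonneg_nonneg integral_nonneg_AE) (auto simp: indicator_def)

lemma bernstein_fun_pos:
  assumes s: "s > 0"
  shows "0 < f s"
proof (rule ccontr)
  assume "\<not> 0 < f s"
  then have "ennreal (f s) = 0" by (simp add: ennreal_eq_0_iff)
  then have "(\<integral>\<^sup>+x. ennreal (1 - exp (- s * x)) * indicator {0<..} x \<partial>\<nu>) = 0"
    using ennreal_bernstein_fun[OF s] by simp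
  then have "AE x in \<nu>. ennreal (1 - exp (- s * x)) * indicator {0<..} x = 0"
    by (subst (asm) nn_integral_0_iff_AE) auto
  with AE_nu_pos have "AE x in \<nu>. \<not> (x \<in> {0<..})"
    by eventually_elim (use s in \<open>auto simp: ennreal_eq_0_iff mult_le_0_iff\<close>)
  from emeasure_eq_0_AE[OF this] have "emeasure \<nu> {0<..} = 0" by (simp add: greaterThan_def)
  then show False using levy by (simp add: levy_measure_pos_def)
qed

text \<open>By monotone convergence the integral part alone tends to the mass of \<nu> on the
  positive half-line, which is infinite; so the growth does not depend on the drift b.\<close>

lemma bernstein_fun_at_top: "filterlim (\<lambda>n. f (real (Suc n))) at_top sequentially"
proof -
  have "(\<lambda>n. \<integral>\<^sup>+x. ennreal (1 - exp (- real (Suc n) * x)) * indicator {0<..} x \<partial>\<nu>) \<longlonglongrightarrow> (\<integral>\<^sup>+x. indicator {0<..} x \<partial>\<nu>)"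
  proof (rule nn_integral_LIMSEQ)
    show "incseq (\<lambda>n x. ennreal (1 - exp (- real (Suc n) * x)) * indicator {0<..} x)"
      by (intro incseq_SucI le_funI) (auto simp: indicator_def intro!: ennreal_leI)
    fix x :: real
    show "(\<lambda>n. ennreal (1 - exp (- real (Suc n) * x)) * indicator {0<..} x) \<longlonglongrightarrow> indicator {0<..} x"
    proof (cases "x > 0")
      case True
      have "(\<lambda>n. exp (- x) ^ Suc n) \<longlonglongrightarrow> 0"
        using True by (intro LIMSEQ_Suc LIMSEQ_realpow_zero) auto
      then have "(\<lambda>n. exp (- real (Suc n) * x)) \<longlonglongrightarrow> 0"
        unfolding exp_of_nat_mult[symmetric] by (simp only: mult_minus_left mult_minus_right)
      then have "(\<lambda>n. ennreal (1 - exp (- real (Suc n) * x))) \<longlonglongrightarrow> ennreal (1 - 0)"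
        by (intro tendsto_ennrealI tendsto_diff tendsto_const)
      then show ?thesis using True by simp
    qed simp
  qed auto
  moreover have "(\<integral>\<^sup>+x. indicator {0<..} x \<partial>\<nu>) = \<top>" using levy by (simp add: levy_measure_pos_def)
  ultimately have lim: "(\<lambda>n. \<integral>\<^sup>+x. ennreal (1 - exp (- real (Suc n) * x)) * indicator {0<..} x \<partial>\<nu>) \<longlonglongrightarrow> \<top>" by simp
  show ?thesis
    unfolding filterlim_at_top
  proof
    fix Z :: real
    have "eventually (\<lambda>n. ennreal (max Z 0) < (\<integral>\<^sup>+x. ennreal (1 - exp (- real (Suc n) * x)) * indicator {0<..} x \<partial>\<nu>)) sequentially"
      by (rule order_tendstoD(1)[OF lim]) simp
    then show "eventually (\<lambda>n. Z \<le> f (real (Suc n))) sequentially"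
    proof eventually_elim
      fix n assume "ennreal (max Z 0) < (\<integral>\<^sup>+x. ennreal (1 - exp (- real (Suc n) * x)) * indicator {0<..} x \<partial>\<nu>)"
      also have "\<dots> \<le> ennreal (f (real (Suc n)))"
        by (subst ennreal_bernstein_fun) (auto simp del: of_nat_Suc)
      finally have "max Z 0 < f (real (Suc n))" by (subst (asm) ennreal_less_iff) auto
      then show "Z \<le> f (real (Suc n))" by simp
    qed
  qed
qed

lemma nn_integral_levy_kernel_exp:
  assumes s: "s > 0"
  shows "ennreal b + (\<integral>\<^sup>+y. ennreal (levy_kernel \<nu> y) * ennreal (exp (- s * y)) \<partial>lborel) = ennreal (f s / s)"
proof -
  have inner: "(\<integral>\<^sup>+y. ennreal (exp (- s * y)) * indicator {0<..<x} y \<partial>lborel) = ennreal (1 / s) * (ennreal (1 - exp (- s * x)) * indicator {0<..} x)" for x :: real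
  proof (cases "x > 0")
    case True
    have "(\<integral>\<^sup>+y. ennreal (exp (- s * y)) * indicator {0<..<x} y \<partial>lborel) = (\<integral>\<^sup>+y. ennreal (exp (- s * y)) * indicator {0..x} y \<partial>lborel)"
      using AE_lborel_singleton[of 0] AE_lborel_singleton[of x]
      by (intro nn_integral_cong_AE, eventually_elim) (auto simp: indicator_def)
    also have "\<dots> = ennreal ((- exp (- s * x) / s) - (- exp (- s * 0) / s))"
      using s True by (intro nn_integral_FTC_Icc) (auto intro!: derivative_eq_intros)
    finally show ?thesis using True s by (simp add: ennreal_mult'[symmetric] field_simps)
  qed (simp add: indicator_def)
  have "(\<integral>\<^sup>+y. ennreal (levy_kernel \<nu> y) * ennreal (exp (- s * y)) \<partial>lborel) = (\<integral>\<^sup>+x. ennreal (1 / s) * (ennreal (1 - exp (- s * x)) * indicator {0<..} x) \<partial>\<nu>)"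
    unfolding inner[symmetric] by (rule nn_integral_levy_kernel) simp
  also have "\<dots> = ennreal (1 / s) * (\<integral>\<^sup>+x. ennreal (1 - exp (- s * x)) * indicator {0<..} x \<partial>\<nu>)"
    by (rule nn_integral_cmult) measurable
  finally have "ennreal b + (\<integral>\<^sup>+y. ennreal (levy_kernel \<nu> y) * ennreal (exp (- s * y)) \<partial>lborel) =
     ennreal (1 / s) * (ennreal (b * s) + (\<integral>\<^sup>+x. ennreal (1 - exp (- s * x)) * indicator {0<..} x \<partial>\<nu>))"
    using s b_nonneg by (simp add: distrib_left ennreal_mult'[symmetric])
  also have "\<dots> = ennreal (f s / s)"
    unfolding ennreal_bernstein_fun[OF s, symmetric] using s bernstein_fun_nonneg[OF s] by (simp add: ennreal_mult'[symmetric])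
  finally show ?thesis .
qed

end

section \<open>Subordinators and their inverses\<close>

text \<open>The floor plus one, unlike the ceiling, lies strictly to the right of r even when r is a
  grid point, as \<open>at_right\<close> demands.\<close>

lemma grid_tendsto_at_right:
  "filterlim (\<lambda>n. real_of_int (\<lfloor>real (Suc n) * r\<rfloor> + 1) / real (Suc n)) (at_right r) sequentially"
  unfolding filterlim_at
proof
  have bnd: "r < real_of_int (\<lfloor>real (Suc n) * r\<rfloor> + 1) / real (Suc n)"
    "real_of_int (\<lfloor>real (Suc n) * r\<rfloor> + 1) / real (Suc n) \<le> r + 1 / real (Suc n)" for n
  proof -
    define m where "m = real (Suc n)"
    define k where "k = real_of_int (\<lfloor>m * r\<rfloor> + 1)"
    have m: "0 < m" by (simp add: m_def)
    have "m * r < k" "k \<le> m * r + 1" unfolding k_def by linarith+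
    then have "r < k / m" "k / m \<le> r + 1 / m" using m by (simp_all add: field_simps)
    then show "r < real_of_int (\<lfloor>real (Suc n) * r\<rfloor> + 1) / real (Suc n)"
      "real_of_int (\<lfloor>real (Suc n) * r\<rfloor> + 1) / real (Suc n) \<le> r + 1 / real (Suc n)"
      unfolding k_def m_def by this+
  qed
  show "\<forall>\<^sub>F n in sequentially. real_of_int (\<lfloor>real (Suc n) * r\<rfloor> + 1) / real (Suc n) \<in> {r<..} \<and>
     real_of_int (\<lfloor>real (Suc n) * r\<rfloor> + 1) / real (Suc n) \<noteq> r"
    using bnd(1) by (intro always_eventually allI conjI) (simp only: greaterThan_iff, metis less_irrefl)
  show "(\<lambda>n. real_of_int (\<lfloor>real (Suc n) * r\<rfloor> + 1) / real (Suc n)) \<longlonglongrightarrow> r"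
  proof (rule tendsto_sandwich[OF _ _ tendsto_const])
    have "(\<lambda>n. r + 1 / real (Suc n)) \<longlonglongrightarrow> r + 0"
      by (intro tendsto_add tendsto_const LIMSEQ_Suc[OF lim_const_over_n])
    then show "(\<lambda>n. r + 1 / real (Suc n)) \<longlonglongrightarrow> r" by simp
  qed (use bnd in \<open>blast intro: always_eventually less_imp_le\<close>)+
qed

locale subordinator_setting = prob_space M + levy_measure \<nu> b
  for M :: "'a measure" and \<nu> :: "real measure" and b :: real +
  fixes D :: "real \<Rightarrow> 'a \<Rightarrow> real"
  assumes subordinator: "levy_subordinator M D"
    and Laplace: "\<And>s t. s > 0 \<Longrightarrow> t \<ge> 0 \<Longrightarrow> expectation (\<lambda>\<omega>. exp (- s * D t \<omega>)) = exp (- t * bernstein_fun b \<nu> s)"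
begin

text \<open>Only nonnegative times of D are governed by the hypotheses; clamping gives a function on
  the whole line that can be measurable jointly in time and outcome.\<close>

definition D' :: "real \<Rightarrow> 'a \<Rightarrow> real" where "D' r \<omega> = D (max r 0) \<omega>"

lemma measurable_D: "t \<ge> 0 \<Longrightarrow> D t \<in> borel_measurable M"
  using subordinator by (simp add: levy_subordinator_def)

lemma measurable_D' [measurable]: "D' r \<in> borel_measurable M"
  unfolding D'_def[abs_def] by (rule measurable_D) simp

lemma D_mono: "\<omega> \<in> space M \<Longrightarrow> 0 \<le> r \<Longrightarrow> r \<le> r' \<Longrightarrow> D r \<omega> \<le> D r' \<omega>"
  using subordinator by (auto simp: levy_subordinator_def increasing_rcont_paths_def mono_on_def)

lemma D_right_continuous: "\<omega> \<in> space M \<Longrightarrow> 0 \<le> t \<Longrightarrow> continuous (at_right t) (\<lambda>t. D t \<omega>)"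
  using subordinator by (auto simp: levy_subordinator_def increasing_rcont_paths_def)

lemma AE_D_nonneg: "AE \<omega> in M. \<forall>t\<ge>0. 0 \<le> D t \<omega>"
proof -
  have "AE \<omega> in M. D 0 \<omega> = 0" using subordinator by (simp add: levy_subordinator_def)
  with AE_space show ?thesis
  proof (eventually_elim, intro allI impI)
    fix \<omega> and t :: real assume "\<omega> \<in> space M" "D 0 \<omega> = 0" "0 \<le> t"
    then show "0 \<le> D t \<omega>" using D_mono[of \<omega> 0 t] by simp
  qed
qed

text \<open>Right-continuity makes the process a pointwise limit of processes evaluated at grid
  times to the right, and each of these involves only countably many random variables.\<close>

lemma measurable_D'_pair [measurable]: "(\<lambda>(r, \<omega>). D' r \<omega>) \<in> borel_measurable (borel \<Otimes>\<^sub>M M)"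
proof (rule borel_measurable_LIMSEQ_real)
  let ?z = "\<lambda>(n::nat) (r::real). \<lfloor>real (Suc n) * max r 0\<rfloor>"
  let ?u = "\<lambda>n p. D' (real_of_int (?z n (fst p) + 1) / real (Suc n)) (snd p)"
  show "?u n \<in> borel_measurable (borel \<Otimes>\<^sub>M M)" for n
    by (rule measurable_compose_countable[where f="\<lambda>i p. D' (real_of_int (i + 1) / real (Suc n)) (snd p)" and g="\<lambda>p. ?z n (fst p)"]) measurable
  fix p :: "real \<times> 'a" assume p: "p \<in> space (borel \<Otimes>\<^sub>M M)"
  obtain r \<omega> where [simp]: "p = (r, \<omega>)" by (cases p)
  have w: "\<omega> \<in> space M" using p by (simp add: space_pair_measure)
  have "((\<lambda>t. D t \<omega>) \<longlongrightarrow> D (max r 0) \<omega>) (at_right (max r 0))"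
    using D_right_continuous[OF w, of "max r 0"] by (simp add: continuous_within)
  then have "(\<lambda>n. D (real_of_int (?z n r + 1) / real (Suc n)) \<omega>) \<longlonglongrightarrow> D (max r 0) \<omega>"
    by (rule filterlim_compose[OF _ grid_tendsto_at_right])
  moreover have "D' (real_of_int (?z n r + 1) / real (Suc n)) \<omega> = D (real_of_int (?z n r + 1) / real (Suc n)) \<omega>" for n
    unfolding D'_def by (subst max_absorb1) auto
  ultimately show "(\<lambda>n. ?u n p) \<longlonglongrightarrow> (case p of (r, \<omega>) \<Rightarrow> D' r \<omega>)"
    by (simp add: D'_def del: of_nat_Suc)
qed

lemma nn_integral_exp_D:
  assumes "s > 0" "r \<ge> 0"
  shows "(\<integral>\<^sup>+\<omega>. ennreal (exp (- s * D r \<omega>)) \<partial>M) = ennreal (exp (- r * f s))"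
proof -
  have [measurable]: "D r \<in> borel_measurable M" by (rule measurable_D[OF assms(2)])
  have "integrable M (\<lambda>\<omega>. exp (- s * D r \<omega>))"
  proof (rule integrable_const_bound[where B=1])
    show "AE \<omega> in M. norm (exp (- s * D r \<omega>)) \<le> 1"
      using AE_D_nonneg by eventually_elim (use assms in simp)
  qed measurable
  from nn_integral_eq_integral[OF this] show ?thesis unfolding Laplace[OF assms] by simp
qed

text \<open>The probability that D r \<le> 0 is at most E exp(-s D r) = exp(-r f(s)) for every s >
  0, and f is unbounded.\<close>

lemma AE_D_pos:
  assumes r: "r > 0"
  shows "AE \<omega> in M. 0 < D r \<omega>"
proof -
  have [measurable]: "D r \<in> borel_measurable M" by (rule measurable_D) (use r in simp)
  have le: "emeasure M {\<omega>\<in>space M. D r \<omega> \<le> 0} \<le> ennreal (exp (- r * f (real (Suc n))))" for n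
  proof -
    have "emeasure M {\<omega>\<in>space M. D r \<omega> \<le> 0} = (\<integral>\<^sup>+\<omega>. indicator {\<omega>\<in>space M. D r \<omega> \<le> 0} \<omega> \<partial>M)" by simp
    also have "\<dots> \<le> (\<integral>\<^sup>+\<omega>. ennreal (exp (- real (Suc n) * D r \<omega>)) \<partial>M)"
      by (intro nn_integral_mono) (auto simp: indicator_def mult_le_0_iff simp del: of_nat_Suc)
    also have "\<dots> = ennreal (exp (- r * f (real (Suc n))))" using r by (intro nn_integral_exp_D) auto
    finally show ?thesis .
  qed
  have "filterlim (\<lambda>n. r * f (real (Suc n))) at_top sequentially"
    by (rule filterlim_tendsto_pos_mult_at_top[OF tendsto_const r bernstein_fun_at_top])
  then have "(\<lambda>n. exp (- (r * f (real (Suc n))))) \<longlonglongrightarrow> 0"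
    by (intro filterlim_compose[OF exp_at_bot] filterlim_compose[OF filterlim_uminus_at_bot_at_top])
  then have "(\<lambda>n. ennreal (exp (- r * f (real (Suc n))))) \<longlonglongrightarrow> ennreal 0" by (intro tendsto_ennrealI) simp
  then have "emeasure M {\<omega>\<in>space M. D r \<omega> \<le> 0} \<le> ennreal 0"
    using le by (intro LIMSEQ_le_const) auto
  then have "AE \<omega> in M. \<omega> \<notin> {\<omega>\<in>space M. D r \<omega> \<le> 0}" by (intro AE_not_in) (auto simp: null_sets_def)
  with AE_space show ?thesis by eventually_elim auto
qed

text \<open>An exponential Markov bound: the event that D stays below k at all integers has
  probability at most exp(k - n f(1)) for every n, and f(1) > 0. It makes the default value in
  \<open>inverse_subordinator\<close> irrelevant almost surely.\<close>

lemma AE_D_unbounded: "AE \<omega> in M. \<forall>t\<ge>0. \<exists>r\<ge>0. D r \<omega> > t"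
proof -
  have "AE \<omega> in M. \<exists>n::nat. D (real n) \<omega> > real k" for k :: nat
  proof -
    have [measurable]: "D (real n) \<in> borel_measurable M" for n by (rule measurable_D) simp
    let ?B = "{\<omega>\<in>space M. \<forall>n::nat. D (real n) \<omega> \<le> real k}"
    have le: "emeasure M ?B \<le> ennreal (exp (real k) * exp (- real n * f 1))" for n :: nat
    proof -
      have "emeasure M ?B = (\<integral>\<^sup>+\<omega>. indicator ?B \<omega> \<partial>M)" by simp
      also have "\<dots> \<le> (\<integral>\<^sup>+\<omega>. ennreal (exp (real k)) * ennreal (exp (- 1 * D (real n) \<omega>)) \<partial>M)"
        by (intro nn_integral_mono) (auto simp: indicator_def ennreal_mult[symmetric] exp_add[symmetric])
      also have "\<dots> = ennreal (exp (real k)) * ennreal (exp (- real n * f 1))"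
        by (subst nn_integral_cmult, measurable) (subst nn_integral_exp_D, auto)
      finally show ?thesis by (simp add: ennreal_mult)
    qed
    have "(\<lambda>n. exp (- f 1) ^ n) \<longlonglongrightarrow> 0"
      using bernstein_fun_pos[of 1] by (intro LIMSEQ_realpow_zero) auto
    then have "(\<lambda>n. exp (- real n * f 1)) \<longlonglongrightarrow> 0"
      unfolding exp_of_nat_mult[symmetric] by (simp only: mult_minus_left mult_minus_right)
    then have "(\<lambda>n. ennreal (exp (real k) * exp (- real n * f 1))) \<longlonglongrightarrow> ennreal (exp (real k) * 0)"
      by (intro tendsto_ennrealI tendsto_mult tendsto_const)
    then have "emeasure M ?B \<le> ennreal (exp (real k) * 0)"
      using le by (intro LIMSEQ_le_const) auto
    then have "AE \<omega> in M. \<omega> \<notin> ?B" by (intro AE_not_in) (auto simp: null_sets_def)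
    with AE_space show ?thesis by eventually_elim (auto simp: not_le)
  qed
  then have "AE \<omega> in M. \<forall>k::nat. \<exists>n::nat. D (real n) \<omega> > real k" by (subst AE_all_countable) blast
  then show ?thesis
  proof (eventually_elim, intro allI impI)
    fix \<omega> and t :: real assume H: "\<forall>k::nat. \<exists>n::nat. D (real n) \<omega> > real k"
    obtain k :: nat where "t \<le> real k" using real_arch_simple by blast
    moreover obtain n :: nat where "D (real n) \<omega> > real k" using H by blast
    ultimately show "\<exists>r\<ge>0. D r \<omega> > t" by (intro exI[of _ "real n"]) auto
  qed
qed

lemma inverse_subordinator_nonneg: "0 \<le> inverse_subordinator D t \<omega>"
  unfolding inverse_subordinator_def by (auto intro!: cInf_greatest)

text \<open>Monotone paths make the set in the infimum an up-set, so only its left end point is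
  undecided. That point is excluded here and is later discarded as a Lebesgue null set of
  times.\<close>

lemma AE_inverse_subordinator_iff:
  "AE \<omega> in M. \<forall>t\<ge>0. \<forall>r\<ge>0. r \<noteq> inverse_subordinator D t \<omega> \<longrightarrow> (D r \<omega> \<le> t \<longleftrightarrow> r < inverse_subordinator D t \<omega>)"
  using AE_D_unbounded AE_space
proof (eventually_elim, intro allI impI)
  fix \<omega> t r assume un: "\<forall>t\<ge>0. \<exists>r\<ge>0. D r \<omega> > t" and w: "\<omega> \<in> space M" and t: "0 \<le> (t::real)" and r: "0 \<le> r"
    and ne: "r \<noteq> inverse_subordinator D t \<omega>"
  let ?S = "{r. r \<ge> 0 \<and> D r \<omega> > t}"
  have S: "?S \<noteq> {}" "bdd_below ?S" using un t by (auto intro!: bdd_belowI[of _ 0])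
  have E: "inverse_subordinator D t \<omega> = Inf ?S" using un t by (simp add: inverse_subordinator_def)
  show "D r \<omega> \<le> t \<longleftrightarrow> r < inverse_subordinator D t \<omega>"
  proof
    assume "D r \<omega> \<le> t"
    have "r \<le> r'" if "r' \<in> ?S" for r'
    proof (rule ccontr)
      assume "\<not> r \<le> r'"
      then have "D r' \<omega> \<le> D r \<omega>" using that by (intro D_mono[OF w]) auto
      then show False using that \<open>D r \<omega> \<le> t\<close> by auto
    qed
    then have "r \<le> Inf ?S" using S by (intro cInf_greatest) auto
    then show "r < inverse_subordinator D t \<omega>" using ne E by simp
  next
    assume "r < inverse_subordinator D t \<omega>"
    then have "r \<notin> ?S" using cInf_lower[OF _ S(2), of r] unfolding E by linarith
    then show "D r \<omega> \<le> t" using r by auto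
  qed
qed

lemma AE_inverse_subordinator_0: "AE \<omega> in M. inverse_subordinator D 0 \<omega> = 0"
proof -
  have "AE \<omega> in M. \<forall>n::nat. 0 < D (1 / real (Suc n)) \<omega>"
    by (subst AE_all_countable) (auto intro!: AE_D_pos)
  then show ?thesis
  proof eventually_elim
    fix \<omega> assume H: "\<forall>n::nat. 0 < D (1 / real (Suc n)) \<omega>"
    let ?S = "{r. r \<ge> 0 \<and> D r \<omega> > 0}"
    have bdd: "bdd_below ?S" by (auto intro!: bdd_belowI[of _ 0])
    have E: "inverse_subordinator D 0 \<omega> = Inf ?S"
      using H by (auto simp: inverse_subordinator_def intro!: exI[of _ 1] dest: spec[of _ 0])
    have "Inf ?S \<le> 1 / real (Suc n)" for n using H bdd by (intro cInf_lower) auto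
    moreover have "(\<lambda>n. 1 / real (Suc n)) \<longlonglongrightarrow> 0" by (rule LIMSEQ_Suc[OF lim_const_over_n])
    ultimately have "Inf ?S \<le> 0" by (intro LIMSEQ_le_const) auto
    then show "inverse_subordinator D 0 \<omega> = 0" using inverse_subordinator_nonneg[of 0 \<omega>] E by simp
  qed
qed

text \<open>For a probability density A this is the law of D at an independent time with density A.
  The independent time lives in the factor \<open>lborel\<close>, so no larger probability space is
  needed, and A may also be an unnormalized mixture.\<close>

definition subordinated_law :: "(real \<Rightarrow> ennreal) \<Rightarrow> real measure" where
  "subordinated_law A = distr (density (lborel \<Otimes>\<^sub>M M) (\<lambda>(r, \<omega>). A r)) borel (\<lambda>(r, \<omega>). D' r \<omega>)"

lemma sets_subordinated_law [simp, measurable_cong]: "sets (subordinated_law A) = sets borel"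
  by (simp add: subordinated_law_def)

lemma nn_integral_subordinated_law:
  assumes [measurable]: "A \<in> borel_measurable borel" "g \<in> borel_measurable borel"
  shows "(\<integral>\<^sup>+y. g y \<partial>subordinated_law A) = (\<integral>\<^sup>+r. A r * (\<integral>\<^sup>+\<omega>. g (D' r \<omega>) \<partial>M) \<partial>lborel)"
proof -
  have "(\<integral>\<^sup>+y. g y \<partial>subordinated_law A) = (\<integral>\<^sup>+(r, \<omega>). A r * g (D' r \<omega>) \<partial>(lborel \<Otimes>\<^sub>M M))"
    unfolding subordinated_law_def
    by (subst nn_integral_distr, measurable) (subst nn_integral_density, auto simp: case_prod_beta' intro!: nn_integral_cong)
  also have "\<dots> = (\<integral>\<^sup>+r. \<integral>\<^sup>+\<omega>. A r * g (D' r \<omega>) \<partial>M \<partial>lborel)"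
    using nn_integral_fst[of "\<lambda>(r, \<omega>). A r * g (D' r \<omega>)" lborel] by (simp add: case_prod_beta')
  also have "\<dots> = (\<integral>\<^sup>+r. A r * (\<integral>\<^sup>+\<omega>. g (D' r \<omega>) \<partial>M) \<partial>lborel)"
    by (intro nn_integral_cong nn_integral_cmult) measurable
  finally show ?thesis .
qed

end

section \<open>Subordinators at Erlang times\<close>

lemma nn_integral_erlang_density_UNIV:
  "0 < l \<Longrightarrow> (\<integral>\<^sup>+r. ennreal (erlang_density n l r) \<partial>lborel) = 1"
  using nn_integral_erlang_ith_moment[of l n 0] by simp

lemma nn_integral_exp_atLeast:
  assumes s: "s > 0"
  shows "(\<integral>\<^sup>+t. ennreal (exp (- s * t)) * indicator {y..} t \<partial>lborel) = ennreal (exp (- s * y) / s)"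
proof -
  have "(\<integral>\<^sup>+t. ennreal (exp (- s * t)) * indicator {y..} t \<partial>lborel) = ennreal (0 - (- exp (- s * y) / s))"
  proof (rule nn_integral_FTC_atLeast)
    show "((\<lambda>t. - exp (- s * t) / s) \<longlongrightarrow> 0) at_top"
    proof -
      have "filterlim (\<lambda>t. s * t) at_top at_top"
        by (rule filterlim_tendsto_pos_mult_at_top[OF tendsto_const s filterlim_ident])
      then have "((\<lambda>t. exp (- (s * t))) \<longlongrightarrow> 0) at_top"
        by (intro filterlim_compose[OF exp_at_bot] filterlim_compose[OF filterlim_uminus_at_bot_at_top])
      then have "((\<lambda>t. - exp (- (s * t)) / s) \<longlongrightarrow> - 0 / s) at_top"
        using s by (intro tendsto_divide tendsto_minus tendsto_const) auto
      then show ?thesis by simp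
    qed
  qed (use s in \<open>auto intro!: derivative_eq_intros\<close>)
  then show ?thesis by simp
qed

locale inverse_time_setting = subordinator_setting M \<nu> b D
  for M :: "'a measure" and \<nu> :: "real measure" and b :: real and D :: "real \<Rightarrow> 'a \<Rightarrow> real" +
  fixes lam :: real
  assumes lam: "lam > 0"
    and measurable_E: "\<And>t. t \<ge> 0 \<Longrightarrow> inverse_subordinator D t \<in> borel_measurable M"
begin

abbreviation E :: "real \<Rightarrow> 'a \<Rightarrow> real" where "E \<equiv> inverse_subordinator D"

definition poisson_weight :: "nat \<Rightarrow> real \<Rightarrow> real" where
  "poisson_weight n e = (lam * e) ^ n * exp (- lam * e) / fact n"

lemma poisson_weight_nonneg: "0 \<le> e \<Longrightarrow> 0 \<le> poisson_weight n e"
  using lam by (simp add: poisson_weight_def)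

lemma erlang_CDF_poisson_weight: "0 \<le> e \<Longrightarrow> erlang_CDF n lam e = 1 - (\<Sum>k\<le>n. poisson_weight k e)"
  by (simp add: erlang_CDF_def poisson_weight_def)

lemma poisson_weight_le_1:
  assumes "0 \<le> e" shows "poisson_weight n e \<le> 1"
proof -
  have "poisson_weight n e \<le> (\<Sum>k\<le>n. poisson_weight k e)"
    using poisson_weight_nonneg[OF assms] by (intro member_le_sum) auto
  also have "\<dots> \<le> 1"
    using erlang_CDF_nonneg[OF lam, of n e] erlang_CDF_poisson_weight[OF assms, of n] by simp
  finally show ?thesis .
qed

lemma measurable_poisson_weight [measurable]: "poisson_weight n \<in> borel_measurable borel"
  unfolding poisson_weight_def[abs_def] by measurable

text \<open>Defined from E alone, so that the analysis in t can proceed without N. Its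
  identification with the probability of N(E(t)) = n is \<open>prob_NE\<close>.\<close>

definition q :: "nat \<Rightarrow> real \<Rightarrow> real" where "q n t = expectation (\<lambda>\<omega>. poisson_weight n (E t \<omega>))"

lemma integrable_poisson_weight:
  assumes "t \<ge> 0" shows "integrable M (\<lambda>\<omega>. poisson_weight n (E t \<omega>))"
  using measurable_E[OF assms] poisson_weight_nonneg poisson_weight_le_1 inverse_subordinator_nonneg
  by (intro integrable_const_bound[where B=1]) auto

lemma q_nonneg: "0 \<le> q n t"
  unfolding q_def by (intro integral_nonneg_AE) (auto intro!: poisson_weight_nonneg inverse_subordinator_nonneg)

definition \<rho> :: "nat \<Rightarrow> real measure" where "\<rho> n = subordinated_law (\<lambda>r. ennreal (erlang_density n lam r))"

lemma sets_rho [simp, measurable_cong]: "sets (\<rho> n) = sets borel" by (simp add: \<rho>_def)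

lemma space_rho [simp]: "space (\<rho> n) = UNIV" using sets_eq_imp_space_eq[OF sets_rho] by simp

lemma nn_integral_rho:
  "g \<in> borel_measurable borel \<Longrightarrow>
    (\<integral>\<^sup>+y. g y \<partial>\<rho> n) = (\<integral>\<^sup>+r. ennreal (erlang_density n lam r) * (\<integral>\<^sup>+\<omega>. g (D' r \<omega>) \<partial>M) \<partial>lborel)"
  unfolding \<rho>_def by (rule nn_integral_subordinated_law) auto

lemma prob_space_rho: "prob_space (\<rho> n)"
proof (rule prob_spaceI)
  have "emeasure (\<rho> n) (space (\<rho> n)) = (\<integral>\<^sup>+y. 1 \<partial>\<rho> n)" by simp
  also have "\<dots> = (\<integral>\<^sup>+r. ennreal (erlang_density n lam r) \<partial>lborel)"
    by (subst nn_integral_rho) (auto simp: emeasure_space_1)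
  also have "\<dots> = 1" by (rule nn_integral_erlang_density_UNIV[OF lam])
  finally show "emeasure (\<rho> n) (space (\<rho> n)) = 1" .
qed

lemma emeasure_rho_nonpos: "emeasure (\<rho> n) {..0} = 0"
proof -
  have "emeasure (\<rho> n) {..0} = (\<integral>\<^sup>+y. indicator {..0} y \<partial>\<rho> n)" by simp
  also have "\<dots> = (\<integral>\<^sup>+r. ennreal (erlang_density n lam r) * (\<integral>\<^sup>+\<omega>. indicator {..0} (D' r \<omega>) \<partial>M) \<partial>lborel)"
    by (rule nn_integral_rho) simp
  also have "\<dots> = (\<integral>\<^sup>+r. 0 \<partial>(lborel :: real measure))"
  proof (rule nn_integral_cong_AE, use AE_lborel_singleton[of 0] in eventually_elim)
    fix r :: real assume "r \<noteq> 0"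
    then consider "r < 0" | "r > 0" by linarith
    then show "ennreal (erlang_density n lam r) * (\<integral>\<^sup>+\<omega>. indicator {..0} (D' r \<omega>) \<partial>M) = 0"
    proof cases
      case 1 then show ?thesis by (simp add: erlang_density_def)
    next
      case 2
      have "(\<integral>\<^sup>+\<omega>. indicator {..0} (D' r \<omega>) \<partial>M) = (\<integral>\<^sup>+\<omega>. 0 \<partial>M)"
        by (rule nn_integral_cong_AE, use AE_D_pos[OF 2] in eventually_elim) (use 2 in \<open>simp add: D'_def\<close>)
      then show ?thesis by simp
    qed
  qed
  finally show ?thesis by simp
qed

definition \<theta> :: "real \<Rightarrow> real" where "\<theta> s = lam / (lam + f s)"

lemma theta_bounds: "s > 0 \<Longrightarrow> 0 < \<theta> s" "s > 0 \<Longrightarrow> \<theta> s \<le> 1"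
  using lam bernstein_fun_nonneg[of s] by (auto simp: \<theta>_def add_pos_nonneg divide_le_eq)

text \<open>Exponential tilting: the Erlang density of rate lam times exp(-r f(s)) is
  \<theta>(s)^(n+1) times the Erlang density of rate lam + f(s), which integrates to 1.\<close>

lemma nn_integral_exp_rho:
  assumes s: "s > 0"
  shows "(\<integral>\<^sup>+y. ennreal (exp (- s * y)) \<partial>\<rho> n) = ennreal (\<theta> s ^ Suc n)"
proof -
  have pos: "0 < lam + f s" using lam bernstein_fun_nonneg[OF s] by simp
  have "(\<integral>\<^sup>+y. ennreal (exp (- s * y)) \<partial>\<rho> n) = (\<integral>\<^sup>+r. ennreal (erlang_density n lam r) * (\<integral>\<^sup>+\<omega>. ennreal (exp (- s * D' r \<omega>)) \<partial>M) \<partial>lborel)"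
    by (rule nn_integral_rho) simp
  also have "\<dots> = (\<integral>\<^sup>+r. ennreal (\<theta> s ^ Suc n) * ennreal (erlang_density n (lam + f s) r) \<partial>lborel)"
  proof (rule nn_integral_cong)
    fix r :: real
    show "ennreal (erlang_density n lam r) * (\<integral>\<^sup>+\<omega>. ennreal (exp (- s * D' r \<omega>)) \<partial>M) = ennreal (\<theta> s ^ Suc n) * ennreal (erlang_density n (lam + f s) r)"
    proof (cases "r < 0")
      case True then show ?thesis by (simp add: erlang_density_def)
    next
      case False
      then have r: "0 \<le> r" by simp
      have D: "D' r = D r" using r by (simp add: D'_def fun_eq_iff)
      have "erlang_density n lam r * exp (- r * f s) = \<theta> s ^ Suc n * erlang_density n (lam + f s) r"
      proof -
        have "exp (- (lam + f s) * r) = exp (- lam * r) * exp (- r * f s)"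
          by (simp add: exp_add[symmetric] algebra_simps)
        moreover have "\<theta> s ^ Suc n * (lam + f s) ^ Suc n = lam ^ Suc n"
          using pos unfolding power_mult_distrib[symmetric] \<theta>_def by simp
        ultimately show ?thesis using r unfolding erlang_density_def
          by (simp add: field_simps del: power_Suc)
      qed
      then show ?thesis unfolding D nn_integral_exp_D[OF s r] using lam theta_bounds(1)[OF s]
        by (simp add: ennreal_mult[symmetric] ennreal_mult'[symmetric] del: power_Suc)
    qed
  qed
  also have "\<dots> = ennreal (\<theta> s ^ Suc n) * (\<integral>\<^sup>+r. ennreal (erlang_density n (lam + f s) r) \<partial>lborel)"
    by (rule nn_integral_cmult) measurable
  finally show ?thesis unfolding nn_integral_erlang_density_UNIV[OF pos] by simp
qed

text \<open>Here \<open>\<rho> n\<close> is the law of \<open>D\<close> at the \<open>(n+1)\<close>-st jump time of the Poisson process, and that jump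
  has happened by the random time \<open>E t\<close> if and only if \<open>D\<close> at the jump time is at most \<open>t\<close>.\<close>

lemma measure_rho_atMost:
  assumes t: "t \<ge> 0"
  shows "measure (\<rho> n) {..t} = 1 - (\<Sum>k\<le>n. q k t)"
proof -
  interpret lM: pair_sigma_finite lborel M ..
  have [measurable]: "E t \<in> borel_measurable M" by (rule measurable_E[OF t])
  have "emeasure (\<rho> n) {..t} = (\<integral>\<^sup>+y. indicator {..t} y \<partial>\<rho> n)" by simp
  also have "\<dots> = (\<integral>\<^sup>+r. ennreal (erlang_density n lam r) * (\<integral>\<^sup>+\<omega>. indicator {..t} (D' r \<omega>) \<partial>M) \<partial>lborel)"
    by (rule nn_integral_rho) simp
  also have "\<dots> = (\<integral>\<^sup>+r. (\<integral>\<^sup>+\<omega>. ennreal (erlang_density n lam r) * indicator {..t} (D' r \<omega>) \<partial>M) \<partial>lborel)"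
    by (intro nn_integral_cong nn_integral_cmult[symmetric]) measurable
  also have "\<dots> = (\<integral>\<^sup>+\<omega>. (\<integral>\<^sup>+r. ennreal (erlang_density n lam r) * indicator {..t} (D' r \<omega>) \<partial>lborel) \<partial>M)"
    by (intro lM.Fubini'[symmetric]) measurable
  also have "\<dots> = (\<integral>\<^sup>+\<omega>. ennreal (erlang_CDF n lam (E t \<omega>)) \<partial>M)"
  proof (rule nn_integral_cong_AE, use AE_inverse_subordinator_iff in eventually_elim)
    fix \<omega> assume H: "\<forall>t\<ge>0. \<forall>r\<ge>0. r \<noteq> E t \<omega> \<longrightarrow> (D r \<omega> \<le> t \<longleftrightarrow> r < E t \<omega>)"
    have "(\<integral>\<^sup>+r. ennreal (erlang_density n lam r) * indicator {..t} (D' r \<omega>) \<partial>lborel) =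
      (\<integral>\<^sup>+r. ennreal (erlang_density n lam r) * indicator {..E t \<omega>} r \<partial>lborel)"
    proof (rule nn_integral_cong_AE, use AE_lborel_singleton[of "E t \<omega>"] in eventually_elim)
      fix r assume r: "r \<noteq> E t \<omega>"
      show "ennreal (erlang_density n lam r) * indicator {..t} (D' r \<omega>) = ennreal (erlang_density n lam r) * indicator {..E t \<omega>} r"
      proof (cases "r < 0")
        case True then show ?thesis by (simp add: erlang_density_def)
      next
        case False
        then have "D' r \<omega> \<le> t \<longleftrightarrow> r \<le> E t \<omega>" using H t r by (auto simp: D'_def)
        then show ?thesis by (simp add: indicator_def)
      qed
    qed
    also have "\<dots> = ennreal (erlang_CDF n lam (E t \<omega>))" by (rule nn_integral_erlang_density[OF lam])
    finally show "(\<integral>\<^sup>+r. ennreal (erlang_density n lam r) * indicator {..t} (D' r \<omega>) \<partial>lborel) = ennreal (erlang_CDF n lam (E t \<omega>))" .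
  qed
  also have "\<dots> = ennreal (expectation (\<lambda>\<omega>. 1 - (\<Sum>k\<le>n. poisson_weight k (E t \<omega>))))"
    unfolding erlang_CDF_poisson_weight[OF inverse_subordinator_nonneg, symmetric]
  proof (rule nn_integral_eq_integral)
    show "integrable M (\<lambda>\<omega>. erlang_CDF n lam (E t \<omega>))"
      unfolding erlang_CDF_poisson_weight[OF inverse_subordinator_nonneg]
      using integrable_poisson_weight[OF t] by (intro Bochner_Integration.integrable_diff Bochner_Integration.integrable_sum) auto
  qed (use lam in auto)
  also have "expectation (\<lambda>\<omega>. 1 - (\<Sum>k\<le>n. poisson_weight k (E t \<omega>))) = 1 - (\<Sum>k\<le>n. q k t)"
    using integrable_poisson_weight[OF t] unfolding q_def
    by (subst Bochner_Integration.integral_diff) (auto simp: prob_space Bochner_Integration.integral_sum)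
  finally have eq: "emeasure (\<rho> n) {..t} = ennreal (1 - (\<Sum>k\<le>n. q k t))" .
  \<comment> \<open>\<open>ennreal\<close> sends negative numbers to 0, so the sign must be settled
    before returning to \<open>measure\<close>.\<close>
  have "0 \<le> 1 - (\<Sum>k\<le>n. q k t)"
  proof -
    have "0 \<le> expectation (\<lambda>\<omega>. erlang_CDF n lam (E t \<omega>))" using lam by (intro integral_nonneg_AE) auto
    also have "\<dots> = 1 - (\<Sum>k\<le>n. q k t)"
      unfolding erlang_CDF_poisson_weight[OF inverse_subordinator_nonneg]
      using integrable_poisson_weight[OF t] unfolding q_def
      by (subst Bochner_Integration.integral_diff) (auto simp: prob_space Bochner_Integration.integral_sum)
    finally show ?thesis .
  qed
  then show ?thesis using eq by (simp add: measure_def)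
qed

definition R :: "nat \<Rightarrow> real \<Rightarrow> real" where
  "R n t = (case n of 0 \<Rightarrow> indicator {0..} t | Suc m \<Rightarrow> measure (\<rho> m) {..t})"

text \<open>Agrees with \<open>q\<close> for t \<ge> 0 but vanishes for t < 0, where
  \<open>q\<close> is not controlled. The Laplace argument needs measures without mass on the
  negative half-line.\<close>

definition Q :: "nat \<Rightarrow> real \<Rightarrow> real" where "Q n t = R n t - R (Suc n) t"

lemma R_simps: "R 0 t = indicator {0..} t" "R (Suc m) t = measure (\<rho> m) {..t}"
  by (simp_all add: R_def)

lemma R_neg: "t < 0 \<Longrightarrow> R n t = 0"
proof (cases n)
  case (Suc m)
  assume "t < 0"
  then have "emeasure (\<rho> m) {..t} \<le> emeasure (\<rho> m) {..0}" by (intro emeasure_mono) auto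
  then show ?thesis using emeasure_rho_nonpos by (simp add: Suc R_simps measure_def)
qed (simp add: R_simps)

lemma R_nonneg: "0 \<le> R n t" and R_le_1: "R n t \<le> 1"
  using prob_space.prob_le_1[OF prob_space_rho] by (cases n; simp add: R_simps)+

lemma Q_eq_q: "t \<ge> 0 \<Longrightarrow> Q n t = q n t"
  by (cases n) (simp_all add: Q_def R_simps measure_rho_atMost)

lemma Q_neg: "t < 0 \<Longrightarrow> Q n t = 0" by (simp add: Q_def R_neg)

lemma Q_nonneg: "0 \<le> Q n t"
  by (cases "t \<ge> 0") (simp_all add: Q_eq_q q_nonneg Q_neg)

lemma Q_le_1: "Q n t \<le> 1" using R_nonneg[of "Suc n" t] R_le_1[of n t] by (simp add: Q_def)

lemma measurable_R [measurable]: "R n \<in> borel_measurable borel"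
proof (cases n)
  case 0
  then show ?thesis by (simp add: R_simps[abs_def] cong: measurable_cong)
next
  case (Suc m)
  interpret r: prob_space "\<rho> m" by (rule prob_space_rho)
  have "mono (R n)" unfolding Suc mono_def R_simps by (auto intro!: r.finite_measure_mono)
  then show ?thesis by (rule borel_measurable_mono)
qed

lemma measurable_Q [measurable]: "Q n \<in> borel_measurable borel"
  unfolding Q_def[abs_def] by measurable

lemma nn_integral_exp_R:
  assumes s: "s > 0"
  shows "(\<integral>\<^sup>+t. ennreal (R n t) * ennreal (exp (- s * t)) \<partial>lborel) = ennreal (\<theta> s ^ n / s)"
proof (cases n)
  case 0
  have "(\<integral>\<^sup>+t. ennreal (R n t) * ennreal (exp (- s * t)) \<partial>lborel) = (\<integral>\<^sup>+t. ennreal (exp (- s * t)) * indicator {0..} t \<partial>lborel)"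
    by (intro nn_integral_cong) (simp add: 0 R_simps indicator_def)
  then show ?thesis using nn_integral_exp_atLeast[OF s, of 0] by (simp add: 0)
next
  case (Suc m)
  interpret r: prob_space "\<rho> m" by (rule prob_space_rho)
  interpret pair_sigma_finite lborel "\<rho> m" ..
  have "(\<integral>\<^sup>+t. ennreal (R n t) * ennreal (exp (- s * t)) \<partial>lborel) = (\<integral>\<^sup>+t. (\<integral>\<^sup>+y. (if y \<le> t then 1 else 0) * ennreal (exp (- s * t)) \<partial>\<rho> m) \<partial>lborel)"
  proof (rule nn_integral_cong)
    fix t
    have "(\<integral>\<^sup>+y. (if y \<le> t then 1 else 0) \<partial>\<rho> m) = (\<integral>\<^sup>+y. indicator {..t} y \<partial>\<rho> m)"
      by (intro nn_integral_cong) (simp add: indicator_def)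
    also have "\<dots> = ennreal (R n t)" by (simp add: Suc R_simps r.emeasure_eq_measure)
    finally show "ennreal (R n t) * ennreal (exp (- s * t)) = (\<integral>\<^sup>+y. (if y \<le> t then 1 else 0) * ennreal (exp (- s * t)) \<partial>\<rho> m)"
      by (subst nn_integral_multc) auto
  qed
  also have "\<dots> = (\<integral>\<^sup>+y. (\<integral>\<^sup>+t. (if y \<le> t then 1 else 0) * ennreal (exp (- s * t)) \<partial>lborel) \<partial>\<rho> m)"
    by (intro Fubini'[symmetric]) measurable
  also have "\<dots> = (\<integral>\<^sup>+y. ennreal (1 / s) * ennreal (exp (- s * y)) \<partial>\<rho> m)"
  proof (rule nn_integral_cong)
    fix y
    have "(\<integral>\<^sup>+t. (if y \<le> t then 1 else 0) * ennreal (exp (- s * t)) \<partial>lborel) = (\<integral>\<^sup>+t. ennreal (exp (- s * t)) * indicator {y..} t \<partial>lborel)"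
      by (intro nn_integral_cong) (simp add: indicator_def)
    then show "(\<integral>\<^sup>+t. (if y \<le> t then 1 else 0) * ennreal (exp (- s * t)) \<partial>lborel) = ennreal (1 / s) * ennreal (exp (- s * y))"
      using nn_integral_exp_atLeast[OF s, of y] s by (simp add: ennreal_mult[symmetric])
  qed
  also have "\<dots> = ennreal (1 / s) * ennreal (\<theta> s ^ Suc m)"
    by (subst nn_integral_cmult) (simp_all only: nn_integral_exp_rho[OF s], simp)
  finally show ?thesis using s theta_bounds(1)[OF s] by (simp add: Suc ennreal_mult[symmetric])
qed

text \<open>The transforms of \<open>R\<close> give (\<theta>^n - \<theta>^(n+1)) / s for
  \<open>Q n\<close>, and lam (1 - \<theta>) = f \<theta> by the choice of \<theta>. The difference
  is first written as a sum because the integrals take values in \<open>ennreal\<close>.\<close>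

lemma nn_integral_exp_Q:
  assumes s: "s > 0"
  shows "(\<integral>\<^sup>+t. ennreal (lam * Q n t) * ennreal (exp (- s * t)) \<partial>lborel) = ennreal (f s / s * \<theta> s ^ Suc n)"
proof -
  let ?L = "\<integral>\<^sup>+t. ennreal (Q n t) * ennreal (exp (- s * t)) \<partial>lborel"
  have "?L + ennreal (\<theta> s ^ Suc n / s) = (\<integral>\<^sup>+t. ennreal (Q n t) * ennreal (exp (- s * t)) + ennreal (R (Suc n) t) * ennreal (exp (- s * t)) \<partial>lborel)"
    unfolding nn_integral_exp_R[OF s, symmetric] by (intro nn_integral_add[symmetric]) auto
  also have "\<dots> = (\<integral>\<^sup>+t. ennreal (R n t) * ennreal (exp (- s * t)) \<partial>lborel)"
  proof (rule nn_integral_cong)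
    fix t
    have "ennreal (Q n t) + ennreal (R (Suc n) t) = ennreal (R n t)"
      using Q_nonneg[of n t] R_nonneg[of "Suc n" t] by (simp add: Q_def ennreal_plus[symmetric] del: ennreal_plus)
    then show "ennreal (Q n t) * ennreal (exp (- s * t)) + ennreal (R (Suc n) t) * ennreal (exp (- s * t)) = ennreal (R n t) * ennreal (exp (- s * t))"
      by (simp only: distrib_right[symmetric])
  qed
  also have "\<dots> = ennreal (\<theta> s ^ n / s)" by (rule nn_integral_exp_R[OF s])
  finally have sum: "?L + ennreal (\<theta> s ^ Suc n / s) = ennreal (\<theta> s ^ n / s)" .
  have L: "?L = ennreal (\<theta> s ^ n / s - \<theta> s ^ Suc n / s)"
  proof (cases ?L)
    case (real x)
    have nn: "0 \<le> \<theta> s ^ Suc n / s" "0 \<le> \<theta> s ^ n / s" using s theta_bounds(1)[OF s] by (auto simp: less_imp_le)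
    have "ennreal (x + \<theta> s ^ Suc n / s) = ennreal (\<theta> s ^ n / s)"
      using sum real nn by (simp add: ennreal_plus del: power_Suc)
    then have "x + \<theta> s ^ Suc n / s = \<theta> s ^ n / s" using real nn by (subst (asm) ennreal_inj) auto
    then show ?thesis using real by (simp add: algebra_simps)
  next
    case top then show ?thesis using sum by simp
  qed
  have "(\<integral>\<^sup>+t. ennreal (lam * Q n t) * ennreal (exp (- s * t)) \<partial>lborel) = ennreal lam * ?L"
    using lam Q_nonneg by (subst nn_integral_cmult[symmetric]) (auto simp: ennreal_mult mult.assoc intro!: nn_integral_cong)
  also have "\<dots> = ennreal (lam * (\<theta> s ^ n / s - \<theta> s ^ Suc n / s))"
    unfolding L using lam by (simp add: ennreal_mult'[symmetric])
  also have "lam * (\<theta> s ^ n / s - \<theta> s ^ Suc n / s) = f s / s * \<theta> s ^ Suc n"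
  proof -
    have "lam * (1 - \<theta> s) = f s * \<theta> s"
      using lam bernstein_fun_nonneg[OF s] by (simp add: \<theta>_def field_simps)
    then have "\<theta> s ^ n * (lam * (1 - \<theta> s)) / s = \<theta> s ^ n * (f s * \<theta> s) / s" by simp
    moreover have "lam * (\<theta> s ^ n / s - \<theta> s ^ Suc n / s) = \<theta> s ^ n * (lam * (1 - \<theta> s)) / s"
      unfolding diff_divide_distrib[symmetric] by (simp add: algebra_simps)
    ultimately show ?thesis by simp
  qed
  finally show ?thesis .
qed

end

section \<open>Convolution of the Levy kernel with the laws at Erlang times and with their
  mixtures\<close>

lemma suminf_ennreal_bounded:
  assumes c: "summable c" "\<And>n. 0 \<le> c n" and x: "\<And>n. 0 \<le> x n" "\<And>n. x n \<le> (1::real)"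
  shows "(\<Sum>n. ennreal (c n) * ennreal (x n)) = ennreal (\<Sum>n. c n * x n)" "summable (\<lambda>n. c n * x n)"
proof -
  show s: "summable (\<lambda>n. c n * x n)"
    by (rule summable_comparison_test'[OF c(1), of 0]) (use c x in \<open>auto simp: abs_mult mult_left_le\<close>)
  have "(\<Sum>n. ennreal (c n) * ennreal (x n)) = (\<Sum>n. ennreal (c n * x n))"
    using c x by (simp add: ennreal_mult)
  also have "\<dots> = ennreal (\<Sum>n. c n * x n)" using s c x by (intro suminf_ennreal2) auto
  finally show "(\<Sum>n. ennreal (c n) * ennreal (x n)) = ennreal (\<Sum>n. c n * x n)" .
qed

context inverse_time_setting
begin

text \<open>A single density on the line representing the kernel \<open>b \<delta>\<^sub>0 + \<kappa>(s) ds\<close>: the map \<open>max 0\<close>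
  collapses the mass \<open>b\<close> on \<open>[-1, 0)\<close> to an atom at \<open>0\<close>.\<close>

definition kernel_density :: "real \<Rightarrow> ennreal" where
  "kernel_density s = ennreal b * indicator {-1..<0} s + ennreal (levy_kernel \<nu> s)"

lemma measurable_kernel_density [measurable]: "kernel_density \<in> borel_measurable borel"
  unfolding kernel_density_def[abs_def] by measurable

lemma nn_integral_kernel_density:
  assumes [measurable]: "h \<in> borel_measurable borel"
  shows "(\<integral>\<^sup>+s. kernel_density s * h (max s 0) \<partial>lborel) = ennreal b * h 0 + (\<integral>\<^sup>+s. ennreal (levy_kernel \<nu> s) * h s \<partial>lborel)"
proof -
  have "(\<integral>\<^sup>+s. kernel_density s * h (max s 0) \<partial>lborel) =
    (\<integral>\<^sup>+s. (ennreal b * h 0) * indicator {-1..<0} s + ennreal (levy_kernel \<nu> s) * h s \<partial>lborel)"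
  proof (rule nn_integral_cong)
    fix s :: real
    show "kernel_density s * h (max s 0) = (ennreal b * h 0) * indicator {-1..<0} s + ennreal (levy_kernel \<nu> s) * h s"
      by (cases "s \<le> 0") (auto simp: kernel_density_def levy_kernel_zero indicator_def)
  qed
  also have "\<dots> = (\<integral>\<^sup>+s. (ennreal b * h 0) * indicator {-1..<0::real} s \<partial>lborel) + (\<integral>\<^sup>+s. ennreal (levy_kernel \<nu> s) * h s \<partial>lborel)"
    by (intro nn_integral_add) auto
  also have "(\<integral>\<^sup>+s. (ennreal b * h 0) * indicator {-1..<0::real} s \<partial>lborel) = ennreal b * h 0"
    by (simp add: nn_integral_cmult_indicator)
  finally show ?thesis .
qed

text \<open>Both sides integrate g against measures with Laplace transform (f(s)/s)
  \<theta>(s)^(n+1). These measures may have infinite total mass, which is why the uniqueness lemma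
  asks only that exp (- t) be integrable. The tested form avoids speaking of a density of the
  convolution.\<close>

lemma kernel_convolution_rho:
  assumes g [measurable]: "g \<in> borel_measurable borel"
  shows "ennreal b * (\<integral>\<^sup>+y. g y \<partial>\<rho> n) + (\<integral>\<^sup>+y. (\<integral>\<^sup>+s. ennreal (levy_kernel \<nu> s) * g (s + y) \<partial>lborel) \<partial>\<rho> n) =
    (\<integral>\<^sup>+t. ennreal (lam * Q n t) * g t \<partial>lborel)"
proof -
  interpret r: prob_space "\<rho> n" by (rule prob_space_rho)
  interpret P: pair_sigma_finite lborel "\<rho> n" ..
  \<comment> \<open>The image of a product measure under addition is the convolution of the kernel
    with \<rho> n, so its transform factorizes.\<close>
  define \<alpha> where "\<alpha> = distr (density (lborel \<Otimes>\<^sub>M \<rho> n) (\<lambda>(s, y). kernel_density s)) borel (\<lambda>(s, y). max s 0 + y)"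
  define \<beta> where "\<beta> = density lborel (\<lambda>t. ennreal (lam * Q n t))"
  have int_\<alpha>: "(\<integral>\<^sup>+x. g x \<partial>\<alpha>) = ennreal b * (\<integral>\<^sup>+y. g y \<partial>\<rho> n) + (\<integral>\<^sup>+s. ennreal (levy_kernel \<nu> s) * (\<integral>\<^sup>+y. g (s + y) \<partial>\<rho> n) \<partial>lborel)"
    if [measurable]: "g \<in> borel_measurable borel" for g
  proof -
    have "(\<integral>\<^sup>+x. g x \<partial>\<alpha>) = (\<integral>\<^sup>+(s, y). kernel_density s * g (max s 0 + y) \<partial>(lborel \<Otimes>\<^sub>M \<rho> n))"
      unfolding \<alpha>_def
      by (subst nn_integral_distr, measurable) (subst nn_integral_density, auto simp: case_prod_beta' intro!: nn_integral_cong)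
    also have "\<dots> = (\<integral>\<^sup>+s. (\<integral>\<^sup>+y. kernel_density s * g (max s 0 + y) \<partial>\<rho> n) \<partial>lborel)"
      using r.nn_integral_fst[of "\<lambda>(s, y). kernel_density s * g (max s 0 + y)" lborel] by (simp add: case_prod_beta')
    also have "\<dots> = (\<integral>\<^sup>+s. kernel_density s * (\<integral>\<^sup>+y. g (max s 0 + y) \<partial>\<rho> n) \<partial>lborel)"
      by (intro nn_integral_cong nn_integral_cmult) measurable
    also have "\<dots> = ennreal b * (\<integral>\<^sup>+y. g (0 + y) \<partial>\<rho> n) + (\<integral>\<^sup>+s. ennreal (levy_kernel \<nu> s) * (\<integral>\<^sup>+y. g (s + y) \<partial>\<rho> n) \<partial>lborel)"
      by (rule nn_integral_kernel_density) measurable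
    finally show ?thesis by simp
  qed
  have int_\<beta>: "(\<integral>\<^sup>+x. g x \<partial>\<beta>) = (\<integral>\<^sup>+t. ennreal (lam * Q n t) * g t \<partial>lborel)"
    if "g \<in> borel_measurable borel" for g
    unfolding \<beta>_def using that by (intro nn_integral_density) auto
  have L\<beta>: "(\<integral>\<^sup>+x. ennreal (exp (- s * x)) \<partial>\<beta>) = ennreal (f s / s * \<theta> s ^ Suc n)" if "s > 0" for s
    by (subst int_\<beta>) (auto simp: nn_integral_exp_Q[OF that, simplified])
  have L\<alpha>: "(\<integral>\<^sup>+x. ennreal (exp (- s * x)) \<partial>\<alpha>) = ennreal (f s / s * \<theta> s ^ Suc n)" if s: "s > 0" for s
  proof -
    let ?l = "ennreal (\<theta> s ^ Suc n)"
    have "(\<integral>\<^sup>+y. ennreal (exp (- s * (x + y))) \<partial>\<rho> n) = ennreal (exp (- s * x)) * ?l" for x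
    proof -
      have "(\<integral>\<^sup>+y. ennreal (exp (- s * (x + y))) \<partial>\<rho> n) = (\<integral>\<^sup>+y. ennreal (exp (- s * x)) * ennreal (exp (- s * y)) \<partial>\<rho> n)"
        by (intro nn_integral_cong) (simp add: ennreal_mult'[symmetric] exp_add[symmetric] algebra_simps)
      also have "\<dots> = ennreal (exp (- s * x)) * ?l"
        by (subst nn_integral_cmult) (simp_all only: nn_integral_exp_rho[OF s], simp)
      finally show ?thesis .
    qed
    then have "(\<integral>\<^sup>+x. ennreal (exp (- s * x)) \<partial>\<alpha>) = ennreal b * ?l + (\<integral>\<^sup>+x. ennreal (levy_kernel \<nu> x) * (ennreal (exp (- s * x)) * ?l) \<partial>lborel)"
      by (subst int_\<alpha>) (simp_all only: nn_integral_exp_rho[OF s], simp)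
    also have "(\<integral>\<^sup>+x. ennreal (levy_kernel \<nu> x) * (ennreal (exp (- s * x)) * ?l) \<partial>lborel) = (\<integral>\<^sup>+x. ennreal (levy_kernel \<nu> x) * ennreal (exp (- s * x)) \<partial>lborel) * ?l"
      by (subst nn_integral_multc[symmetric]) (auto simp: mult.assoc)
    also have "ennreal b * ?l + \<dots> = ennreal (f s / s) * ?l"
      unfolding nn_integral_levy_kernel_exp[OF s, symmetric] by (simp only: distrib_right)
    also have "\<dots> = ennreal (f s / s * \<theta> s ^ Suc n)"
      using theta_bounds(1)[OF s] by (intro ennreal_mult''[symmetric]) simp
    finally show ?thesis .
  qed
  have "\<alpha> = \<beta>"
  proof (rule Laplace_transform_unique)
    show "sets \<alpha> = sets borel" "sets \<beta> = sets borel" by (simp_all add: \<alpha>_def \<beta>_def)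
    then have "emeasure \<alpha> {..<0} = (\<integral>\<^sup>+x. indicator {..<0} x \<partial>\<alpha>)" by simp
    also have "\<dots> = ennreal b * (\<integral>\<^sup>+y. indicator {..<0} y \<partial>\<rho> n) + (\<integral>\<^sup>+s. ennreal (levy_kernel \<nu> s) * (\<integral>\<^sup>+y. indicator {..<0} (s + y) \<partial>\<rho> n) \<partial>lborel)"
      by (rule int_\<alpha>) simp
    also have "\<dots> = 0"
    proof -
      have null: "emeasure (\<rho> n) A = 0" if "A \<subseteq> {..0}" for A
        using emeasure_mono[OF that, of "\<rho> n"] emeasure_rho_nonpos[of n] by simp
      have z: "ennreal (levy_kernel \<nu> s) * (\<integral>\<^sup>+y. indicator {..<0} (s + y) \<partial>\<rho> n) = 0" for s
      proof (cases "s \<le> 0")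
        case False
        have "(\<integral>\<^sup>+y. indicator {..<0} (s + y) \<partial>\<rho> n) = (\<integral>\<^sup>+y. indicator {..<- s} y \<partial>\<rho> n)"
          by (intro nn_integral_cong) (auto simp: indicator_def)
        moreover have "{..<- s} \<subseteq> {..0}" using False by auto
        ultimately show ?thesis using null[of "{..<- s}"] by simp
      qed (simp add: levy_kernel_zero)
      have "emeasure (\<rho> n) {..<0} = 0" by (rule null) auto
      then show ?thesis unfolding z by simp
    qed
    finally show "emeasure \<alpha> {..<0} = 0" .
    have "emeasure \<beta> {..<0} = (\<integral>\<^sup>+t. ennreal (lam * Q n t) * indicator {..<0} t \<partial>lborel)"
      unfolding \<beta>_def by (subst emeasure_density) auto
    also have "\<dots> = (\<integral>\<^sup>+t. 0 \<partial>(lborel :: real measure))"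
      by (intro nn_integral_cong) (auto simp: indicator_def Q_neg)
    finally show "emeasure \<beta> {..<0} = 0" by simp
    show "(\<integral>\<^sup>+t. ennreal (exp (- real k * t)) \<partial>\<alpha>) = (\<integral>\<^sup>+t. ennreal (exp (- real k * t)) \<partial>\<beta>)" if "k \<ge> 1" for k
      using that L\<alpha>[of "real k"] L\<beta>[of "real k"] by simp
    show "(\<integral>\<^sup>+t. ennreal (exp (- t)) \<partial>\<alpha>) < \<top>" using L\<alpha>[of 1] by simp
  qed
  moreover have "(\<integral>\<^sup>+s. ennreal (levy_kernel \<nu> s) * (\<integral>\<^sup>+y. g (s + y) \<partial>\<rho> n) \<partial>lborel) =
      (\<integral>\<^sup>+y. (\<integral>\<^sup>+s. ennreal (levy_kernel \<nu> s) * g (s + y) \<partial>lborel) \<partial>\<rho> n)"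
  proof -
    have "(\<integral>\<^sup>+s. ennreal (levy_kernel \<nu> s) * (\<integral>\<^sup>+y. g (s + y) \<partial>\<rho> n) \<partial>lborel) = (\<integral>\<^sup>+s. (\<integral>\<^sup>+y. ennreal (levy_kernel \<nu> s) * g (s + y) \<partial>\<rho> n) \<partial>lborel)"
      by (intro nn_integral_cong nn_integral_cmult[symmetric]) measurable
    also have "\<dots> = (\<integral>\<^sup>+y. (\<integral>\<^sup>+s. ennreal (levy_kernel \<nu> s) * g (s + y) \<partial>lborel) \<partial>\<rho> n)"
      by (intro P.Fubini'[symmetric]) measurable
    finally show ?thesis .
  qed
  ultimately show ?thesis using int_\<alpha>[OF g] int_\<beta>[OF g] by simp
qed

text \<open>This is the sum of the measures c n times \<rho> n. Mixing the Erlang densities before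
  subordinating replaces an infinite sum of measures by an infinite sum of functions.\<close>

definition \<mu> :: "(nat \<Rightarrow> real) \<Rightarrow> real measure" where
  "\<mu> c = subordinated_law (\<lambda>r. \<Sum>n. ennreal (c n) * ennreal (erlang_density n lam r))"

lemma sets_mu [simp, measurable_cong]: "sets (\<mu> c) = sets borel" by (simp add: \<mu>_def)

lemma space_mu [simp]: "space (\<mu> c) = UNIV" using sets_eq_imp_space_eq[OF sets_mu] by simp

lemma nn_integral_mu:
  assumes [measurable]: "g \<in> borel_measurable borel"
  shows "(\<integral>\<^sup>+y. g y \<partial>\<mu> c) = (\<Sum>n. ennreal (c n) * (\<integral>\<^sup>+y. g y \<partial>\<rho> n))"
proof -
  let ?G = "\<lambda>r. \<integral>\<^sup>+\<omega>. g (D' r \<omega>) \<partial>M"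
  have "(\<integral>\<^sup>+y. g y \<partial>\<mu> c) = (\<integral>\<^sup>+r. (\<Sum>n. ennreal (c n) * ennreal (erlang_density n lam r)) * ?G r \<partial>lborel)"
    unfolding \<mu>_def by (rule nn_integral_subordinated_law) measurable
  also have "\<dots> = (\<integral>\<^sup>+r. (\<Sum>n. ennreal (c n) * (ennreal (erlang_density n lam r) * ?G r)) \<partial>lborel)"
    by (intro nn_integral_cong) (simp add: ennreal_suminf_multc[symmetric] mult.assoc)
  also have "\<dots> = (\<Sum>n. \<integral>\<^sup>+r. ennreal (c n) * (ennreal (erlang_density n lam r) * ?G r) \<partial>lborel)"
    by (intro nn_integral_suminf) measurable
  also have "\<dots> = (\<Sum>n. ennreal (c n) * (\<integral>\<^sup>+y. g y \<partial>\<rho> n))"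
    by (subst nn_integral_cmult) (auto simp: nn_integral_rho)
  finally show ?thesis .
qed

lemma emeasure_mu:
  assumes "A \<in> sets borel"
  shows "emeasure (\<mu> c) A = (\<Sum>n. ennreal (c n) * emeasure (\<rho> n) A)"
  using nn_integral_mu[of "indicator A" c] assms by simp

lemma finite_measure_mu:
  assumes c: "summable c" "\<And>n. 0 \<le> c n"
  shows "finite_measure (\<mu> c)"
proof (rule finite_measureI)
  have "emeasure (\<mu> c) UNIV = (\<Sum>n. ennreal (c n) * emeasure (\<rho> n) (space (\<rho> n)))"
    by (subst emeasure_mu) auto
  also have "\<dots> = (\<Sum>n. ennreal (c n) * ennreal 1)"
    using prob_space.emeasure_space_1[OF prob_space_rho] by simp
  also have "\<dots> = ennreal (\<Sum>n. c n * 1)" by (rule suminf_ennreal_bounded(1)[OF c]) auto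
  finally show "emeasure (\<mu> c) (space (\<mu> c)) \<noteq> \<infinity>" by simp
qed

lemma measure_mu_atMost:
  assumes c: "summable c" "\<And>n. 0 \<le> c n"
  shows "measure (\<mu> c) {..t} = (\<Sum>n. c n * R (Suc n) t)"
proof -
  have "emeasure (\<mu> c) {..t} = (\<Sum>n. ennreal (c n) * ennreal (R (Suc n) t))"
    by (simp add: emeasure_mu R_simps finite_measure.emeasure_eq_measure[OF prob_space.finite_measure[OF prob_space_rho]])
  also have "\<dots> = ennreal (\<Sum>n. c n * R (Suc n) t)"
    by (rule suminf_ennreal_bounded(1)[OF c R_nonneg R_le_1])
  finally show ?thesis
    using c R_nonneg suminf_ennreal_bounded(2)[OF c R_nonneg R_le_1] by (simp add: measure_def suminf_nonneg)
qed

lemma kernel_convolution_mu: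
  assumes c: "summable c" "\<And>n. 0 \<le> c n" and [measurable]: "g \<in> borel_measurable borel"
  shows "ennreal b * (\<integral>\<^sup>+y. g y \<partial>\<mu> c) + (\<integral>\<^sup>+y. (\<integral>\<^sup>+s. ennreal (levy_kernel \<nu> s) * g (s + y) \<partial>lborel) \<partial>\<mu> c) =
    (\<integral>\<^sup>+t. ennreal (lam * (\<Sum>n. c n * Q n t)) * g t \<partial>lborel)"
proof -
  let ?K = "\<lambda>y. \<integral>\<^sup>+s. ennreal (levy_kernel \<nu> s) * g (s + y) \<partial>lborel"
  have lin: "a * (\<Sum>n. x n) + (\<Sum>n. z n) = (\<Sum>n. a * x n + z n)" for a :: ennreal and x z :: "nat \<Rightarrow> ennreal"
    unfolding ennreal_suminf_cmult[symmetric] by (intro suminf_add summableI)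
  have "ennreal b * (\<integral>\<^sup>+y. g y \<partial>\<mu> c) + (\<integral>\<^sup>+y. ?K y \<partial>\<mu> c) =
    (\<Sum>n. ennreal b * (ennreal (c n) * (\<integral>\<^sup>+y. g y \<partial>\<rho> n)) + ennreal (c n) * (\<integral>\<^sup>+y. ?K y \<partial>\<rho> n))"
    unfolding lin[symmetric] by (subst nn_integral_mu, measurable)+
  also have "\<dots> = (\<Sum>n. ennreal (c n) * (ennreal b * (\<integral>\<^sup>+y. g y \<partial>\<rho> n) + (\<integral>\<^sup>+y. ?K y \<partial>\<rho> n)))"
    by (simp only: distrib_left mult.left_commute)
  also have "\<dots> = (\<Sum>n. \<integral>\<^sup>+t. ennreal (c n) * (ennreal (lam * Q n t) * g t) \<partial>lborel)"
    by (subst kernel_convolution_rho) (auto simp: nn_integral_cmult)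
  also have "\<dots> = (\<integral>\<^sup>+t. (\<Sum>n. ennreal (c n) * (ennreal (lam * Q n t) * g t)) \<partial>lborel)"
    by (intro nn_integral_suminf[symmetric]) measurable
  also have "\<dots> = (\<integral>\<^sup>+t. ennreal (lam * (\<Sum>n. c n * Q n t)) * g t \<partial>lborel)"
  proof (rule nn_integral_cong)
    fix t :: real
    have "(\<Sum>n. ennreal (c n) * (ennreal (lam * Q n t) * g t)) = (\<Sum>n. ennreal lam * (ennreal (c n) * ennreal (Q n t)) * g t)"
      using lam Q_nonneg by (intro suminf_cong) (simp add: ennreal_mult ac_simps)
    also have "\<dots> = ennreal lam * (\<Sum>n. ennreal (c n) * ennreal (Q n t)) * g t"
      by (simp only: ennreal_suminf_multc ennreal_suminf_cmult)
    also have "\<dots> = ennreal (lam * (\<Sum>n. c n * Q n t)) * g t"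
      unfolding suminf_ennreal_bounded(1)[OF c Q_nonneg Q_le_1] using lam by (simp add: ennreal_mult')
    finally show "(\<Sum>n. ennreal (c n) * (ennreal (lam * Q n t) * g t)) = ennreal (lam * (\<Sum>n. c n * Q n t)) * g t" .
  qed
  finally show ?thesis .
qed

text \<open>\<open>R (Suc n)\<close> is the distribution function of \<rho> n, whose convolution
  with the kernel has density lam \<open>Q n\<close>; hence the drop of the index. Two nonnegative
  sequences are kept apart because the argument works with positive measures and absolute continuity
  is known only for the difference.\<close>

lemma CD_deriv_R_series:
  fixes c1 c2 :: "nat \<Rightarrow> real"
  assumes c1: "summable c1" "\<And>n. 0 \<le> c1 n" and c2: "summable c2" "\<And>n. 0 \<le> c2 n"
    and V: "\<And>t. t \<ge> 0 \<Longrightarrow> V t = (\<Sum>n. c1 n * R (Suc n) t) - (\<Sum>n. c2 n * R (Suc n) t)"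
    and ac: "loc_abs_continuous V"
  shows "AE t in lborel. t > 0 \<longrightarrow> CD_defined \<nu> V t \<and>
    CD_deriv b \<nu> V t = lam * ((\<Sum>n. c1 n * Q n t) - (\<Sum>n. c2 n * Q n t))"
proof -
  have pos: "emeasure (\<mu> c) {..0} = 0" for c by (subst emeasure_mu) (auto simp: emeasure_rho_nonpos)
  have nn: "0 \<le> lam * (\<Sum>n. c n * Q n t)" if "summable c" "\<And>n. 0 \<le> c n" for c t
    using lam that Q_nonneg suminf_ennreal_bounded(2)[OF that Q_nonneg Q_le_1] by (simp add: suminf_nonneg)
  have "AE t in lborel. t > 0 \<longrightarrow> CD_defined \<nu> V t \<and>
    CD_deriv b \<nu> V t = lam * (\<Sum>n. c1 n * Q n t) - lam * (\<Sum>n. c2 n * Q n t)"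
  proof (rule CD_deriv_of_distribution_functions[of "\<mu> c1" "\<mu> c2", folded levy_kernel_def])
    show "V t = measure (\<mu> c1) {..t} - measure (\<mu> c2) {..t}" if "t \<ge> 0" for t
      by (simp add: V[OF that] measure_mu_atMost[OF c1] measure_mu_atMost[OF c2])
    show "(\<lambda>t. lam * (\<Sum>n. c1 n * Q n t)) \<in> borel_measurable borel" "(\<lambda>t. lam * (\<Sum>n. c2 n * Q n t)) \<in> borel_measurable borel"
      by measurable
  qed (use finite_measure_mu c1 c2 pos ac b_nonneg nn kernel_convolution_mu nn_integral_levy_kernel_finite measurable_levy_kernel in auto)
  then show ?thesis by (simp add: right_diff_distrib)
qed

end

section \<open>Erlang series and densities\<close>

lemma erlang_density_nonneg_arg: "0 \<le> x \<Longrightarrow> erlang_density n \<eta> x = \<eta> * exp (- \<eta> * x) * ((\<eta> * x) ^ n /\<^sub>R fact n)"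
  by (simp add: erlang_density_def power_mult_distrib field_simps)

lemma summable_erlang_density: "0 \<le> x \<Longrightarrow> summable (\<lambda>n. erlang_density n \<eta> x)"
  unfolding erlang_density_nonneg_arg by (intro summable_mult summable_exp_generic)

text \<open>With exp(-\<eta> x) factored out, an everywhere convergent power series remains.
  Differentiating its terms \<eta>^(n+1) x^n / n! shifts the index of q by one and yields a factor
  \<eta>; the exponential contributes -\<eta> times the original series.\<close>

lemma erlang_series_has_derivative:
  fixes q :: "nat \<Rightarrow> real"
  assumes q: "\<And>n. 0 \<le> q n" "\<And>n. q n \<le> 1" and \<eta>: "\<eta> > 0" and x: "x > 0"
  shows "((\<lambda>x. \<Sum>n. q n * erlang_density n \<eta> x) has_real_derivative
    \<eta> * ((\<Sum>n. q (Suc n) * erlang_density n \<eta> x) - (\<Sum>n. q n * erlang_density n \<eta> x))) (at x)"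
proof -
  define a where "a n = q n * (\<eta> ^ Suc n / fact n)" for n
  define b where "b n = q (Suc n) * (\<eta> ^ Suc n / fact n)" for n
  have ser: "(\<Sum>n. u n * erlang_density n \<eta> y) = exp (- \<eta> * y) * (\<Sum>n. u n * (\<eta> ^ Suc n / fact n) * y ^ n)"
    "summable (\<lambda>n. u n * (\<eta> ^ Suc n / fact n) * y ^ n)"
    if u: "\<And>n. 0 \<le> u n" "\<And>n. u n \<le> 1" and y: "0 \<le> y" for u :: "nat \<Rightarrow> real" and y
  proof -
    have eq: "u n * erlang_density n \<eta> y = exp (- \<eta> * y) * (u n * (\<eta> ^ Suc n / fact n) * y ^ n)" for n
      using y by (simp add: erlang_density_def)
    have "summable (\<lambda>n. u n * erlang_density n \<eta> y)"
      by (rule summable_comparison_test'[OF summable_erlang_density[OF y, of \<eta>], of 0])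
        (use u \<eta> in \<open>auto simp: abs_mult mult_right_le_one_le mult_left_le_one_le\<close>)
    then show s: "summable (\<lambda>n. u n * (\<eta> ^ Suc n / fact n) * y ^ n)"
      unfolding eq by (subst (asm) summable_cmult_iff) simp
    show "(\<Sum>n. u n * erlang_density n \<eta> y) = exp (- \<eta> * y) * (\<Sum>n. u n * (\<eta> ^ Suc n / fact n) * y ^ n)"
      unfolding eq by (rule suminf_mult[OF s])
  qed
  have sum_a: "summable (\<lambda>n. a n * y ^ n)" for y
  \<comment> \<open>The comparison with Erlang densities gives convergence only at nonnegative
    arguments; convergence at |y| + 1 implies it at y of either sign.\<close>
  proof (rule powser_insidea[where x="\<bar>y\<bar> + 1", THEN summable_norm_cancel])
    show "summable (\<lambda>n. a n * (\<bar>y\<bar> + 1) ^ n)" unfolding a_def by (rule ser(2)[OF q]) auto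
  qed auto
  have diffs_a: "diffs a n = \<eta> * b n" for n
    unfolding diffs_def a_def b_def fact_Suc power_Suc of_nat_mult of_nat_fact
    by (simp del: of_nat_Suc)
  have "((\<lambda>y. exp (- \<eta> * y) * (\<Sum>n. a n * y ^ n)) has_real_derivative
     exp (- \<eta> * x) * (\<Sum>n. diffs a n * x ^ n) + (- \<eta> * exp (- \<eta> * x)) * (\<Sum>n. a n * x ^ n)) (at x)"
    by (rule derivative_eq_intros termdiffs_strong_converges_everywhere[OF sum_a] refl | simp)+
  moreover have "exp (- \<eta> * x) * (\<Sum>n. diffs a n * x ^ n) = \<eta> * (\<Sum>n. q (Suc n) * erlang_density n \<eta> x)"
  proof -
    have sb: "summable (\<lambda>n. b n * x ^ n)" unfolding b_def by (rule ser(2)) (use q x in auto)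
    have "(\<Sum>n. diffs a n * x ^ n) = \<eta> * (\<Sum>n. b n * x ^ n)"
      unfolding diffs_a mult.assoc by (rule suminf_mult[OF sb])
    then show ?thesis using ser(1)[of "\<lambda>n. q (Suc n)" x] q x by (simp add: b_def)
  qed
  moreover have "exp (- \<eta> * x) * (\<Sum>n. a n * x ^ n) = (\<Sum>n. q n * erlang_density n \<eta> x)"
    using ser(1)[OF q, of x] x by (simp add: a_def)
  ultimately have "((\<lambda>y. exp (- \<eta> * y) * (\<Sum>n. a n * y ^ n)) has_real_derivative
     \<eta> * ((\<Sum>n. q (Suc n) * erlang_density n \<eta> x) - (\<Sum>n. q n * erlang_density n \<eta> x))) (at x)"
    by (simp add: algebra_simps)
  then show ?thesis
  proof (rule has_field_derivative_transform_within_open[where S="{0<..}"])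
    show "exp (- \<eta> * y) * (\<Sum>n. a n * y ^ n) = (\<Sum>n. q n * erlang_density n \<eta> y)" if "y \<in> {0<..}" for y
      using ser(1)[OF q, of y] that by (simp add: a_def)
  qed (use x in auto)
qed

text \<open>Densities of the same law agree almost everywhere. By continuity the set where they
  differ is open, and an open null set is empty.\<close>

lemma has_continuous_pdf_pos_unique:
  assumes p: "has_continuous_pdf_pos M Y p" and p': "has_continuous_pdf_pos M Y p'" and x: "x > 0"
  shows "p x = p' x"
proof -
  have meas: "(\<lambda>y. ennreal (indicator {0<..} y * r y)) \<in> borel_measurable borel"
    if "continuous_on {0<..} r" for r :: "real \<Rightarrow> real"
  proof -
    have "set_borel_measurable borel {0<..} r"
      by (rule borel_measurable_continuous_on_indicator[OF _ that, folded set_borel_measurable_def]) simp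
    then show ?thesis unfolding set_borel_measurable_def by simp
  qed
  note c = p[unfolded has_continuous_pdf_pos_def] and c' = p'[unfolded has_continuous_pdf_pos_def]
  have "density lborel (\<lambda>y. ennreal (indicator {0<..} y * p y)) = density lborel (\<lambda>y. ennreal (indicator {0<..} y * p' y))"
  proof (rule measure_eqI)
    fix A assume "A \<in> sets (density lborel (\<lambda>y. ennreal (indicator {0<..} y * p y)))"
    then have A: "A \<in> sets borel" by simp
    have "emeasure (density lborel (\<lambda>y. ennreal (indicator {0<..} y * r y))) A = emeasure M (Y -` (A \<inter> {0<..}) \<inter> space M)"
      if r: "has_continuous_pdf_pos M Y r" for r
    proof -
      note r' = r[unfolded has_continuous_pdf_pos_def]
      have "emeasure (density lborel (\<lambda>y. ennreal (indicator {0<..} y * r y))) A = (\<integral>\<^sup>+y. ennreal (indicator {0<..} y * r y) * indicator A y \<partial>lborel)"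
        using A meas r' by (subst emeasure_density) auto
      also have "\<dots> = (\<integral>\<^sup>+y\<in>A \<inter> {0<..}. ennreal (r y) \<partial>lborel)"
        by (intro nn_integral_cong) (auto simp: indicator_def)
      also have "\<dots> = emeasure M (Y -` (A \<inter> {0<..}) \<inter> space M)"
        using r' A by (metis Int_lower2 borel_open open_greaterThan sets.Int)
      finally show ?thesis .
    qed
    from this[OF p] this[OF p']
    show "emeasure (density lborel (\<lambda>y. ennreal (indicator {0<..} y * p y))) A = emeasure (density lborel (\<lambda>y. ennreal (indicator {0<..} y * p' y))) A"
      by simp
  qed simp
  then have "AE y in lborel. ennreal (indicator {0<..} y * p y) = ennreal (indicator {0<..} y * p' y)"
    using meas c c' by (intro sigma_finite_measure.density_unique[OF sigma_finite_lborel]) auto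
  then have ae: "AE y in lborel. y \<notin> {y\<in>{0<..}. p y \<noteq> p' y}"
    by eventually_elim (use c c' in auto)
  have op: "open {y\<in>{0<..}. p y \<noteq> p' y}"
  proof -
    have "continuous_on {0<..} (\<lambda>y. p y - p' y)" using c c' by (intro continuous_on_diff) auto
    then have "open ({0<..} \<inter> (\<lambda>y. p y - p' y) -` (- {0}))"
      by (rule continuous_open_preimage) auto
    moreover have "{0<..} \<inter> (\<lambda>y. p y - p' y) -` (- {0}) = {y\<in>{0<..}. p y \<noteq> p' y}" by auto
    ultimately show ?thesis by simp
  qed
  have "{y\<in>{0<..}. p y \<noteq> p' y} \<in> null_sets lborel"
    using ae op by (subst AE_iff_null_sets) auto
  then have "negligible {y\<in>{0<..}. p y \<noteq> p' y}"
    unfolding negligible_iff_null_sets by (rule null_sets_completionI)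
  then have "{y\<in>{0<..}. p y \<noteq> p' y} = {}" using op open_not_negligible by blast
  then show ?thesis using x by auto
qed

section \<open>The law of the compound process\<close>

lemma measurable_process_sigma:
  assumes "i \<in> I" "process_sigma M S I Z \<subseteq> sets F" "space F = space M" "\<And>\<omega>. \<omega> \<in> space M \<Longrightarrow> Z i \<omega> \<in> space S"
  shows "Z i \<in> measurable F S"
proof (rule measurableI)
  fix A assume "A \<in> sets S"
  then have "Z i -` A \<inter> space M \<in> process_sigma M S I Z"
    unfolding process_sigma_def using assms(1) by (intro sigma_sets.Basic) auto
  then show "Z i -` A \<inter> space F \<in> sets F" using assms(2,3) by auto
qed (use assms in auto)

locale compound_setting = inverse_time_setting M \<nu> b D lam
  for M :: "'a measure" and \<nu> :: "real measure" and b :: real and D :: "real \<Rightarrow> 'a \<Rightarrow> real" and lam :: real +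
  fixes \<eta> :: real and N :: "real \<Rightarrow> 'a \<Rightarrow> nat" and X :: "nat \<Rightarrow> 'a \<Rightarrow> real"
  assumes eta: "\<eta> > 0"
    and poisson: "poisson_process M lam N"
    and indep_N_E: "indep_set (process_sigma M (count_space UNIV) {0..} N) (process_sigma M borel {0..} E)"
    and indep_X: "indep_vars (\<lambda>_. borel) X {1..}"
    and X_exponential: "\<And>i. i \<ge> 1 \<Longrightarrow> distributed M lborel (X i) (exponential_density \<eta>)"
    and indep_X_NE: "indep_set (process_sigma M borel {1..} X)
           (sigma_sets (space M) (process_sigma M (count_space UNIV) {0..} N \<union> process_sigma M borel {0..} E))"
begin

text \<open>The right end point of cell j of mesh 1/(n+1); \<open>Suc j\<close> rather than j makes
  \<open>grid n (grid_index n r)\<close> exceed r strictly.\<close>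

definition grid :: "nat \<Rightarrow> nat \<Rightarrow> real" where "grid n j = real (Suc j) / real (Suc n)"

definition grid_index :: "nat \<Rightarrow> real \<Rightarrow> nat" where "grid_index n r = nat \<lfloor>real (Suc n) * r\<rfloor>"

lemma measurable_grid_index [measurable]: "grid_index n \<in> measurable borel (count_space UNIV)"
  unfolding grid_index_def[abs_def] by measurable

lemma grid_grid_index: "0 \<le> r \<Longrightarrow> grid n (grid_index n r) = real_of_int (\<lfloor>real (Suc n) * r\<rfloor> + 1) / real (Suc n)"
  by (simp add: grid_def grid_index_def)

lemma grid_pos: "0 < grid n j" by (simp add: grid_def)

lemma filterlim_grid: "0 \<le> r \<Longrightarrow> filterlim (\<lambda>n. grid n (grid_index n r)) (at_right r) sequentially"
  using grid_tendsto_at_right[of r] by (simp only: grid_grid_index)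

lemma N_right_continuous:
  assumes "\<omega> \<in> space M" "0 \<le> r"
  shows "eventually (\<lambda>n. N (grid n (grid_index n r)) \<omega> = N r \<omega>) sequentially"
proof -
  have "((\<lambda>t. real (N t \<omega>)) \<longlongrightarrow> real (N r \<omega>)) (at_right r)"
    using poisson assms by (auto simp: poisson_process_def increasing_rcont_paths_def continuous_within)
  then have "(\<lambda>n. real (N (grid n (grid_index n r)) \<omega>)) \<longlonglongrightarrow> real (N r \<omega>)"
    by (rule filterlim_compose[OF _ filterlim_grid[OF assms(2)]])
  then have "eventually (\<lambda>n. dist (real (N (grid n (grid_index n r)) \<omega>)) (real (N r \<omega>)) < 1) sequentially"
    by (rule tendstoD) simp
  then show ?thesis by eventually_elim (simp add: dist_real_def)
qed

lemma prob_N: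
  assumes r: "r > 0"
  shows "prob {\<omega>\<in>space M. N r \<omega> = k} = poisson_weight k r"
proof -
  have [measurable]: "N r \<in> measurable M (count_space UNIV)" "N 0 \<in> measurable M (count_space UNIV)"
    using poisson r by (auto simp: poisson_process_def)
  have d: "distr M (count_space UNIV) (\<lambda>\<omega>. N (0 + r) \<omega> - N 0 \<omega>) = measure_pmf (poisson_pmf (lam * r))"
    using poisson r unfolding poisson_process_def by blast
  have N0: "AE \<omega> in M. N 0 \<omega> = 0" using poisson by (simp add: poisson_process_def)
  \<comment> \<open>The Poisson law is given for increments. As N 0 = 0 almost surely, the increment
    from 0 is N r, and the truncated subtraction of naturals does no harm.\<close>
  have "prob {\<omega>\<in>space M. N r \<omega> = k} = prob ((\<lambda>\<omega>. N (0 + r) \<omega> - N 0 \<omega>) -` {k} \<inter> space M)"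
    by (rule finite_measure_eq_AE, use N0 in eventually_elim) auto
  also have "\<dots> = measure (distr M (count_space UNIV) (\<lambda>\<omega>. N (0 + r) \<omega> - N 0 \<omega>)) {k}"
    by (subst measure_distr) auto
  also have "\<dots> = pmf (poisson_pmf (lam * r)) k" unfolding d by (simp add: pmf.rep_eq)
  also have "\<dots> = poisson_weight k r"
    using lam r by (simp add: poisson_weight_def field_simps)
  finally show ?thesis .
qed

text \<open>The sigma-algebra that the jumps are independent of. Events about N(E(t)) must be
  measurable with respect to it, not merely with respect to M, before independence can be
  used.\<close>

definition F :: "'a measure" where
  "F = sigma (space M) (process_sigma M (count_space UNIV) {0..} N \<union> process_sigma M borel {0..} E)"

lemma process_sigma_events:
  "process_sigma M (count_space UNIV) {0..} N \<subseteq> events" "process_sigma M borel {0..} E \<subseteq> events"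
  using indep_N_E unfolding indep_set_def indep_sets_def by (auto split: bool.splits)

lemma sets_F: "sets F = sigma_sets (space M) (process_sigma M (count_space UNIV) {0..} N \<union> process_sigma M borel {0..} E)"
  and space_F [simp]: "space F = space M"
proof -
  have "process_sigma M (count_space UNIV) {0..} N \<union> process_sigma M borel {0..} E \<subseteq> Pow (space M)"
    using process_sigma_events sets.sets_into_space by blast
  then show "sets F = sigma_sets (space M) (process_sigma M (count_space UNIV) {0..} N \<union> process_sigma M borel {0..} E)" "space F = space M"
    unfolding F_def by (auto simp: sets_measure_of space_measure_of)
qed

lemma sets_F_subset: "sets F \<subseteq> events"
  unfolding sets_F using process_sigma_events by (intro sets.sigma_sets_subset) auto

lemma measurable_F_imp: "g \<in> measurable F S \<Longrightarrow> g \<in> measurable M S"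
  using sets_F_subset by (auto simp: measurable_def)

lemma measurable_E_F: "t \<ge> 0 \<Longrightarrow> E t \<in> borel_measurable F"
  by (rule measurable_process_sigma[where I="{0..}" and M=M]) (auto simp: sets_F)

lemma measurable_N_F: "t \<ge> 0 \<Longrightarrow> N t \<in> measurable F (count_space UNIV)"
  by (rule measurable_process_sigma[where I="{0..}" and M=M]) (auto simp: sets_F)

text \<open>A process evaluated at a random time: rounding the time up to the grid leaves countably
  many cases, and by right-continuity of integer-valued paths the rounded values are eventually
  equal to the true one.\<close>

lemma measurable_NE_F:
  assumes t: "t \<ge> 0"
  shows "(\<lambda>\<omega>. N (E t \<omega>) \<omega>) \<in> measurable F (count_space UNIV)"
proof -
  note [measurable] = measurable_E_F[OF t] measurable_N_F[OF less_imp_le[OF grid_pos]]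
  have "(\<lambda>\<omega>. real (N (E t \<omega>) \<omega>)) \<in> borel_measurable F"
  proof (rule borel_measurable_LIMSEQ_real)
    show "(\<lambda>\<omega>. real (N (grid n (grid_index n (E t \<omega>))) \<omega>)) \<in> borel_measurable F" for n
      by (rule measurable_compose_countable[where f="\<lambda>j \<omega>. real (N (grid n j) \<omega>)" and g="\<lambda>\<omega>. grid_index n (E t \<omega>)"]) measurable
    fix \<omega> assume "\<omega> \<in> space F"
    then show "(\<lambda>n. real (N (grid n (grid_index n (E t \<omega>))) \<omega>)) \<longlonglongrightarrow> real (N (E t \<omega>) \<omega>)"
      using N_right_continuous[of \<omega> "E t \<omega>"] inverse_subordinator_nonneg
      by (intro tendsto_eventually) (auto elim!: eventually_mono)
  qed
  then have "(\<lambda>\<omega>. nat \<lfloor>real (N (E t \<omega>) \<omega>)\<rfloor>) \<in> measurable F (count_space UNIV)" by measurable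
  then show ?thesis by simp
qed

text \<open>Conditioning on the grid cell of the random time; right-continuity of the paths of \<open>N\<close> removes
  the discretization.\<close>

lemma prob_NE:
  assumes t: "t \<ge> 0"
  shows "prob {\<omega>\<in>space M. N (E t \<omega>) \<omega> = k} = q k t"
proof -
  note E_meas [measurable] = measurable_E[OF t]
  have N_meas [measurable]: "N (grid n j) \<in> measurable M (count_space UNIV)" for n j
    by (rule measurable_F_imp[OF measurable_N_F]) (simp add: grid_pos less_imp_le)
  have NE_meas [measurable]: "(\<lambda>\<omega>. N (E t \<omega>) \<omega>) \<in> measurable M (count_space UNIV)"
    by (rule measurable_F_imp[OF measurable_NE_F[OF t]])
  let ?J = "\<lambda>n \<omega>. grid_index n (E t \<omega>)"
  have NJ_meas [measurable]: "(\<lambda>\<omega>. N (grid n (?J n \<omega>)) \<omega>) \<in> measurable M (count_space UNIV)" for n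
    by (rule measurable_compose_countable[where f="\<lambda>j \<omega>. N (grid n j) \<omega>" and g="?J n"]) measurable
  have weight: "0 \<le> poisson_weight k (grid n j)" "poisson_weight k (grid n j) \<le> 1" for n j
    using grid_pos[of n j] by (auto intro!: poisson_weight_nonneg poisson_weight_le_1)
  have disc: "prob {\<omega>\<in>space M. N (grid n (?J n \<omega>)) \<omega> = k} = expectation (\<lambda>\<omega>. poisson_weight k (grid n (?J n \<omega>)))" for n
  proof -
    have "emeasure M {\<omega>\<in>space M. N (grid n (?J n \<omega>)) \<omega> = k} =
      emeasure M (\<Union>j. {\<omega>\<in>space M. N (grid n j) \<omega> = k} \<inter> {\<omega>\<in>space M. ?J n \<omega> = j})"
      by (rule arg_cong[where f="emeasure M"]) auto
    also have "\<dots> = (\<Sum>j. emeasure M ({\<omega>\<in>space M. N (grid n j) \<omega> = k} \<inter> {\<omega>\<in>space M. ?J n \<omega> = j}))"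
      by (intro suminf_emeasure[symmetric]) (auto simp: disjoint_family_on_def)
    \<comment> \<open>On each cell the random time is replaced by a deterministic one, so
      independence of N and E applies to an event about N at a fixed time and an event about E
      t.\<close>
    also have "\<dots> = (\<Sum>j. ennreal (poisson_weight k (grid n j)) * emeasure M {\<omega>\<in>space M. ?J n \<omega> = j})"
    proof (rule suminf_cong)
      fix j
      have a: "{\<omega>\<in>space M. N (grid n j) \<omega> = k} \<in> process_sigma M (count_space UNIV) {0..} N"
        unfolding process_sigma_def
        by (intro sigma_sets.Basic UN_I[of "grid n j"] CollectI exI[of _ "{k}"]) (auto simp: grid_pos less_imp_le)
      have "{\<omega>\<in>space M. ?J n \<omega> = j} = E t -` {r. grid_index n r = j} \<inter> space M" by auto
      moreover have "{r. grid_index n r = j} \<in> sets borel" by measurable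
      ultimately have b: "{\<omega>\<in>space M. ?J n \<omega> = j} \<in> process_sigma M borel {0..} E"
        unfolding process_sigma_def using t by (intro sigma_sets.Basic UN_I[of t] CollectI exI[of _ "{r. grid_index n r = j}"]) auto
      show "emeasure M ({\<omega>\<in>space M. N (grid n j) \<omega> = k} \<inter> {\<omega>\<in>space M. ?J n \<omega> = j}) = ennreal (poisson_weight k (grid n j)) * emeasure M {\<omega>\<in>space M. ?J n \<omega> = j}"
        unfolding emeasure_eq_measure indep_setD[OF indep_N_E a b] prob_N[OF grid_pos]
        using weight by (simp add: ennreal_mult)
    qed
    also have "\<dots> = (\<Sum>j. \<integral>\<^sup>+\<omega>. ennreal (poisson_weight k (grid n j)) * indicator {\<omega>\<in>space M. ?J n \<omega> = j} \<omega> \<partial>M)"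
      by (subst nn_integral_cmult_indicator) auto
    also have "\<dots> = (\<integral>\<^sup>+\<omega>. (\<Sum>j. ennreal (poisson_weight k (grid n j)) * indicator {\<omega>\<in>space M. ?J n \<omega> = j} \<omega>) \<partial>M)"
      by (intro nn_integral_suminf[symmetric]) measurable
    also have "\<dots> = (\<integral>\<^sup>+\<omega>. ennreal (poisson_weight k (grid n (?J n \<omega>))) \<partial>M)"
    proof (rule nn_integral_cong)
      fix \<omega> assume "\<omega> \<in> space M"
      then show "(\<Sum>j. ennreal (poisson_weight k (grid n j)) * indicator {\<omega>\<in>space M. ?J n \<omega> = j} \<omega>) = ennreal (poisson_weight k (grid n (?J n \<omega>)))"
        by (subst suminf_finite[of "{?J n \<omega>}"]) (auto simp: indicator_def)
    qed
    also have "\<dots> = ennreal (expectation (\<lambda>\<omega>. poisson_weight k (grid n (?J n \<omega>))))"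
      using weight by (intro nn_integral_eq_integral integrable_const_bound[where B=1]) auto
    finally show ?thesis
      using weight by (subst (asm) emeasure_eq_measure, subst (asm) ennreal_inj) (auto intro!: integral_nonneg_AE)
  qed
  have "(\<lambda>n. expectation (\<lambda>\<omega>. poisson_weight k (grid n (?J n \<omega>)))) \<longlonglongrightarrow> expectation (\<lambda>\<omega>. poisson_weight k (E t \<omega>))"
  proof (rule integral_dominated_convergence[where w="\<lambda>_. 1"])
    show "AE \<omega> in M. (\<lambda>n. poisson_weight k (grid n (?J n \<omega>))) \<longlonglongrightarrow> poisson_weight k (E t \<omega>)"
    proof (intro always_eventually allI)
      fix \<omega>
      have "filterlim (\<lambda>n. grid n (?J n \<omega>)) (nhds (E t \<omega>)) sequentially"
        using filterlim_grid[OF inverse_subordinator_nonneg[of t \<omega>]] by (rule filterlim_mono) (auto simp: at_within_le_nhds)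
      moreover have "isCont (poisson_weight k) (E t \<omega>)"
        unfolding poisson_weight_def[abs_def] by (intro continuous_intros) auto
      ultimately show "(\<lambda>n. poisson_weight k (grid n (?J n \<omega>))) \<longlonglongrightarrow> poisson_weight k (E t \<omega>)"
        by (rule isCont_tendsto_compose[rotated])
    qed
  qed (use weight in auto)
  moreover have "(\<lambda>n. prob {\<omega>\<in>space M. N (grid n (?J n \<omega>)) \<omega> = k}) \<longlonglongrightarrow> prob {\<omega>\<in>space M. N (E t \<omega>) \<omega> = k}"
  proof -
    have "(\<lambda>n. LINT \<omega>|M. indicat_real {\<omega>\<in>space M. N (grid n (?J n \<omega>)) \<omega> = k} \<omega>) \<longlonglongrightarrow> (LINT \<omega>|M. indicat_real {\<omega>\<in>space M. N (E t \<omega>) \<omega> = k} \<omega>)"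
    proof (rule integral_dominated_convergence[where w="\<lambda>_. 1"])
      show "AE \<omega> in M. (\<lambda>n. indicat_real {\<omega>\<in>space M. N (grid n (?J n \<omega>)) \<omega> = k} \<omega>) \<longlonglongrightarrow> indicat_real {\<omega>\<in>space M. N (E t \<omega>) \<omega> = k} \<omega>"
      proof (rule AE_I2)
        fix \<omega> assume w: "\<omega> \<in> space M"
        have "eventually (\<lambda>n. indicat_real {\<omega>\<in>space M. N (grid n (?J n \<omega>)) \<omega> = k} \<omega> = indicat_real {\<omega>\<in>space M. N (E t \<omega>) \<omega> = k} \<omega>) sequentially"
          by (rule eventually_mono[OF N_right_continuous[OF w inverse_subordinator_nonneg[of t \<omega>]]]) (simp add: indicator_def)
        then show "(\<lambda>n. indicat_real {\<omega>\<in>space M. N (grid n (?J n \<omega>)) \<omega> = k} \<omega>) \<longlonglongrightarrow> indicat_real {\<omega>\<in>space M. N (E t \<omega>) \<omega> = k} \<omega>"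
          by (rule tendsto_eventually)
      qed
    qed auto
    then show ?thesis by (simp add: Int_absorb2)
  qed
  ultimately show ?thesis unfolding disc q_def using LIMSEQ_unique by blast
qed

section \<open>The law of the compound process on the positive half-line\<close>

abbreviation Y :: "real \<Rightarrow> 'a \<Rightarrow> real" where "Y \<equiv> compound_process N E X"

lemma measurable_X: "i \<ge> 1 \<Longrightarrow> X i \<in> borel_measurable M"
  using distributed_measurable[OF X_exponential[of i]] by simp

lemma measurable_Y:
  assumes t: "t \<ge> 0"
  shows "Y t \<in> borel_measurable M"
proof -
  have "(\<lambda>\<omega>. \<Sum>i=1..N (E t \<omega>) \<omega>. X i \<omega>) \<in> borel_measurable M"
    by (rule measurable_compose_countable[where f="\<lambda>n \<omega>. \<Sum>i=1..n. X i \<omega>", OF _ measurable_F_imp[OF measurable_NE_F[OF t]]])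
      (auto intro!: borel_measurable_sum measurable_X)
  then show ?thesis by (simp add: compound_process_def[abs_def])
qed

text \<open>A set in the positive half-line excludes the empty sum, so the case N(E(t)) = 0 drops
  out and the counts start at n + 1. On N(E(t)) = n + 1 the process is a sum of n + 1 independent
  exponentials, independent of the count.\<close>

lemma emeasure_Y:
  assumes t: "t \<ge> 0" and A [measurable]: "A \<in> sets borel" and pos: "A \<subseteq> {0<..}"
  shows "emeasure M (Y t -` A \<inter> space M) = (\<Sum>n. ennreal (q (Suc n) t) * (\<integral>\<^sup>+x\<in>A. ennreal (erlang_density n \<eta> x) \<partial>lborel))"
proof -
  let ?G = "sigma (space M) (process_sigma M borel {1..} X)"
  have X_events: "process_sigma M borel {1..} X \<subseteq> events"
    using indep_X_NE unfolding indep_set_def indep_sets_def by (auto split: bool.splits)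
  have G: "sets ?G = process_sigma M borel {1..} X" "space ?G = space M"
  proof -
    have P: "process_sigma M borel {1..} X \<subseteq> Pow (space M)" using X_events sets.sets_into_space by blast
    have "sigma_sets (space M) (process_sigma M borel {1..} X) = process_sigma M borel {1..} X"
      unfolding process_sigma_def by (rule sigma_sets_sigma_sets_eq) auto
    then show "sets ?G = process_sigma M borel {1..} X" "space ?G = space M"
      using P by (auto simp: sets_measure_of space_measure_of)
  qed
  let ?S = "\<lambda>n \<omega>. \<Sum>i=1..Suc n. X i \<omega>"
  let ?a = "\<lambda>n. ?S n -` A \<inter> space M" and ?b = "\<lambda>n. {\<omega>\<in>space M. N (E t \<omega>) \<omega> = Suc n}"
  have a: "?a n \<in> process_sigma M borel {1..} X" for n
  proof -
    have "X i \<in> borel_measurable ?G" if "i \<ge> 1" for i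
      by (rule measurable_process_sigma[where I="{1..}" and M=M]) (use that G in auto)
    then have "?S n \<in> borel_measurable ?G" by (intro borel_measurable_sum) auto
    from measurable_sets[OF this A] show ?thesis unfolding G .
  qed
  have b: "?b n \<in> sigma_sets (space M) (process_sigma M (count_space UNIV) {0..} N \<union> process_sigma M borel {0..} E)" for n
  proof -
    have "(\<lambda>\<omega>. N (E t \<omega>) \<omega>) -` {Suc n} \<inter> space F \<in> sets F"
      by (rule measurable_sets[OF measurable_NE_F[OF t]]) simp
    moreover have "(\<lambda>\<omega>. N (E t \<omega>) \<omega>) -` {Suc n} \<inter> space F = ?b n" by auto
    ultimately show ?thesis unfolding sets_F by simp
  qed
  have ev: "?a n \<in> events" "?b n \<in> events" for n
    using a b X_events sets_F_subset sets_F by auto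
  have law_S: "emeasure M (?a n) = (\<integral>\<^sup>+x\<in>A. ennreal (erlang_density n \<eta> x) \<partial>lborel)" for n
  proof -
    have "distributed M lborel (?S n) (erlang_density (card {1..Suc n} - 1) \<eta>)"
      by (rule exponential_distributed_sum[OF _ _ eta X_exponential indep_vars_subset[OF indep_X]]) auto
    then have "distributed M lborel (?S n) (erlang_density n \<eta>)" by simp
    then show ?thesis by (rule distributed_emeasure) simp
  qed
  have "Y t -` A \<inter> space M = (\<Union>n. ?a n \<inter> ?b n)"
  proof (intro set_eqI iffI)
    fix \<omega> assume w: "\<omega> \<in> Y t -` A \<inter> space M"
    then have "Y t \<omega> > 0" using pos by auto
    then have "N (E t \<omega>) \<omega> \<noteq> 0" by (auto simp: compound_process_def intro: ccontr)
    then obtain n where "N (E t \<omega>) \<omega> = Suc n" using not0_implies_Suc by blast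
    then show "\<omega> \<in> (\<Union>n. ?a n \<inter> ?b n)" using w by (auto simp: compound_process_def)
  qed (auto simp: compound_process_def)
  then have "emeasure M (Y t -` A \<inter> space M) = (\<Sum>n. emeasure M (?a n \<inter> ?b n))"
    using ev by (simp only:) (intro suminf_emeasure[symmetric], auto simp: disjoint_family_on_def)
  also have "\<dots> = (\<Sum>n. emeasure M (?a n) * ennreal (q (Suc n) t))"
  proof (rule suminf_cong)
    show "emeasure M (?a n \<inter> ?b n) = emeasure M (?a n) * ennreal (q (Suc n) t)" for n
      unfolding emeasure_eq_measure indep_setD[OF indep_X_NE a b] prob_NE[OF t] by (intro ennreal_mult measure_nonneg q_nonneg)
  qed
  finally show ?thesis unfolding law_S by (simp only: mult.commute)
qed

definition P0 :: "real \<Rightarrow> real \<Rightarrow> real" where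
  "P0 x t = (\<Sum>n. q (Suc n) t * erlang_density n \<eta> x)"

lemma q_le_1: "t \<ge> 0 \<Longrightarrow> q n t \<le> 1" using Q_le_1[of n t] by (simp add: Q_eq_q)

lemma P0_has_derivative:
  "t \<ge> 0 \<Longrightarrow> x > 0 \<Longrightarrow> ((\<lambda>x. P0 x t) has_real_derivative
    \<eta> * ((\<Sum>n. q (Suc (Suc n)) t * erlang_density n \<eta> x) - (\<Sum>n. q (Suc n) t * erlang_density n \<eta> x))) (at x)"
  unfolding P0_def by (rule erlang_series_has_derivative[OF q_nonneg q_le_1 eta])

lemma suminf_q_erlang:
  assumes "t \<ge> 0" "x \<ge> 0"
  shows "(\<Sum>n. ennreal (q (Suc n) t) * ennreal (erlang_density n \<eta> x)) = ennreal (P0 x t)"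
  using suminf_ennreal_bounded(1)[OF summable_erlang_density[OF assms(2)], of \<eta> "\<lambda>n. q (Suc n) t"] eta q_nonneg q_le_1[OF assms(1)]
  by (simp add: P0_def mult.commute)

lemma has_continuous_pdf_pos_P0:
  assumes t: "t \<ge> 0"
  shows "has_continuous_pdf_pos M (Y t) (\<lambda>x. P0 x t)"
  unfolding has_continuous_pdf_pos_def
proof (intro conjI allI impI ballI)
  show "Y t \<in> borel_measurable M" by (rule measurable_Y[OF t])
  show "continuous_on {0<..} (\<lambda>x. P0 x t)"
    using P0_has_derivative[OF t] by (intro continuous_at_imp_continuous_on ballI) (auto intro: DERIV_isCont)
  show "0 \<le> P0 x t" if "x > 0" for x
  proof -
    have "summable (\<lambda>n. q (Suc n) t * erlang_density n \<eta> x)"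
      using suminf_ennreal_bounded(2)[OF summable_erlang_density[of x \<eta>], of "\<lambda>n. q (Suc n) t"] that eta q_nonneg q_le_1[OF t]
      by (simp add: mult.commute)
    then show ?thesis unfolding P0_def using eta q_nonneg by (intro suminf_nonneg) auto
  qed
  fix A :: "real set" assume A [measurable]: "A \<in> sets borel" and pos: "A \<subseteq> {0<..}"
  have "emeasure M (Y t -` A \<inter> space M) = (\<Sum>n. ennreal (q (Suc n) t) * (\<integral>\<^sup>+x\<in>A. ennreal (erlang_density n \<eta> x) \<partial>lborel))"
    by (rule emeasure_Y[OF t A pos])
  also have "\<dots> = (\<Sum>n. \<integral>\<^sup>+x. ennreal (q (Suc n) t) * (ennreal (erlang_density n \<eta> x) * indicator A x) \<partial>lborel)"
    by (intro suminf_cong nn_integral_cmult[symmetric]) measurable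
  also have "\<dots> = (\<integral>\<^sup>+x. (\<Sum>n. ennreal (q (Suc n) t) * (ennreal (erlang_density n \<eta> x) * indicator A x)) \<partial>lborel)"
    by (intro nn_integral_suminf[symmetric]) measurable
  also have "\<dots> = (\<integral>\<^sup>+x\<in>A. ennreal (P0 x t) \<partial>lborel)"
  proof (rule nn_integral_cong)
    fix x
    have "(\<Sum>n. ennreal (q (Suc n) t) * (ennreal (erlang_density n \<eta> x) * indicator A x)) = (\<Sum>n. ennreal (q (Suc n) t) * ennreal (erlang_density n \<eta> x)) * indicator A x"
      by (simp only: mult.assoc[symmetric] ennreal_suminf_multc)
    then show "(\<Sum>n. ennreal (q (Suc n) t) * (ennreal (erlang_density n \<eta> x) * indicator A x)) = ennreal (P0 x t) * indicator A x"
      using suminf_q_erlang[OF t, of x] pos by (cases "x \<in> A") auto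
  qed
  finally show "emeasure M (Y t -` A \<inter> space M) = (\<integral>\<^sup>+x\<in>A. ennreal (P0 x t) \<partial>lborel)" .
qed

text \<open>Each Erlang law has full mass on the positive half-line, so \<open>emeasure_Y\<close>
  adds up the probabilities of N(E(t)) \<ge> 1. The complement has probability q 0 t, the mean of
  exp(-lam E(t)).\<close>

lemma prob_Y_pos:
  assumes t: "t \<ge> 0"
  shows "prob {\<omega>\<in>space M. Y t \<omega> > 0} = 1 - expectation (\<lambda>\<omega>. exp (- lam * E t \<omega>))"
proof -
  have NE [measurable]: "(\<lambda>\<omega>. N (E t \<omega>) \<omega>) \<in> measurable M (count_space UNIV)"
    by (rule measurable_F_imp[OF measurable_NE_F[OF t]])
  have one: "(\<integral>\<^sup>+x\<in>{0<..}. ennreal (erlang_density n \<eta> x) \<partial>lborel) = 1" for n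
  proof -
    have "(\<integral>\<^sup>+x\<in>{0<..}. ennreal (erlang_density n \<eta> x) \<partial>lborel) = (\<integral>\<^sup>+x. ennreal (erlang_density n \<eta> x) \<partial>lborel)"
      using AE_lborel_singleton[of 0]
      by (intro nn_integral_cong_AE, eventually_elim) (auto simp: indicator_def erlang_density_def)
    then show ?thesis using nn_integral_erlang_density_UNIV[OF eta] by simp
  qed
  have "{\<omega>\<in>space M. Y t \<omega> > 0} = Y t -` {0<..} \<inter> space M" by auto
  then have "emeasure M {\<omega>\<in>space M. Y t \<omega> > 0} = (\<Sum>n. emeasure M {\<omega>\<in>space M. N (E t \<omega>) \<omega> = Suc n})"
    using emeasure_Y[OF t, of "{0<..}"] by (simp add: one prob_NE[OF t] emeasure_eq_measure)
  also have "\<dots> = emeasure M (\<Union>n. {\<omega>\<in>space M. N (E t \<omega>) \<omega> = Suc n})"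
    by (intro suminf_emeasure) (auto simp: disjoint_family_on_def)
  also have "(\<Union>n. {\<omega>\<in>space M. N (E t \<omega>) \<omega> = Suc n}) = space M - {\<omega>\<in>space M. N (E t \<omega>) \<omega> = 0}"
    using not0_implies_Suc by auto
  finally have "prob {\<omega>\<in>space M. Y t \<omega> > 0} = prob (space M - {\<omega>\<in>space M. N (E t \<omega>) \<omega> = 0})"
    by (simp add: measure_def)
  also have "\<dots> = 1 - q 0 t" by (subst prob_compl) (auto simp: prob_NE[OF t])
  finally show ?thesis by (simp add: q_def poisson_weight_def)
qed

lemma P0_time_0: "P0 x 0 = 0"
proof -
  have "q (Suc n) 0 = 0" for n
  proof -
    have "q (Suc n) 0 = expectation (\<lambda>\<omega>. 0)"
      unfolding q_def
    proof (rule integral_cong_AE)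
      show "AE \<omega> in M. poisson_weight (Suc n) (E 0 \<omega>) = 0"
        using AE_inverse_subordinator_0 by eventually_elim (simp add: poisson_weight_def)
    qed (use measurable_E[of 0] in auto)
    then show ?thesis by simp
  qed
  then show ?thesis by (simp add: P0_def)
qed

end

section \<open>The fractional equation\<close>

text \<open>Moves an index shift from the functions to the coefficients, so that sums over x (n + k)
  take the form required by \<open>CD_deriv_R_series\<close>.\<close>

definition shift_seq :: "nat \<Rightarrow> (nat \<Rightarrow> real) \<Rightarrow> nat \<Rightarrow> real" where
  "shift_seq k e n = (if n < k then 0 else e (n - k))"

lemma shift_seq_add [simp]: "shift_seq k e (n + k) = e n"
  by (simp add: shift_seq_def)

lemma shift_seq_nonneg: "(\<And>n. 0 \<le> e n) \<Longrightarrow> 0 \<le> shift_seq k e n"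
  by (simp add: shift_seq_def)

lemma summable_shift_seq: "summable e \<Longrightarrow> summable (shift_seq k e)"
  using summable_iff_shift[of "shift_seq k e" k] by simp

lemma suminf_shift_seq:
  assumes "summable (\<lambda>n. e n * x (n + k))"
  shows "summable (\<lambda>n. shift_seq k e n * x n)" "(\<Sum>n. shift_seq k e n * x n) = (\<Sum>n. e n * x (n + k))"
proof -
  show s: "summable (\<lambda>n. shift_seq k e n * x n)"
    using summable_iff_shift[of "\<lambda>n. shift_seq k e n * x n" k] assms by simp
  have "(\<Sum>n<k. shift_seq k e n * x n) = 0" by (simp add: shift_seq_def)
  then show "(\<Sum>n. shift_seq k e n * x n) = (\<Sum>n. e n * x (n + k))"
    using suminf_split_initial_segment[OF s, of k] by simp
qed

context compound_setting
begin

lemma series_relations: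
  assumes x: "x > 0" and t: "t \<ge> 0" and P: "\<And>x. x > 0 \<Longrightarrow> p x = P0 x t"
  defines "e \<equiv> \<lambda>n. erlang_density n \<eta> x"
  shows "p differentiable (at x)"
    and "p x = (\<Sum>n. e n * Q (n + 1) t)"
    and "deriv p x = \<eta> * ((\<Sum>n. e n * Q (n + 2) t) - (\<Sum>n. e n * Q (n + 1) t))"
proof -
  have "(p has_real_derivative \<eta> * ((\<Sum>n. q (Suc (Suc n)) t * e n) - (\<Sum>n. q (Suc n) t * e n))) (at x)"
    using P0_has_derivative[OF t x] unfolding e_def
    by (rule has_field_derivative_transform_within_open[where S="{0<..}"]) (use x P in auto)
  then show "p differentiable (at x)" "deriv p x = \<eta> * ((\<Sum>n. e n * Q (n + 2) t) - (\<Sum>n. e n * Q (n + 1) t))"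
    by (auto simp: real_differentiable_def DERIV_imp_deriv Q_eq_q[OF t] mult.commute)
  show "p x = (\<Sum>n. e n * Q (n + 1) t)"
    using P[OF x] by (simp add: P0_def Q_eq_q[OF t] e_def mult.commute)
qed

text \<open>Let r_k and u_k be the sums of e n R (n+k) and of e n Q (n+k), so u_k = r_k - r_(k+1).
  Then P = u_1 = r_1 - r_2, and its x-derivative is \<eta> (u_2 - u_1) = \<eta> (2 r_2 - r_1 - r_3).
  The operator replaces r_(k+1) by lam u_k, giving lam (u_0 - u_1) and lam \<eta> (2 u_1 - u_0 -
  u_2). In the equation the terms with u_2 cancel.\<close>

lemma density_CD_equation:
  assumes x: "x > 0" and P: "\<And>t x. t \<ge> 0 \<Longrightarrow> x > 0 \<Longrightarrow> P x t = P0 x t"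
    and ac: "loc_abs_continuous (\<lambda>t. P x t)" "loc_abs_continuous (\<lambda>t. deriv (\<lambda>y. P y t) x)"
  shows "AE t in lborel. t > 0 \<longrightarrow>
    CD_defined \<nu> (\<lambda>t. P x t) t \<and> CD_defined \<nu> (\<lambda>t. deriv (\<lambda>y. P y t) x) t \<and>
    \<eta> * CD_deriv b \<nu> (\<lambda>t. P x t) t =
      - (lam * deriv (\<lambda>y. P y t) x + CD_deriv b \<nu> (\<lambda>t. deriv (\<lambda>y. P y t) x) t)"
proof -
  define e where "e n = erlang_density n \<eta> x" for n
  have e: "summable e" "0 \<le> e n" for n
    using x eta summable_erlang_density[of x \<eta>] by (auto simp: e_def[abs_def])
  have eR: "summable (\<lambda>n. e n * R (k n) t)" and eQ: "summable (\<lambda>n. e n * Q (k n) t)" for k t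
    using suminf_ennreal_bounded(2)[OF e, of "\<lambda>n. R (k n) t"] suminf_ennreal_bounded(2)[OF e, of "\<lambda>n. Q (k n) t"]
      R_nonneg R_le_1 Q_nonneg Q_le_1 by auto
  define r where "r k t = (\<Sum>n. e n * R (n + k) t)" for k t
  define u where "u k t = (\<Sum>n. e n * Q (n + k) t)" for k t
  have u_r: "u k t = r k t - r (Suc k) t" for k t
    unfolding u_def r_def Q_def by (subst suminf_diff[OF eR eR]) (simp add: right_diff_distrib)
  have sR: "summable (\<lambda>n. shift_seq k e n * R (Suc n) t)" "(\<Sum>n. shift_seq k e n * R (Suc n) t) = r (Suc k) t" for k t
    using suminf_shift_seq[of e "\<lambda>n. R (Suc n) t" k] eR by (simp_all add: r_def)
  have sQ: "summable (\<lambda>n. shift_seq k e n * Q n t)" "(\<Sum>n. shift_seq k e n * Q n t) = u k t" for k t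
    using suminf_shift_seq[of e "\<lambda>n. Q n t" k] eQ by (simp_all add: u_def)
  have s0: "shift_seq 0 e = e" by (simp add: shift_seq_def fun_eq_iff)
  have Px: "P x t = u 1 t" "deriv (\<lambda>y. P y t) x = \<eta> * (u 2 t - u 1 t)" if "t \<ge> 0" for t
    using series_relations[OF x that, of "\<lambda>y. P y t"] P[OF that] by (auto simp: u_def e_def)
  have AE1: "AE t in lborel. t > 0 \<longrightarrow> CD_defined \<nu> (\<lambda>t. P x t) t \<and>
    CD_deriv b \<nu> (\<lambda>t. P x t) t = lam * ((\<Sum>n. e n * Q n t) - (\<Sum>n. shift_seq 1 e n * Q n t))"
    by (rule CD_deriv_R_series[OF e summable_shift_seq[OF e(1)] shift_seq_nonneg[OF e(2)] _ ac(1)])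
      (use sR(2)[of 0] sR(2)[of 1] in \<open>simp add: Px u_r s0 numeral_2_eq_2\<close>)
  \<comment> \<open>The positive and negative coefficients in \<eta> (2 r_2 - r_1 - r_3), kept apart
    as two nonnegative sequences.\<close>
  let ?c1 = "\<lambda>n. 2 * \<eta> * shift_seq 1 e n" and ?c2 = "\<lambda>n. \<eta> * e n + \<eta> * shift_seq 2 e n"
  have c: "summable ?c1" "summable ?c2" "0 \<le> ?c1 n" "0 \<le> ?c2 n" for n
    using e summable_shift_seq[OF e(1)] shift_seq_nonneg[OF e(2)] eta
    by (auto intro!: summable_mult summable_add add_nonneg_nonneg mult_nonneg_nonneg)
  have c1: "(\<Sum>n. ?c1 n * y n) = 2 * \<eta> * (\<Sum>n. shift_seq 1 e n * y n)" if "summable (\<lambda>n. shift_seq 1 e n * y n)" for y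
    unfolding mult.assoc[of "2 * \<eta>"] by (rule suminf_mult[OF that])
  have c2: "(\<Sum>n. ?c2 n * y n) = \<eta> * (\<Sum>n. e n * y n) + \<eta> * (\<Sum>n. shift_seq 2 e n * y n)"
    if s: "summable (\<lambda>n. e n * y n)" "summable (\<lambda>n. shift_seq 2 e n * y n)" for y
    unfolding distrib_right mult.assoc suminf_mult[OF s(1), symmetric] suminf_mult[OF s(2), symmetric]
    by (intro suminf_add[symmetric] summable_mult s)
  have AE2: "AE t in lborel. t > 0 \<longrightarrow> CD_defined \<nu> (\<lambda>t. deriv (\<lambda>y. P y t) x) t \<and>
    CD_deriv b \<nu> (\<lambda>t. deriv (\<lambda>y. P y t) x) t = lam * ((\<Sum>n. ?c1 n * Q n t) - (\<Sum>n. ?c2 n * Q n t))"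
  proof (rule CD_deriv_R_series[OF c(1,3) c(2,4) _ ac(2)])
    fix t :: real assume t: "t \<ge> 0"
    show "deriv (\<lambda>y. P y t) x = (\<Sum>n. ?c1 n * R (Suc n) t) - (\<Sum>n. ?c2 n * R (Suc n) t)"
      unfolding Px(2)[OF t] c1[OF sR(1)] c2[OF eR sR(1)] sR(2)
      using sR(2)[of 0 t] by (simp add: s0 u_r algebra_simps numeral_2_eq_2)
  qed
  from AE1 AE2 show ?thesis
  proof (eventually_elim, intro impI)
    fix t :: real
    assume 1: "t > 0 \<longrightarrow> CD_defined \<nu> (\<lambda>t. P x t) t \<and>
        CD_deriv b \<nu> (\<lambda>t. P x t) t = lam * ((\<Sum>n. e n * Q n t) - (\<Sum>n. shift_seq 1 e n * Q n t))"
      and 2: "t > 0 \<longrightarrow> CD_defined \<nu> (\<lambda>t. deriv (\<lambda>y. P y t) x) t \<and>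
        CD_deriv b \<nu> (\<lambda>t. deriv (\<lambda>y. P y t) x) t = lam * ((\<Sum>n. ?c1 n * Q n t) - (\<Sum>n. ?c2 n * Q n t))"
      and t: "t > 0"
    have u0: "(\<Sum>n. e n * Q n t) = u 0 t" by (simp add: u_def)
    have C1: "CD_deriv b \<nu> (\<lambda>t. P x t) t = lam * (u 0 t - u 1 t)"
      using 1 t by (simp add: u0 sQ(2))
    have C2: "CD_deriv b \<nu> (\<lambda>t. deriv (\<lambda>y. P y t) x) t = lam * (2 * \<eta> * u 1 t - (\<eta> * u 0 t + \<eta> * u 2 t))"
      using 2 t unfolding c1[OF sQ(1)] c2[OF eQ sQ(1)] sQ(2) u0 by simp
    have "\<eta> * CD_deriv b \<nu> (\<lambda>t. P x t) t = - (lam * deriv (\<lambda>y. P y t) x + CD_deriv b \<nu> (\<lambda>t. deriv (\<lambda>y. P y t) x) t)"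
      unfolding C1 C2 Px(2)[OF less_imp_le[OF t]] by (simp add: algebra_simps)
    with 1 2 t show "CD_defined \<nu> (\<lambda>t. P x t) t \<and> CD_defined \<nu> (\<lambda>t. deriv (\<lambda>y. P y t) x) t \<and>
      \<eta> * CD_deriv b \<nu> (\<lambda>t. P x t) t = - (lam * deriv (\<lambda>y. P y t) x + CD_deriv b \<nu> (\<lambda>t. deriv (\<lambda>y. P y t) x) t)"
      by blast
  qed
qed

end

theorem theorem4p1:
  fixes M :: "'a measure" and \<nu> :: "real measure" and b lam \<eta> :: real
    and D E Y :: "real \<Rightarrow> 'a \<Rightarrow> real" and N :: "real \<Rightarrow> 'a \<Rightarrow> nat" and X :: "nat \<Rightarrow> 'a \<Rightarrow> real"
  assumes "prob_space M"
    and "b \<ge> 0" and "levy_measure_pos \<nu>" and "lam > 0" and "\<eta> > 0"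
    and "levy_subordinator M D"
    and "\<And>s t. s > 0 \<Longrightarrow> t \<ge> 0 \<Longrightarrow>
           prob_space.expectation M (\<lambda>\<omega>. exp (- s * D t \<omega>)) = exp (- t * bernstein_fun b \<nu> s)"
    and E_eq: "E = inverse_subordinator D"
    and "poisson_process M lam N"
    and "prob_space.indep_set M
           (process_sigma M (count_space UNIV) {0..} N) (process_sigma M borel {0..} E)"
    and "prob_space.indep_vars M (\<lambda>_. borel) X {1..}"
    and "\<And>i. i \<ge> 1 \<Longrightarrow> distributed M lborel (X i) (exponential_density \<eta>)"
    and "prob_space.indep_set M (process_sigma M borel {1..} X)
           (sigma_sets (space M) (process_sigma M (count_space UNIV) {0..} N \<union>
                                  process_sigma M borel {0..} E))"
    and Y_eq: "Y = compound_process N E X"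
  shows "(\<exists>P. \<forall>t\<ge>0. has_continuous_pdf_pos M (Y t) (\<lambda>x. P x t)) \<and>
    (\<forall>P. (\<forall>t\<ge>0. has_continuous_pdf_pos M (Y t) (\<lambda>x. P x t)) \<longrightarrow>
       (\<forall>t\<ge>0. \<forall>x>0. (\<lambda>y. P y t) differentiable (at x)) \<and>
       (\<forall>x>0. loc_abs_continuous (\<lambda>t. P x t) \<longrightarrow>
              loc_abs_continuous (\<lambda>t. deriv (\<lambda>y. P y t) x) \<longrightarrow>
         (AE t in lborel. t > 0 \<longrightarrow>
            CD_defined \<nu> (\<lambda>t. P x t) t \<and>
            CD_defined \<nu> (\<lambda>t. deriv (\<lambda>y. P y t) x) t \<and>
            \<eta> * CD_deriv b \<nu> (\<lambda>t. P x t) t =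
              - (lam * deriv (\<lambda>y. P y t) x + CD_deriv b \<nu> (\<lambda>t. deriv (\<lambda>y. P y t) x) t))) \<and>
       (\<forall>x>0. P x 0 = 0)) \<and>
    (\<forall>t\<ge>0. prob_space.prob M {\<omega> \<in> space M. Y t \<omega> > 0} =
            1 - prob_space.expectation M (\<lambda>\<omega>. exp (- lam * E t \<omega>)))"
proof -
  interpret prob_space M by (rule assms(1))
  interpret levy_measure \<nu> b using assms(2,3) by unfold_locales
  interpret subordinator_setting M \<nu> b D using assms(6,7) by unfold_locales
  \<comment> \<open>Measurability of each E t is extracted from the independence hypothesis, which
    includes that the sigma-algebra of E consists of events.\<close>
  have events: "process_sigma M borel {0..} (inverse_subordinator D) \<subseteq> events"
    using assms(10) unfolding E_eq indep_set_def indep_sets_def by (auto split: bool.splits)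
  interpret inverse_time_setting M \<nu> b D lam
  proof
    show "lam > 0" by (rule assms(4))
    show "inverse_subordinator D t \<in> borel_measurable M" if "t \<ge> 0" for t
      by (rule measurable_process_sigma[OF _ events]) (use that in auto)
  qed
  interpret compound_setting M \<nu> b D lam \<eta> N X
    using assms(5,9-13) unfolding E_eq by unfold_locales
  have Y: "Y t = compound_process N (inverse_subordinator D) X t" for t by (simp add: Y_eq E_eq)
  show ?thesis unfolding Y unfolding E_eq
  proof (intro conjI allI impI)
    show "\<exists>P. \<forall>t\<ge>0. has_continuous_pdf_pos M (compound_process N (inverse_subordinator D) X t) (\<lambda>x. P x t)"
      using has_continuous_pdf_pos_P0 by blast
  next
    fix P :: "real \<Rightarrow> real \<Rightarrow> real"
    assume P: "\<forall>t\<ge>0. has_continuous_pdf_pos M (compound_process N (inverse_subordinator D) X t) (\<lambda>x. P x t)"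
    \<comment> \<open>Continuity identifies an arbitrary admissible P with the Erlang series
      \<open>P0\<close>, so every claim about P can be checked on that series.\<close>
    have eq: "P x t = P0 x t" if "t \<ge> 0" "x > 0" for x t
      using has_continuous_pdf_pos_unique[of M _ "\<lambda>x. P x t" "\<lambda>x. P0 x t" x] P has_continuous_pdf_pos_P0 that by blast
    show "(\<lambda>y. P y t) differentiable (at x)" if "t \<ge> 0" "x > 0" for t x
      using series_relations(1)[OF that(2,1), of "\<lambda>y. P y t"] eq[OF that(1)] by simp
    show "P x 0 = 0" if "x > 0" for x using eq[of 0 x] that by (simp add: P0_time_0)
    show "AE t in lborel. t > 0 \<longrightarrow>
            CD_defined \<nu> (\<lambda>t. P x t) t \<and>
            CD_defined \<nu> (\<lambda>t. deriv (\<lambda>y. P y t) x) t \<and>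
            \<eta> * CD_deriv b \<nu> (\<lambda>t. P x t) t =
              - (lam * deriv (\<lambda>y. P y t) x + CD_deriv b \<nu> (\<lambda>t. deriv (\<lambda>y. P y t) x) t)"
      if "x > 0" "loc_abs_continuous (\<lambda>t. P x t)" "loc_abs_continuous (\<lambda>t. deriv (\<lambda>y. P y t) x)" for x
      using density_CD_equation[OF that(1) eq that(2,3)] by blast
  next
    show "prob {\<omega> \<in> space M. compound_process N (inverse_subordinator D) X t \<omega> > 0} =
        1 - expectation (\<lambda>\<omega>. exp (- lam * inverse_subordinator D t \<omega>))" if "t \<ge> 0" for t
      by (rule prob_Y_pos[OF that])
  qed
qed

end
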